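(* Given an NMDA $\mathcal{A}$ over $\Sigma$ (with arbitrary rational discount factors greater than $1$) and a threshold $\nu\in\mathbb{Q}$, it is decidable in polynomial time whether there exists a nonempty finite word $u\in\Sigma^+$ with $\mathcal{A}(u)<\nu$.
   Context: An NMDA over a finite alphabet $\Sigma$ is a tuple $\mathcal{A}=\langle \Sigma,Q,\iota,\delta,\gamma,\rho\rangle$ with finite state set $Q$, initial states $\iota\subseteq Q$, transition relation $\delta\subseteq Q\times\Sigma\times Q$, weight function $\gamma:\delta\to\mathbb{Q}$ and discount-factor function $\rho:\delta\to\mathbb{Q}\cap(1,\infty)$; NMDAs are assumed complete (every state has at least one outgoing transition on every letter). A run on $u=\sigma_0\cdots\sigma_{n-1}$ is $p_0,\sigma_0,p_1,\ldots,p_n$ with $p_0\in\iota$ and $t_i=(p_i,\sigma_i,p_{i+1})\in\delta$; its value is $\sum_{i=0}^{n-1}\gamma(t_i)\prod_{j<i}\frac{1}{\rho(t_j)}$, and $\mathcal{A}(u)$ is the minimum of values of runs on $u$. Input size is measured by the maximum of the number of transitions and the maximal binary length of any weight, discount factor, or of the threshold. *)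

theory Defs
  imports
    Complex_Main
    "HOL-Library.Extended_Real"
    "HOL-Library.Log_Nat"
    "HOL-Computational_Algebra.Polynomial"
begin

section \<open>Nondeterministic discounted-sum automata with multiple discount factors\<close>

record ('q, 'a) nmda =
  alphabet :: "'a set"
  states :: "'q set"
  initial :: "'q set"
  trans :: "('q \<times> 'a \<times> 'q) set"
  weight :: "'q \<times> 'a \<times> 'q \<Rightarrow> rat"
  discount :: "'q \<times> 'a \<times> 'q \<Rightarrow> rat"

text \<open>The values of \<^const>\<open>weight\<close> and \<^const>\<open>discount\<close> outside \<^const>\<open>trans\<close> are irrelevant.\<close>

definition is_nmda :: "('q, 'a) nmda \<Rightarrow> bool" where
  "is_nmda A \<longleftrightarrow>
     finite (alphabet A) \<and> finite (states A) \<and>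
     initial A \<subseteq> states A \<and>
     trans A \<subseteq> states A \<times> alphabet A \<times> states A \<and>
     (\<forall>t \<in> trans A. 1 < discount A t) \<and>
     (\<forall>q \<in> states A. \<forall>a \<in> alphabet A. \<exists>q'. (q, a, q') \<in> trans A)"

text \<open>A run on \<open>u\<close> is given by its sequence of states; the letters are those of \<open>u\<close>.\<close>

definition runs :: "('q, 'a) nmda \<Rightarrow> 'a list \<Rightarrow> 'q list set" where
  "runs A u = {ps. length ps = Suc (length u) \<and> ps ! 0 \<in> initial A \<and>
     (\<forall>i < length u. (ps ! i, u ! i, ps ! Suc i) \<in> trans A)}"

definition run_value :: "('q, 'a) nmda \<Rightarrow> 'a list \<Rightarrow> 'q list \<Rightarrow> rat" where
  "run_value A u ps =
     (let t = (\<lambda>i. (ps ! i, u ! i, ps ! Suc i))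
      in \<Sum>i < length u. weight A (t i) * (\<Prod>j < i. 1 / discount A (t j)))"

text \<open>By completeness, a word over the alphabet has no run only if there is no initial state;
  the minimum over the empty set is then \<open>\<infinity>\<close>.\<close>

definition nmda_value :: "('q, 'a) nmda \<Rightarrow> 'a list \<Rightarrow> ereal" where
  "nmda_value A u =
     (if runs A u = {} then \<infinity> else ereal (of_rat (Min (run_value A u ` runs A u))))"


section \<open>Deterministic multitape Turing machines and polynomial time\<close>

datatype dir = Lft | Stay | Rgt

text \<open>States and tape symbols are initial segments of the natural numbers.
  State \<open>0\<close> is the start state and symbol \<open>0\<close> is the blank. A transition maps the current state
  and the list of scanned symbols to the new state and, for each tape, the symbol to be written
  and the head movement.\<close>

record tm =
  tm_tapes :: nat
  tm_symbols :: nat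
  tm_states :: nat
  tm_acc :: nat
  tm_rej :: nat
  tm_delta :: "nat \<Rightarrow> nat list \<Rightarrow> nat \<times> (nat \<times> dir) list"

definition is_tm :: "tm \<Rightarrow> bool" where
  "is_tm M \<longleftrightarrow>
     0 < tm_tapes M \<and> 0 < tm_symbols M \<and> 0 < tm_states M \<and>
     tm_acc M < tm_states M \<and> tm_rej M < tm_states M \<and> tm_acc M \<noteq> tm_rej M \<and>
     (\<forall>q ss. q < tm_states M \<and> length ss = tm_tapes M \<and> set ss \<subseteq> {..<tm_symbols M} \<longrightarrow>
        (case tm_delta M q ss of (q', as) \<Rightarrow>
           q' < tm_states M \<and> length as = tm_tapes M \<and> fst ` set as \<subseteq> {..<tm_symbols M}))"

text \<open>A two-way infinite tape, together with the position of its head.\<close>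

type_synonym tape = "(int \<Rightarrow> nat) \<times> int"

type_synonym tm_config = "nat \<times> tape list"

fun tape_read :: "tape \<Rightarrow> nat" where
  "tape_read (f, h) = f h"

fun tape_act :: "nat \<times> dir \<Rightarrow> tape \<Rightarrow> tape" where
  "tape_act (s, d) (f, h) =
     (f(h := s), case d of Lft \<Rightarrow> h - 1 | Stay \<Rightarrow> h | Rgt \<Rightarrow> h + 1)"

fun tm_step :: "tm \<Rightarrow> tm_config \<Rightarrow> tm_config" where
  "tm_step M (q, tps) =
     (if q = tm_acc M \<or> q = tm_rej M then (q, tps)
      else case tm_delta M q (map tape_read tps) of (q', as) \<Rightarrow> (q', map2 tape_act as tps))"

definition blank_tape :: tape where
  "blank_tape = (\<lambda>_. 0, 0)"

definition input_tape :: "nat list \<Rightarrow> tape" where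
  "input_tape w = (\<lambda>i. if 0 \<le> i \<and> i < int (length w) then w ! nat i else 0, 0)"

definition tm_init :: "tm \<Rightarrow> nat list \<Rightarrow> tm_config" where
  "tm_init M w = (0, input_tape w # replicate (tm_tapes M - 1) blank_tape)"

definition tm_state_after :: "tm \<Rightarrow> nat list \<Rightarrow> nat \<Rightarrow> nat" where
  "tm_state_after M w t = fst ((tm_step M ^^ t) (tm_init M w))"

text \<open>A decision problem is given by its instances, the strings encoding an instance (an instance
  may have several encodings, all of which have to be handled), the size of an instance, and
  the property to be decided. Accepting and rejecting states are never left, so the existence of
  a suitable \<open>t\<close> below the bound means that the machine halts within the bound with the correct
  answer.\<close>

definition ptime_decidable ::
  "'i set \<Rightarrow> ('i \<Rightarrow> nat list \<Rightarrow> bool) \<Rightarrow> ('i \<Rightarrow> nat) \<Rightarrow> ('i \<Rightarrow> bool) \<Rightarrow> bool" where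
  "ptime_decidable X encodes sz P \<longleftrightarrow>
     (\<exists>M (p :: nat poly). is_tm M \<and>
        (\<forall>x \<in> X. \<forall>w. encodes x w \<longrightarrow>
           set w \<subseteq> {0<..<tm_symbols M} \<and>
           (\<exists>t \<le> poly p (sz x).
              tm_state_after M w t = (if P x then tm_acc M else tm_rej M))))"


section \<open>Size and encoding of an automaton with a threshold\<close>

text \<open>\<^term>\<open>floorlog 2 n\<close> is the number of binary digits of \<open>n\<close>.\<close>

definition rat_length :: "rat \<Rightarrow> nat" where
  "rat_length r = (case quotient_of r of (a, b) \<Rightarrow> floorlog 2 (nat \<bar>a\<bar>) + floorlog 2 (nat b))"

fun nmda_size :: "('q, 'a) nmda \<times> rat \<Rightarrow> nat" where
  "nmda_size (A, \<nu>) =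
     Max ({card (trans A), rat_length \<nu>} \<union> rat_length ` weight A ` trans A
          \<union> rat_length ` discount A ` trans A)"

text \<open>Input symbols: \<open>1\<close> and \<open>2\<close> are the binary digits zero and one, \<open>3\<close> ends a number,
  \<open>4\<close> ends a list, and \<open>5\<close> is the minus sign. Numbers are written in binary, most significant
  digit first, without leading zeros; in particular the digit string of \<open>0\<close> is empty.\<close>

definition nat_code :: "nat \<Rightarrow> nat list" where
  "nat_code n = map (\<lambda>i. if bit n i then 2 else 1) (rev [0..<floorlog 2 n]) @ [3]"

definition rat_code :: "rat \<Rightarrow> nat list" where
  "rat_code r = (case quotient_of r of (a, b) \<Rightarrow>
     (if a < 0 then [5] else []) @ nat_code (nat \<bar>a\<bar>) @ nat_code (nat b))"

text \<open>States and letters are represented by their numbers under arbitrary numberings \<open>f\<close> and \<open>g\<close>,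
  and initial states and transitions are listed in an arbitrary order. The numbers of states and
  letters come last because they are not bounded in terms of \<^const>\<open>nmda_size\<close> when there are no
  transitions.\<close>

fun nmda_encodes :: "('q, 'a) nmda \<times> rat \<Rightarrow> nat list \<Rightarrow> bool" where
  "nmda_encodes (A, \<nu>) w \<longleftrightarrow>
     (\<exists>f g is ts.
        bij_betw f (states A) {..<card (states A)} \<and>
        bij_betw g (alphabet A) {..<card (alphabet A)} \<and>
        distinct is \<and> set is = initial A \<and>
        distinct ts \<and> set ts = trans A \<and>
        w = rat_code \<nu> @
            concat (map (\<lambda>(p, a, q). nat_code (f p) @ nat_code (g a) @ nat_code (f q) @
                           rat_code (weight A (p, a, q)) @ rat_code (discount A (p, a, q))) ts) @
            [4] @
            concat (map (\<lambda>q. nat_code (f q)) is) @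
            [4] @
            nat_code (card (states A)) @ nat_code (card (alphabet A)))"

lemma nmda_encodes_exists:
  assumes "is_nmda A"
  shows "\<exists>w. nmda_encodes (A, \<nu>) w"
proof -
  have fin: "finite (states A)" "finite (alphabet A)"
    using assms by (auto simp: is_nmda_def)
  have "finite (initial A)" "finite (trans A)"
    using assms by (auto simp: is_nmda_def intro: finite_subset)
  then obtain "is" ts where "distinct is" "set is = initial A" "distinct ts" "set ts = trans A"
    by (meson finite_distinct_list)
  moreover obtain f where "bij_betw f (states A) {..<card (states A)}"
    using ex_bij_betw_finite_nat[OF fin(1)] by (auto simp: atLeast0LessThan)
  moreover obtain g where "bij_betw g (alphabet A) {..<card (alphabet A)}"
    using ex_bij_betw_finite_nat[OF fin(2)] by (auto simp: atLeast0LessThan)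
  ultimately show ?thesis
    unfolding nmda_encodes.simps by blast
qed

end

theory Submission imports Defs
begin

text \<open>Follow a run and keep track of the threshold that its remainder has to undercut: a transition of
  weight \<open>w\<close> and discount factor \<open>d\<close> turns the threshold \<open>x\<close> into \<open>(x - w) * d\<close>, and the value of the run
  is below \<open>\<nu>\<close> iff the threshold finally reached from \<open>\<nu>\<close> is positive. These maps are increasing with
  slope greater than \<open>1\<close>. The Bellman--Ford algorithm computes the largest thresholds reachable by walks
  of length \<open>1, \<dots>, m + 1\<close>, where \<open>m\<close> is the number of transitions. If the last round still
  yields an improvement for some state, then some cycle increases the threshold, and iterating it makes
  the threshold arbitrarily large since the slopes exceed \<open>1\<close>; otherwise the values
  computed so far dominate all walks. The numbers only grow by a polynomial number of bits.

  For the time bound, a While language on five stacks is compiled to Turing machines, and the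
  functions on binary trees computed by its programs in polynomial time are closed under composition,
  case distinction and folding over lists as long as the intermediate results have
  polynomial size.\<close>

section \<open>A While language on stacks and its compilation\<close>

text \<open>With discount factors varying from edge to edge, runs ending in the same state have no
  common scale on which their values could be compared; the threshold still to be undercut is such a
  scale. As the threshold maps are increasing, only the largest threshold per state and length
  matters. Letters disappear, because the word is chosen together with the run. A walk with more
  edges than there are edge targets enters some state twice. Removing the cycle in between either
  costs nothing or exposes a cycle with positive gain. Such a gain never shrinks under repetition,
  so the growth is at least linear. Each table belongs to one exact length, hence a late entry is
  judged against all earlier tables and not just the preceding one. Two obstacles shape the
  complexity part. Iterating a polynomial-time step may blow up its state exponentially, so folds
  demand a bound on all intermediate states; fractions are never reduced, yet each round adds only a
  number of bits fixed by the input. Moreover the size is a maximum, which bounds the input length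
  only if there is a transition: completeness then limits states and letters by the number of
  transitions.\<close>

datatype com =
    Skip
  | Push nat nat
  | Pop nat
  | Seq com com  (infixr ";;" 60)
  | Cond nat "nat set" com com
  | While nat "nat set" com

type_synonym store = "nat \<Rightarrow> nat list"

definition peek :: "store \<Rightarrow> nat \<Rightarrow> nat" where
  "peek s r = (case s r of [] \<Rightarrow> 0 | x # _ \<Rightarrow> x)"

text \<open>The time is the exact number of machine steps of the compiled code: a push is two
  instructions, a conditional pays for its test and, if true, for the jump over the other branch,
  and a loop round pays for the test and the jump back.\<close>

inductive exec :: "com \<Rightarrow> store \<Rightarrow> nat \<Rightarrow> store \<Rightarrow> bool" where
  Skip: "exec Skip s 0 s"
| Push: "exec (Push r x) s 2 (s(r := x # s r))"
| Pop: "exec (Pop r) s 1 (s(r := tl (s r)))"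
| Seq: "exec a s t s' \<Longrightarrow> exec b s' t' s'' \<Longrightarrow> exec (a ;; b) s (t + t') s''"
| CondT: "peek s r \<in> X \<Longrightarrow> exec a s t s' \<Longrightarrow> exec (Cond r X a b) s (t + 2) s'"
| CondF: "peek s r \<notin> X \<Longrightarrow> exec b s t s' \<Longrightarrow> exec (Cond r X a b) s (t + 1) s'"
| WhileF: "peek s r \<notin> X \<Longrightarrow> exec (While r X a) s 1 s"
| WhileT: "peek s r \<in> X \<Longrightarrow> exec a s t s' \<Longrightarrow> exec (While r X a) s' t' s'' \<Longrightarrow>
    exec (While r X a) s (t + t' + 2) s''"

text \<open>There are five stacks and the symbols \<open>1, \<dots>, 5\<close>; symbol \<open>0\<close> (the blank) can only be
  tested for, where it stands for the empty stack.\<close>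

fun wf_com :: "com \<Rightarrow> bool" where
  "wf_com Skip \<longleftrightarrow> True"
| "wf_com (Push r x) \<longleftrightarrow> r < 5 \<and> 0 < x \<and> x < 6"
| "wf_com (Pop r) \<longleftrightarrow> r < 5"
| "wf_com (a ;; b) \<longleftrightarrow> wf_com a \<and> wf_com b"
| "wf_com (Cond r X a b) \<longleftrightarrow> r < 5 \<and> wf_com a \<and> wf_com b"
| "wf_com (While r X a) \<longleftrightarrow> r < 5 \<and> wf_com a"

datatype instr = Act nat "nat option" dir | Branch nat "nat set" nat nat

text \<open>The input word is a stack with its top at the left end, so stack \<open>0\<close> grows to the left
  while all others grow to the right. The head of a tape scans the top of its stack.\<close>

definition grow :: "nat \<Rightarrow> dir" where
  "grow r = (if r = 0 then Lft else Rgt)"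

definition shrink :: "nat \<Rightarrow> dir" where
  "shrink r = (if r = 0 then Rgt else Lft)"

text \<open>Jump targets are absolute, so \<open>n\<close> is the address at which the code will
  stand. A push first moves the head to the free cell and then writes;
  \<open>Branch r {} e e\<close> is an unconditional jump.\<close>

fun compile :: "nat \<Rightarrow> com \<Rightarrow> instr list" where
  "compile n Skip = []"
| "compile n (Push r x) = [Act r None (grow r), Act r (Some x) Stay]"
| "compile n (Pop r) = [Act r (Some 0) (shrink r)]"
| "compile n (a ;; b) = (let ca = compile n a in ca @ compile (n + length ca) b)"
| "compile n (Cond r X a b) =
    (let ca = compile (n + 1) a; m = n + 2 + length ca; cb = compile m b; e = m + length cb
     in Branch r X (n + 1) m # ca @ Branch r {} e e # cb)"
| "compile n (While r X a) =
    (let ca = compile (n + 1) a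
     in Branch r X (n + 1) (n + 2 + length ca) # ca @ [Branch r {} n n])"

fun instr_act :: "instr \<Rightarrow> nat list \<Rightarrow> nat \<Rightarrow> nat \<times> dir" where
  "instr_act (Act r x d) ss i =
    (if i = r then ((case x of None \<Rightarrow> ss ! i | Some y \<Rightarrow> y), d) else (ss ! i, Stay))"
| "instr_act (Branch r X m n) ss i = (ss ! i, Stay)"

fun instr_next :: "instr \<Rightarrow> nat \<Rightarrow> nat list \<Rightarrow> nat" where
  "instr_next (Act r x d) q ss = Suc q"
| "instr_next (Branch r X m n) q ss = (if ss ! r \<in> X then m else n)"

text \<open>Addresses serve as states: the one just past the program accepts and the next one
  rejects.\<close>

definition machine :: "instr list \<Rightarrow> tm" where
  "machine P = \<lparr>tm_tapes = 5, tm_symbols = 6, tm_states = length P + 2,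
     tm_acc = length P, tm_rej = Suc (length P),
     tm_delta = (\<lambda>q ss. if q < length P
       then (instr_next (P ! q) q ss, map (instr_act (P ! q) ss) [0..<5])
       else (q, map (\<lambda>i. (ss ! i, Stay)) [0..<5]))\<rparr>"

fun wf_instr :: "nat \<Rightarrow> instr \<Rightarrow> bool" where
  "wf_instr l (Act r x d) \<longleftrightarrow> (case x of None \<Rightarrow> True | Some y \<Rightarrow> y < 6)"
| "wf_instr l (Branch r X m n) \<longleftrightarrow> m \<le> l \<and> n \<le> l"

lemma wf_instr_mono: "wf_instr l i \<Longrightarrow> l \<le> l' \<Longrightarrow> wf_instr l' i"
  by (cases i) auto

lemma wf_compile:
  "wf_com c \<Longrightarrow> i \<in> set (compile n c) \<Longrightarrow> wf_instr (n + length (compile n c)) i"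
proof (induction c arbitrary: n)
  case (Seq a b)
  then show ?case
    by (fastforce simp: Let_def add.assoc intro: wf_instr_mono)
next
  case (Cond r X a b)
  let ?ca = "compile (n + 1) a"
  let ?cb = "compile (n + 2 + length ?ca) b"
  let ?l = "n + length (compile n (Cond r X a b))"
  from Cond.prems consider "i = Branch r X (n + 1) (n + 2 + length ?ca)" | "i \<in> set ?ca"
    | "i = Branch r {} ?l ?l" | "i \<in> set ?cb"
    by (auto simp: Let_def)
  then show ?case
  proof cases
    case 2
    then have "wf_instr (n + 1 + length ?ca) i"
      using Cond.IH(1)[of "n + 1"] Cond.prems(1) by simp
    then show ?thesis by (rule wf_instr_mono) (simp add: Let_def)
  next
    case 4
    then have "wf_instr (n + 2 + length ?ca + length ?cb) i"
      using Cond.IH(2)[of "n + 2 + length ?ca"] Cond.prems(1) by simp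
    then show ?thesis by (rule wf_instr_mono) (simp add: Let_def)
  qed (simp_all add: Let_def)
next
  case (While r X a)
  let ?ca = "compile (n + 1) a"
  from While.prems consider "i = Branch r X (n + 1) (n + 2 + length ?ca)" | "i \<in> set ?ca"
    | "i = Branch r {} n n"
    by (auto simp: Let_def)
  then show ?case
  proof cases
    case 2
    then have "wf_instr (n + 1 + length ?ca) i"
      using While.IH[of "n + 1"] While.prems(1) by simp
    then show ?thesis by (rule wf_instr_mono) (simp add: Let_def)
  qed (simp_all add: Let_def)
qed (auto split: option.splits)

lemma is_tm_machine:
  assumes "\<forall>i \<in> set P. wf_instr (Suc (length P)) i" "P \<noteq> []"
  shows "is_tm (machine P)"
proof -
  have "instr_next (P ! q) q ss < length P + 2 \<and>
      fst ` instr_act (P ! q) ss ` {0..<5} \<subseteq> {..<6}"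
    if "q < length P" "length ss = 5" "set ss \<subseteq> {..<6}" for q ss
  proof -
    have "wf_instr (Suc (length P)) (P ! q)"
      using assms that by auto
    moreover have "ss ! i \<in> {..<6}" if "i < 5" for i
      by (rule subsetD[OF \<open>set ss \<subseteq> {..<6}\<close> nth_mem]) (simp add: \<open>length ss = 5\<close> that)
    ultimately show ?thesis
      using that(1) by (cases "P ! q") (auto split: option.splits)
  qed
  moreover have "fst ` (\<lambda>i. (ss ! i, Stay)) ` {0..<5} \<subseteq> {..<6}"
    if "length ss = 5" "set ss \<subseteq> {..<6}" for ss :: "nat list"
    using that by (auto dest!: subsetD[OF _ nth_mem])
  ultimately have "case tm_delta (machine P) q ss of (q', as) \<Rightarrow>
      q' < length P + 2 \<and> length as = 5 \<and> fst ` set as \<subseteq> {..<6}"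
    if "q < length P + 2" "length ss = 5" "set ss \<subseteq> {..<6}" for q ss
    using that by (cases "q < length P") (simp_all add: machine_def)
  then show ?thesis
    using assms(2) by (simp add: is_tm_def machine_def)
qed

section \<open>Tapes as stacks\<close>

definition stack_sign :: "nat \<Rightarrow> int" where
  "stack_sign r = (if r = 0 then 1 else - 1)"

text \<open>All offsets from the head are constrained, so every cell outside the stack is blank and
  an empty stack shows symbol \<open>0\<close>.\<close>

fun stack_on :: "nat \<Rightarrow> nat list \<Rightarrow> tape \<Rightarrow> bool" where
  "stack_on r xs (f, h) \<longleftrightarrow>
    (\<forall>i. f (h + stack_sign r * i) = (if 0 \<le> i \<and> i < int (length xs) then xs ! nat i else 0))"

lemma stack_on_read:
  "stack_on r (s r) tp \<Longrightarrow> tape_read tp = peek s r"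
  by (cases tp) (auto simp: peek_def dest!: spec[where x = 0] split: list.splits)

lemma stack_on_push:
  assumes "stack_on r xs tp"
  shows "stack_on r (x # xs) (tape_act (x, Stay) (tape_act (tape_read tp, grow r) tp))"
proof -
  obtain f h where tp: "tp = (f, h)" by (cases tp)
  have *: "f (h + stack_sign r * i) = (if 0 \<le> i \<and> i < int (length xs) then xs ! nat i else 0)" for i
    using assms by (simp add: tp)
  let ?h = "h - stack_sign r"
  have act: "tape_act (x, Stay) (tape_act (tape_read tp, grow r) tp) = (f(?h := x), ?h)"
    by (simp add: tp grow_def stack_sign_def)
  have "(f(?h := x)) (?h + stack_sign r * i) =
      (if 0 \<le> i \<and> i < int (length (x # xs)) then (x # xs) ! nat i else 0)" for i
  proof (cases "i = 0")
    case False
    then have "?h + stack_sign r * i \<noteq> ?h" "?h + stack_sign r * i = h + stack_sign r * (i - 1)"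
      by (auto simp: stack_sign_def)
    then have "(f(?h := x)) (?h + stack_sign r * i) = f (h + stack_sign r * (i - 1))"
      by (metis fun_upd_other)
    moreover have "(x # xs) ! nat i = xs ! nat (i - 1)" if "0 \<le> i"
      using that False by (simp add: nth_Cons' nat_diff_distrib)
    ultimately show ?thesis
      using False *[of "i - 1"] by (auto simp del: fun_upd_apply)
  qed auto
  then show ?thesis by (simp add: act)
qed

lemma stack_on_pop:
  assumes "stack_on r xs tp"
  shows "stack_on r (tl xs) (tape_act (0, shrink r) tp)"
proof -
  obtain f h where tp: "tp = (f, h)" by (cases tp)
  have *: "f (h + stack_sign r * i) = (if 0 \<le> i \<and> i < int (length xs) then xs ! nat i else 0)" for i
    using assms by (simp add: tp)
  let ?h = "h + stack_sign r"
  have act: "tape_act (0, shrink r) tp = (f(h := 0), ?h)"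
    by (simp add: tp shrink_def stack_sign_def)
  have "(f(h := 0)) (?h + stack_sign r * i) =
      (if 0 \<le> i \<and> i < int (length (tl xs)) then tl xs ! nat i else 0)" for i
  proof (cases "i = -1")
    case False
    then have "?h + stack_sign r * i \<noteq> h" "?h + stack_sign r * i = h + stack_sign r * (i + 1)"
      by (auto simp: stack_sign_def algebra_simps)
    then have "(f(h := 0)) (?h + stack_sign r * i) = f (h + stack_sign r * (i + 1))"
      by (metis fun_upd_other)
    moreover have "tl xs ! nat i = xs ! nat (i + 1)" if "0 \<le> i" "i + 1 < length xs"
      using that by (simp add: nth_tl nat_add_distrib)
    ultimately show ?thesis
      using False *[of "i + 1"] by (auto simp del: fun_upd_apply)
  qed (auto simp: stack_sign_def)
  then show ?thesis by (simp add: act)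
qed

definition represents :: "store \<Rightarrow> tape list \<Rightarrow> bool" where
  "represents s tps \<longleftrightarrow> length tps = 5 \<and> (\<forall>r<5. stack_on r (s r) (tps ! r))"

lemma represents_update:
  "represents s tps \<Longrightarrow> r < 5 \<Longrightarrow> stack_on r xs tp \<Longrightarrow> represents (s(r := xs)) (tps[r := tp])"
  by (auto simp: represents_def nth_list_update)

lemma tape_act_read [simp]: "tape_act (tape_read tp, Stay) tp = tp"
  by (cases tp) auto

lemma tm_step_Act:
  assumes "q < length P" "P ! q = Act r x d" "r < 5" "length tps = 5"
  shows "tm_step (machine P) (q, tps) =
    (Suc q, tps[r := tape_act (case x of None \<Rightarrow> tape_read (tps ! r) | Some y \<Rightarrow> y, d) (tps ! r)])"
proof -
  have "map2 tape_act (map (instr_act (P ! q) (map tape_read tps)) [0..<5]) tps =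
      tps[r := tape_act (case x of None \<Rightarrow> tape_read (tps ! r) | Some y \<Rightarrow> y, d) (tps ! r)]"
    using assms by (intro nth_equalityI) (auto simp: nth_list_update split: option.splits)
  then show ?thesis
    using assms by (simp add: machine_def)
qed

lemma tm_step_Branch:
  assumes "q < length P" "P ! q = Branch r X m n" "r < 5" "represents s tps"
  shows "tm_step (machine P) (q, tps) = ((if peek s r \<in> X then m else n), tps)"
proof -
  have len: "length tps = 5"
    using assms(4) by (simp add: represents_def)
  have "map2 tape_act (map (instr_act (P ! q) (map tape_read tps)) [0..<5]) tps = tps"
    using assms len by (intro nth_equalityI) auto
  moreover have "tape_read (tps ! r) = peek s r"
    using assms(3,4) by (simp add: represents_def stack_on_read)
  ultimately show ?thesis
    using assms len by (simp add: machine_def)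
qed

declare tm_step.simps [simp del]

section \<open>Simulation of commands by the compiled code\<close>

definition code_at :: "instr list \<Rightarrow> nat \<Rightarrow> instr list \<Rightarrow> bool" where
  "code_at P n c \<longleftrightarrow> n + length c \<le> length P \<and> (\<forall>i < length c. P ! (n + i) = c ! i)"

lemma code_at_Nil [simp]: "code_at P n [] \<longleftrightarrow> n \<le> length P"
  by (simp add: code_at_def)

lemma code_at_Cons [simp]:
  "code_at P n (i # c) \<longleftrightarrow> n < length P \<and> P ! n = i \<and> code_at P (Suc n) c"
  by (auto simp: code_at_def nth_Cons' less_Suc_eq_0_disj)

lemma code_at_append [simp]:
  "code_at P n (c @ d) \<longleftrightarrow> code_at P n c \<and> code_at P (n + length c) d"
proof -
  have "(\<forall>i < length c + length d. P ! (n + i) = (c @ d) ! i) \<longleftrightarrow>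
      (\<forall>i < length c. P ! (n + i) = c ! i) \<and> (\<forall>i < length d. P ! (n + length c + i) = d ! i)"
    (is "?l \<longleftrightarrow> ?r")
  proof
    assume ?l
    then have "P ! (n + i) = c ! i" if "i < length c" for i
      using that by (auto simp: nth_append)
    moreover have "P ! (n + length c + i) = d ! i" if "i < length d" for i
      using \<open>?l\<close>[rule_format, of "length c + i"] that by (simp add: add.assoc)
    ultimately show ?r by auto
  next
    assume r: ?r
    show ?l
    proof (intro allI impI)
      fix i assume "i < length c + length d"
      then show "P ! (n + i) = (c @ d) ! i"
        using r by (cases "i < length c") (auto simp: nth_append dest!: spec[of _ "i - length c"])
    qed
  qed
  then show ?thesis by (auto simp: code_at_def)
qed

text \<open>The final tapes are hidden behind the store they represent, since their absolute head
  positions depend on the history.\<close>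

definition steps :: "instr list \<Rightarrow> nat \<Rightarrow> tape list \<Rightarrow> nat \<Rightarrow> nat \<Rightarrow> store \<Rightarrow> bool" where
  "steps P q tps t q' s' \<longleftrightarrow>
    (\<exists>tps'. (tm_step (machine P) ^^ t) (q, tps) = (q', tps') \<and> represents s' tps')"

lemma steps_0: "represents s tps \<Longrightarrow> steps P q tps 0 q s"
  by (simp add: steps_def)

lemma steps_Suc:
  "tm_step (machine P) (q, tps) = (q1, tps1) \<Longrightarrow> steps P q1 tps1 t q' s' \<Longrightarrow>
    steps P q tps (Suc t) q' s'"
  by (simp add: steps_def funpow_Suc_right del: funpow.simps)

lemma steps_trans:
  assumes "steps P q tps t q1 s1"
    and "\<And>tps1. represents s1 tps1 \<Longrightarrow> steps P q1 tps1 t' q' s'"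
  shows "steps P q tps (t + t') q' s'"
proof -
  obtain tps1 where 1: "(tm_step (machine P) ^^ t) (q, tps) = (q1, tps1)" "represents s1 tps1"
    using assms(1) by (auto simp: steps_def)
  obtain tps2 where "(tm_step (machine P) ^^ t') (q1, tps1) = (q', tps2)" "represents s' tps2"
    using assms(2)[OF 1(2)] by (auto simp: steps_def)
  then show ?thesis
    using 1(1) by (auto simp: steps_def funpow_add add.commute[of t])
qed

text \<open>Induction over the execution rather than the command: the remaining rounds of a loop are
  again an execution of the same loop, and the jump back returns to the same address
  \<open>n\<close>.\<close>

lemma compile_correct:
  assumes "exec c s t s'" "wf_com c" "code_at P n (compile n c)" "represents s tps"
  shows "steps P n tps t (n + length (compile n c)) s'"
  using assms
proof (induction arbitrary: n tps rule: exec.induct)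
  case (Skip s)
  then show ?case by (simp add: steps_0)
next
  case (Push r x s)
  then have len: "length tps = 5" and on: "stack_on r (s r) (tps ! r)" and r: "r < 5"
    by (auto simp: represents_def)
  let ?tp = "tape_act (x, Stay) (tape_act (tape_read (tps ! r), grow r) (tps ! r))"
  have "represents (s(r := x # s r)) (tps[r := ?tp])"
    using Push.prems r stack_on_push[OF on] by (simp add: represents_update)
  moreover have "tm_step (machine P) (n, tps) =
      (Suc n, tps[r := tape_act (tape_read (tps ! r), grow r) (tps ! r)])"
    using Push.prems tm_step_Act[of n P r None "grow r" tps] len by simp
  moreover have "tm_step (machine P) (Suc n, tps[r := tape_act (tape_read (tps ! r), grow r) (tps ! r)]) =
      (Suc (Suc n), tps[r := ?tp])"
    using Push.prems len
      tm_step_Act[of "Suc n" P r "Some x" Stay "tps[r := tape_act (tape_read (tps ! r), grow r) (tps ! r)]"]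
    by simp
  ultimately show ?case
    using steps_Suc[OF _ steps_Suc[OF _ steps_0]] by (auto simp: numeral_2_eq_2 simp del: fun_upd_apply)
next
  case (Pop r s)
  then have len: "length tps = 5" and on: "stack_on r (s r) (tps ! r)" and r: "r < 5"
    by (auto simp: represents_def)
  have "represents (s(r := tl (s r))) (tps[r := tape_act (0, shrink r) (tps ! r)])"
    using Pop.prems r stack_on_pop[OF on] by (simp add: represents_update)
  moreover have "tm_step (machine P) (n, tps) = (Suc n, tps[r := tape_act (0, shrink r) (tps ! r)])"
    using Pop.prems tm_step_Act[of n P r "Some 0" "shrink r" tps] len by simp
  ultimately show ?case
    using steps_Suc[OF _ steps_0] by (auto simp del: fun_upd_apply)
next
  case (Seq a s t s' b t' s'')
  let ?m = "n + length (compile n a)"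
  have "steps P n tps t ?m s'"
    using Seq.prems by (intro Seq.IH(1)) (simp_all add: Let_def)
  moreover have "steps P ?m tps1 t' (?m + length (compile ?m b)) s''" if "represents s' tps1" for tps1
    using Seq.prems that by (intro Seq.IH(2)) (simp_all add: Let_def)
  ultimately show ?case
    using steps_trans by (simp add: Let_def add.assoc)
next
  case (CondT s r X a t s' b)
  let ?ca = "compile (n + 1) a"
  let ?m = "n + 2 + length ?ca"
  let ?e = "?m + length (compile ?m b)"
  have code: "n < length P" "P ! n = Branch r X (n + 1) ?m" "code_at P (n + 1) ?ca"
      "n + 1 + length ?ca < length P" "P ! (n + 1 + length ?ca) = Branch r {} ?e ?e"
    using CondT.prems(2) by (auto simp: Let_def)
  have r: "r < 5" and a: "wf_com a" using CondT.prems by auto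
  have 1: "tm_step (machine P) (n, tps) = (n + 1, tps)"
    using tm_step_Branch[OF code(1,2) r CondT.prems(3)] CondT.hyps by simp
  have "steps P (n + 1) tps t (n + 1 + length ?ca) s'"
    using CondT.IH[OF a code(3) CondT.prems(3)] .
  then have "steps P (n + 1) tps (t + 1) ?e s'"
  proof (rule steps_trans)
    fix tps1 assume tps1: "represents s' tps1"
    have "tm_step (machine P) (n + 1 + length ?ca, tps1) = (?e, tps1)"
      using tm_step_Branch[OF code(4,5) r tps1] by simp
    from steps_Suc[OF this steps_0[OF tps1]] show "steps P (n + 1 + length ?ca) tps1 1 ?e s'"
      by simp
  qed
  from steps_Suc[OF 1 this] show ?case
    by (simp add: Let_def add.assoc)
next
  case (CondF s r X b t s' a)
  let ?ca = "compile (n + 1) a"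
  let ?m = "n + 2 + length ?ca"
  let ?e = "?m + length (compile ?m b)"
  have code: "n < length P" "P ! n = Branch r X (n + 1) ?m" "code_at P ?m (compile ?m b)"
    using CondF.prems(2) by (auto simp: Let_def)
  have r: "r < 5" and b: "wf_com b" using CondF.prems by auto
  have 1: "tm_step (machine P) (n, tps) = (?m, tps)"
    using tm_step_Branch[OF code(1,2) r CondF.prems(3)] CondF.hyps by simp
  from steps_Suc[OF 1 CondF.IH[OF b code(3) CondF.prems(3)]] show ?case
    by (simp add: Let_def add.assoc)
next
  case (WhileF s r X a)
  let ?ca = "compile (n + 1) a"
  have code: "n < length P" "P ! n = Branch r X (n + 1) (n + 2 + length ?ca)"
    using WhileF.prems(2) by (auto simp: Let_def)
  have r: "r < 5" using WhileF.prems by auto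
  have "tm_step (machine P) (n, tps) = (n + 2 + length ?ca, tps)"
    using tm_step_Branch[OF code(1,2) r WhileF.prems(3)] WhileF.hyps by simp
  from steps_Suc[OF this steps_0[OF WhileF.prems(3)]] show ?case
    by (simp add: Let_def)
next
  case (WhileT s r X a t s' t' s'')
  let ?ca = "compile (n + 1) a"
  let ?l = "n + 1 + length ?ca"
  have code: "n < length P" "P ! n = Branch r X (n + 1) (n + 2 + length ?ca)"
      "code_at P (n + 1) ?ca" "?l < length P" "P ! ?l = Branch r {} n n"
    using WhileT.prems(2) by (auto simp: Let_def)
  have r: "r < 5" and a: "wf_com a" using WhileT.prems by auto
  have 1: "tm_step (machine P) (n, tps) = (n + 1, tps)"
    using tm_step_Branch[OF code(1,2) r WhileT.prems(3)] WhileT.hyps by simp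
  have "steps P (n + 1) tps t ?l s'"
    using WhileT.IH(1)[OF a code(3) WhileT.prems(3)] .
  then have "steps P (n + 1) tps (t + (1 + t')) (n + length (compile n (While r X a))) s''"
  proof (rule steps_trans)
    fix tps1 assume tps1: "represents s' tps1"
    have "tm_step (machine P) (?l, tps1) = (n, tps1)"
      using tm_step_Branch[OF code(4,5) r tps1] by simp
    from steps_Suc[OF this WhileT.IH(2)[OF WhileT.prems(1,2) tps1]]
    show "steps P ?l tps1 (1 + t') (n + length (compile n (While r X a))) s''"
      by simp
  qed
  from steps_Suc[OF 1 this] show ?case
    by (simp add: ac_simps)
qed

definition input_store :: "nat list \<Rightarrow> store" where
  "input_store w = (\<lambda>r. if r = 0 then w else [])"

text \<open>The code of \<open>True\<close> starts with \<open>2\<close> and that of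
  \<open>False\<close> with \<open>1\<close>. With the extra instruction the program has length
  \<open>Suc l\<close>, so the two jump targets are the accepting and the rejecting state.\<close>

definition accept_machine :: "com \<Rightarrow> tm" where
  "accept_machine c = (let P = compile 0 c; l = length P
     in machine (P @ [Branch 1 {2} (Suc l) (Suc (Suc l))]))"

lemma is_tm_accept_machine: "wf_com c \<Longrightarrow> is_tm (accept_machine c)"
  unfolding accept_machine_def Let_def
  by (rule is_tm_machine) (auto intro: wf_instr_mono[OF wf_compile])

lemma accept_machine_halts:
  assumes "exec c (input_store w) t s" "wf_com c"
  shows "tm_state_after (accept_machine c) w (Suc t) =
    (if peek s 1 = 2 then tm_acc (accept_machine c) else tm_rej (accept_machine c))"
proof -
  let ?c = "compile 0 c" and ?M = "accept_machine c"
  let ?l = "length ?c"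
  let ?P = "?c @ [Branch 1 {2} (Suc ?l) (Suc (Suc ?l))]"
  have M: "?M = machine ?P" by (simp add: accept_machine_def Let_def)
  define tps where "tps = input_tape w # replicate 4 blank_tape"
  have init: "tm_init ?M w = (0, tps)"
    by (simp add: tm_init_def M machine_def tps_def)
  have "stack_on 0 w (input_tape w)"
    by (simp add: input_tape_def stack_sign_def)
  moreover have "stack_on r [] blank_tape" for r
    by (simp add: blank_tape_def)
  ultimately have rep: "represents (input_store w) tps"
    by (auto simp: represents_def input_store_def tps_def nth_Cons')
  have at: "code_at ?P 0 ?c"
    by (simp add: code_at_def nth_append)
  obtain tps' where t: "(tm_step ?M ^^ t) (0, tps) = (?l, tps')" "represents s tps'"
    using compile_correct[OF assms at rep] by (auto simp: steps_def M)
  have "tm_step ?M (?l, tps') = ((if peek s 1 \<in> {2} then Suc ?l else Suc (Suc ?l)), tps')"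
    unfolding M by (rule tm_step_Branch) (use t(2) in auto)
  then show ?thesis
    by (simp add: tm_state_after_def init t(1)) (simp add: M machine_def)
qed

inductive_cases exec_SkipE: "exec Skip s t s'"
inductive_cases exec_PushE: "exec (Push r x) s t s'"
inductive_cases exec_PopE: "exec (Pop r) s t s'"
inductive_cases exec_SeqE: "exec (a ;; b) s t s'"

text \<open>No step adds more than one symbol to a stack. This yields size bounds for free: what is
  computed in polynomial time has polynomial size.\<close>

lemma exec_length: "exec c s t s' \<Longrightarrow> length (s' r) \<le> length (s r) + t"
  by (induction rule: exec.induct) (auto split: if_splits)

section \<open>Executions within a time bound\<close>

definition reaches :: "com \<Rightarrow> store \<Rightarrow> nat \<Rightarrow> store \<Rightarrow> bool" where
  "reaches c s n s' \<longleftrightarrow> (\<exists>t\<le>n. exec c s t s')"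

lemma reaches_mono: "reaches c s m s' \<Longrightarrow> m \<le> n \<Longrightarrow> reaches c s n s'"
  by (auto simp: reaches_def intro: order_trans)

lemma reaches_Seq: "reaches a s m s' \<Longrightarrow> reaches b s' n s'' \<Longrightarrow> reaches (a ;; b) s (m + n) s''"
  unfolding reaches_def by (meson add_mono exec.Seq)

lemma reaches_Seq_within:
  "reaches a s m s' \<Longrightarrow> reaches b s' (n - m) s'' \<Longrightarrow> m \<le> n \<Longrightarrow> reaches (a ;; b) s n s''"
  using reaches_Seq[of a s m s' b "n - m"] by simp

lemma reaches_Skip [simp]: "reaches Skip s n s' \<longleftrightarrow> s' = s"
  by (auto simp: reaches_def intro: exec.Skip elim: exec_SkipE)

lemma reaches_Push [simp]: "reaches (Push r x) s n s' \<longleftrightarrow> 2 \<le> n \<and> s' = s(r := x # s r)"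
  by (auto simp: reaches_def intro: exec.Push elim: exec_PushE)

lemma reaches_Pop [simp]: "reaches (Pop r) s n s' \<longleftrightarrow> 1 \<le> n \<and> s' = s(r := tl (s r))"
  by (auto simp: reaches_def intro: exec.Pop[unfolded One_nat_def] elim: exec_PopE)

text \<open>Stated as an equivalence so that the simplifier executes straight-line code symbolically
  and leaves only arithmetic on the bound.\<close>

lemma reaches_Push_Seq [simp]:
  "reaches (Push r x ;; c) s n s' \<longleftrightarrow> 2 \<le> n \<and> reaches c (s(r := x # s r)) (n - 2) s'"
proof
  assume "reaches (Push r x ;; c) s n s'"
  then obtain t where "2 + t \<le> n" "exec c (s(r := x # s r)) t s'"
    by (auto simp: reaches_def elim!: exec_SeqE exec_PushE)
  then show "2 \<le> n \<and> reaches c (s(r := x # s r)) (n - 2) s'"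
    by (auto simp: reaches_def intro!: exI[of _ t])
qed (auto intro: reaches_Seq_within[where m = 2])

lemma reaches_Pop_Seq [simp]:
  "reaches (Pop r ;; c) s n s' \<longleftrightarrow> 1 \<le> n \<and> reaches c (s(r := tl (s r))) (n - 1) s'"
proof
  assume "reaches (Pop r ;; c) s n s'"
  then obtain t where "1 + t \<le> n" "exec c (s(r := tl (s r))) t s'"
    by (auto simp: reaches_def elim!: exec_SeqE exec_PopE)
  then show "1 \<le> n \<and> reaches c (s(r := tl (s r))) (n - 1) s'"
    by (auto simp: reaches_def intro!: exI[of _ t])
qed (auto intro: reaches_Seq_within[where m = 1])

lemma reaches_CondT:
  "peek s r \<in> X \<Longrightarrow> reaches a s n s' \<Longrightarrow> reaches (Cond r X a b) s (n + 2) s'"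
  unfolding reaches_def by (meson add_mono exec.CondT order_refl)

lemma reaches_CondF:
  "peek s r \<notin> X \<Longrightarrow> reaches b s n s' \<Longrightarrow> reaches (Cond r X a b) s (n + 1) s'"
  unfolding reaches_def by (meson add_mono exec.CondF order_refl)

lemma reaches_Cond:
  "(peek s r \<in> X \<Longrightarrow> reaches a s (n - 2) s') \<Longrightarrow> (peek s r \<notin> X \<Longrightarrow> reaches b s (n - 2) s') \<Longrightarrow>
    2 \<le> n \<Longrightarrow> reaches (Cond r X a b) s n s'"
  using reaches_CondT[of s r X a "n - 2" s' b] reaches_CondF[of s r X b "n - 2" s' a]
  by (cases "peek s r \<in> X") (auto intro: reaches_mono)

lemma reaches_WhileF: "peek s r \<notin> X \<Longrightarrow> 1 \<le> n \<Longrightarrow> reaches (While r X a) s n s"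
  unfolding reaches_def by (meson exec.WhileF)

lemma reaches_WhileT:
  assumes "peek s r \<in> X" "reaches a s m s'" "reaches (While r X a) s' n s''"
  shows "reaches (While r X a) s (m + n + 2) s''"
  using assms unfolding reaches_def by (meson add_mono exec.WhileT order_refl)

text \<open>Stack 1 holds the data, stacks 2 and 3 are used to move trees out of the way, and
  stack 4 is a unary counter.\<close>

definition st :: "nat list \<Rightarrow> nat list \<Rightarrow> nat list \<Rightarrow> nat list \<Rightarrow> nat list \<Rightarrow> store" where
  "st i d e f c = (\<lambda>_. [])(0 := i, 1 := d, 2 := e, 3 := f, 4 := c)"

lemma st_apply [simp]:
  "st i d e f c 0 = i" "st i d e f c (Suc 0) = d" "st i d e f c 2 = e"
  "st i d e f c 3 = f" "st i d e f c 4 = c"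
  by (simp_all add: st_def)

lemma st_update [simp]:
  "(st i d e f c)(0 := x) = st x d e f c" "(st i d e f c)(Suc 0 := x) = st i x e f c"
  "(st i d e f c)(2 := x) = st i d x f c" "(st i d e f c)(3 := x) = st i d e x c"
  "(st i d e f c)(4 := x) = st i d e f x"
  by (auto simp: st_def fun_eq_iff)

lemma peek_simp [simp]: "s r = x # xs \<Longrightarrow> peek s r = x" "s r = [] \<Longrightarrow> peek s r = 0"
  by (simp_all add: peek_def)

section \<open>Moving binary trees between stacks\<close>

datatype tree = Nl | Br tree tree

text \<open>Preorder notation is self-delimiting, so a tree can lie directly on top of other data.
  Only two symbols occur, which leaves \<open>3\<close> free as a marker.\<close>

fun code :: "tree \<Rightarrow> nat list" where
  "code Nl = [1]"
| "code (Br a b) = 2 # code a @ code b"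

lemma set_code: "set (code t) \<subseteq> {1, 2}"
  by (induction t) auto

lemma code_nonempty [simp]: "code t \<noteq> []"
  by (cases t) auto

text \<open>The unary counter on stack 4 holds the number of subtrees still to be read: a leaf uses
  up one, an inner node replaces one by two.\<close>

definition save_loop :: "nat \<Rightarrow> com" where
  "save_loop r = While 4 {1} (Pop 4 ;; Cond 1 {2}
     (Pop 1 ;; Push r 2 ;; Push 4 1 ;; Push 4 1)
     (Pop 1 ;; Push r 1))"

text \<open>The marker \<open>3\<close> separates the reversed tree from what lies below it on stack
  \<open>r\<close>, and on stack 4 it ends the countdown without disturbing an outer
  counter.\<close>

definition save :: "nat \<Rightarrow> com" where
  "save r = Push r 3 ;; Push 4 3 ;; Push 4 1 ;; save_loop r ;; Pop 4"

definition restore :: "nat \<Rightarrow> com" where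
  "restore r = While r {1, 2} (Cond r {1} (Pop r ;; Push 1 1) (Pop r ;; Push 1 2)) ;; Pop r"

text \<open>Stated with an arbitrary continuation of the loop, because after the left subtree the
  same loop must go on with the right one. A leaf costs 8 steps and an inner node 12, both below the
  13 charged per symbol.\<close>

lemma save_loop:
  assumes "r = 2 \<or> r = 3" "s 1 = code t @ d" "s 4 = 1 # c"
    and "reaches (save_loop r) (s(1 := d, 4 := c, r := rev (code t) @ s r)) n s'"
  shows "reaches (save_loop r) s (n + 13 * length (code t)) s'"
  using assms(2-)
proof (induction t arbitrary: s d c n)
  case Nl
  have "reaches (save_loop r) s (6 + n + 2) s'"
    unfolding save_loop_def
  proof (rule reaches_WhileT)
    show "reaches (While 4 {1} (Pop 4 ;; Cond 1 {2}
        (Pop 1 ;; Push r 2 ;; Push 4 1 ;; Push 4 1) (Pop 1 ;; Push r 1)))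
        (s(1 := d, 4 := c, r := 1 # s r)) n s'"
      using Nl.prems(3) by (simp add: save_loop_def del: fun_upd_apply)
    have "reaches (Cond 1 {2} (Pop 1 ;; Push r 2 ;; Push 4 1 ;; Push 4 1) (Pop 1 ;; Push r 1))
        (s(4 := c)) 5 (s(1 := d, 4 := c, r := 1 # s r))"
      using assms(1) Nl.prems by (intro reaches_Cond) (auto simp: fun_upd_twist)
    then show "reaches (Pop 4 ;; Cond 1 {2} (Pop 1 ;; Push r 2 ;; Push 4 1 ;; Push 4 1)
        (Pop 1 ;; Push r 1)) s 6 (s(1 := d, 4 := c, r := 1 # s r))"
      using Nl.prems by simp
  qed (use Nl.prems in simp)
  then show ?case by (rule reaches_mono) simp
next
  case (Br t1 t2)
  let ?s1 = "s(1 := code t1 @ code t2 @ d, 4 := 1 # 1 # c, r := 2 # s r)"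
  let ?s2 = "s(1 := code t2 @ d, 4 := 1 # c, r := rev (code t1) @ 2 # s r)"
  have eq: "?s2(1 := d, 4 := c, r := rev (code t2) @ ?s2 r) = s(1 := d, 4 := c, r := rev (code (Br t1 t2)) @ s r)"
    using assms(1) by (auto simp: fun_eq_iff)
  have "reaches (save_loop r) ?s2 (n + 13 * length (code t2)) s'"
  proof (rule Br.IH(2)[where d = d and c = c])
    show "reaches (save_loop r) (?s2(1 := d, 4 := c, r := rev (code t2) @ ?s2 r)) n s'"
      unfolding eq by (fact Br.prems(3))
  qed (use assms(1) in auto)
  note reaches_s2 = this
  have eq: "?s1(1 := code t2 @ d, 4 := 1 # c, r := rev (code t1) @ ?s1 r) = ?s2"
    using assms(1) by (auto simp: fun_eq_iff)
  have 1: "reaches (save_loop r) ?s1 (n + 13 * length (code t2) + 13 * length (code t1)) s'"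
  proof (rule Br.IH(1)[where d = "code t2 @ d" and c = "1 # c"])
    show "reaches (save_loop r) (?s1(1 := code t2 @ d, 4 := 1 # c, r := rev (code t1) @ ?s1 r))
        (n + 13 * length (code t2)) s'"
      unfolding eq by (fact reaches_s2)
  qed (use assms(1) in auto)
  have "reaches (save_loop r) s (10 + (n + 13 * length (code t2) + 13 * length (code t1)) + 2) s'"
    unfolding save_loop_def
  proof (rule reaches_WhileT[OF _ _ 1[unfolded save_loop_def]])
    have "reaches (Cond 1 {2} (Pop 1 ;; Push r 2 ;; Push 4 1 ;; Push 4 1) (Pop 1 ;; Push r 1))
        (s(4 := c)) 9 ?s1"
      using assms(1) Br.prems by (intro reaches_Cond) (auto simp: fun_upd_twist)
    then show "reaches (Pop 4 ;; Cond 1 {2} (Pop 1 ;; Push r 2 ;; Push 4 1 ;; Push 4 1)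
        (Pop 1 ;; Push r 1)) s 10 ?s1"
      using Br.prems by simp
  qed (use Br.prems in simp)
  then show ?case by (rule reaches_mono) simp
qed

lemma save:
  assumes "r = 2 \<or> r = 3" "s 1 = code t @ d" "13 * length (code t) + 8 \<le> n"
  shows "reaches (save r) s n (s(1 := d, r := rev (code t) @ 3 # s r))"
proof -
  let ?s = "s(r := 3 # s r, 4 := 1 # 3 # s 4)"
  have "reaches (save_loop r) (?s(1 := d, 4 := 3 # s 4, r := rev (code t) @ 3 # s r)) 1
      (?s(1 := d, 4 := 3 # s 4, r := rev (code t) @ 3 # s r))"
    unfolding save_loop_def using assms(1) by (intro reaches_WhileF) (auto simp: peek_def)
  then have "reaches (save_loop r) ?s (1 + 13 * length (code t))
      (?s(1 := d, 4 := 3 # s 4, r := rev (code t) @ 3 # s r))"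
    using assms(1,2) by (intro save_loop[where d = d and c = "3 # s 4"]) auto
  then have "reaches (save_loop r ;; Pop 4) ?s
      (1 + 13 * length (code t) + 1) (s(1 := d, r := rev (code t) @ 3 # s r))"
    by (rule reaches_Seq) (use assms(1) in \<open>auto simp: fun_eq_iff\<close>)
  then have "reaches (save r) s (8 + 13 * length (code t)) (s(1 := d, r := rev (code t) @ 3 # s r))"
    using assms(1) by (auto simp: save_def)
  then show ?thesis
    by (rule reaches_mono) (use assms(3) in simp)
qed

lemma save_st:
  assumes "13 * length (code t) + 8 \<le> n"
  shows "reaches (save 2) (st i (code t @ d) e f c) n (st i d (rev (code t) @ 3 # e) f c)"
    and "reaches (save 3) (st i (code t @ d) e f c) n (st i d e (rev (code t) @ 3 # f) c)"
  using save[of 2 "st i (code t @ d) e f c" t d n] save[of 3 "st i (code t @ d) e f c" t d n] assms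
  by simp_all

lemma restore:
  assumes "r = 2 \<or> r = 3" "set ys \<subseteq> {1, 2}" "s r = ys @ 3 # e" "7 * length ys + 2 \<le> n"
  shows "reaches (restore r) s n (s(1 := rev ys @ s 1, r := e))"
  using assms(2-)
proof (induction ys arbitrary: s n)
  case Nil
  then show ?case
    using assms(1) unfolding restore_def
    by (intro reaches_Seq_within[where m = 1, OF reaches_WhileF]) (auto simp: fun_eq_iff)
next
  case (Cons y ys)
  let ?b = "Cond r {1} (Pop r ;; Push 1 1) (Pop r ;; Push 1 2)"
  let ?s1 = "s(1 := y # s 1, r := ys @ 3 # e)"
  have y: "y = 1 \<or> y = 2" using Cons.prems by auto
  have "reaches (restore r) ?s1 (7 * length ys + 2) (?s1(1 := rev ys @ ?s1 1, r := e))"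
    using Cons.prems assms(1) by (intro Cons.IH) auto
  also have "?s1(1 := rev ys @ ?s1 1, r := e) = s(1 := rev (y # ys) @ s 1, r := e)"
    using assms(1) by (auto simp: fun_eq_iff)
  finally obtain t where "t \<le> 7 * length ys + 2"
    "exec (While r {1, 2} ?b ;; Pop r) ?s1 t (s(1 := rev (y # ys) @ s 1, r := e))"
    unfolding reaches_def restore_def by blast
  \<comment> \<open>The run is cut between the loop and the final pop, since the additional round
    has to be put in front of the loop alone.\<close>
  then obtain t1 t2 s2 where 2: "t1 + t2 \<le> 7 * length ys + 2" "exec (While r {1, 2} ?b) ?s1 t1 s2"
    "exec (Pop r) s2 t2 (s(1 := rev (y # ys) @ s 1, r := e))"
    by (auto elim: exec_SeqE)
  have "reaches ?b s 5 ?s1"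
    using y Cons.prems assms(1) by (intro reaches_Cond) (auto simp: fun_upd_twist)
  then have "reaches (While r {1, 2} ?b) s (5 + t1 + 2) s2"
    by (rule reaches_WhileT[rotated]) (use y Cons.prems 2 in \<open>auto simp: reaches_def\<close>)
  then have "reaches (restore r) s (5 + t1 + 2 + t2) (s(1 := rev (y # ys) @ s 1, r := e))"
    unfolding restore_def using 2(3) by (intro reaches_Seq) (auto simp: reaches_def)
  then show ?case
    by (rule reaches_mono) (use 2(1) Cons.prems in simp)
qed

lemma restore_st:
  assumes "7 * length (code t) + 2 \<le> n"
  shows "reaches (restore 2) (st i d (rev (code t) @ 3 # e) f c) n (st i (code t @ d) e f c)"
    and "reaches (restore 3) (st i d e (rev (code t) @ 3 # f) c) n (st i (code t @ d) e f c)"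
  using restore[of 2 "rev (code t)" "st i d (rev (code t) @ 3 # e) f c" e n]
    restore[of 3 "rev (code t)" "st i d e (rev (code t) @ 3 # f) c" f n] set_code assms
  by simp_all

section \<open>Polynomial-time functions on tree-encoded data\<close>

class enc =
  fixes enc :: "'a \<Rightarrow> tree"

definition sz :: "'a :: enc \<Rightarrow> nat" where
  "sz x = length (code (enc x))"

text \<open>\<open>False\<close> and the empty list are both \<open>Nl\<close>, and a nonempty list
  is encoded as the pair of its head and tail. Hence one test at the root implements both the
  conditional and the case distinction on lists.\<close>

instantiation bool :: enc
begin
definition enc_bool :: "bool \<Rightarrow> tree" where
  "enc_bool b = (if b then Br Nl Nl else Nl)"
instance ..
end

instantiation prod :: (enc, enc) enc
begin
definition enc_prod :: "'a \<times> 'b \<Rightarrow> tree" where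
  "enc_prod p = Br (enc (fst p)) (enc (snd p))"
instance ..
end

instantiation list :: (enc) enc
begin
fun enc_list :: "'a list \<Rightarrow> tree" where
  "enc_list [] = Nl"
| "enc_list (x # xs) = Br (enc x) (enc xs)"
instance ..
end

lemma sz_bool_le: "sz (b :: bool) \<le> 3"
  by (simp add: sz_def enc_bool_def)

lemma sz_prod [simp]: "sz (a, b) = 1 + sz a + sz b"
  by (simp add: sz_def enc_prod_def)

lemma sz_Nil [simp]: "sz [] = 1"
  by (simp add: sz_def)

lemma sz_Cons [simp]: "sz (x # xs) = 1 + sz x + sz xs"
  by (simp add: sz_def)

lemma length_le_sz: "length xs < sz xs"
  by (induction xs) auto

lemma sz_elem_le: "x \<in> set xs \<Longrightarrow> sz x < sz xs"
  by (induction xs) auto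

lemma sz_list_le: "(\<And>x. x \<in> set xs \<Longrightarrow> sz x \<le> k) \<Longrightarrow> sz xs \<le> 1 + length xs * (k + 1)"
  by (induction xs) (fastforce simp: algebra_simps)+

text \<open>The measure \<open>m\<close> is \<open>sz\<close> for functions on data and the identity
  for the final time bound. Natural coefficients make the polynomials monotone, which composition
  relies on.\<close>

definition poly_bounded :: "('a \<Rightarrow> nat) \<Rightarrow> ('a \<Rightarrow> nat) \<Rightarrow> bool" where
  "poly_bounded m g \<longleftrightarrow> (\<exists>q :: nat poly. \<forall>x. g x \<le> poly q (m x))"

lemma poly_nat_mono: "m \<le> n \<Longrightarrow> poly (q :: nat poly) m \<le> poly q n"
  by (induction q) (auto intro: add_mono mult_mono)

named_theorems pb_intros

lemma poly_bounded_mono: "poly_bounded m g \<Longrightarrow> (\<And>x. f x \<le> g x) \<Longrightarrow> poly_bounded m f"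
  unfolding poly_bounded_def by (meson order_trans)

lemma poly_bounded_const [pb_intros]: "poly_bounded m (\<lambda>_. c)"
  unfolding poly_bounded_def by (rule exI[of _ "[:c:]"]) simp

lemma poly_bounded_id: "poly_bounded m m"
  unfolding poly_bounded_def by (rule exI[of _ "[:0, 1:]"]) simp

lemmas poly_bounded_sz [pb_intros] = poly_bounded_id[of sz]

lemma poly_bounded_add [pb_intros]:
  assumes "poly_bounded m f" "poly_bounded m g" shows "poly_bounded m (\<lambda>x. f x + g x)"
proof -
  obtain p q where "\<And>x. f x \<le> poly p (m x)" "\<And>x. g x \<le> poly q (m x)"
    using assms by (auto simp: poly_bounded_def)
  then show ?thesis
    unfolding poly_bounded_def by (intro exI[of _ "p + q"]) (simp add: add_mono)
qed

lemma poly_bounded_mult [pb_intros]: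
  assumes "poly_bounded m f" "poly_bounded m g" shows "poly_bounded m (\<lambda>x. f x * g x)"
proof -
  obtain p q where "\<And>x. f x \<le> poly p (m x)" "\<And>x. g x \<le> poly q (m x)"
    using assms by (auto simp: poly_bounded_def)
  then show ?thesis
    unfolding poly_bounded_def by (intro exI[of _ "p * q"]) (simp add: mult_mono)
qed

lemma poly_bounded_compose:
  assumes "poly_bounded m' g" "poly_bounded m (\<lambda>x. m' (f x))"
  shows "poly_bounded m (\<lambda>x. g (f x))"
proof -
  obtain p q where p: "\<And>x. g x \<le> poly p (m' x)" and q: "\<And>x. m' (f x) \<le> poly q (m x)"
    using assms by (auto simp: poly_bounded_def)
  have "g (f x) \<le> poly (pcompose p q) (m x)" for x
    using p[of "f x"] poly_nat_mono[OF q[of x], of p] by (simp add: poly_pcompose)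
  then show ?thesis by (auto simp: poly_bounded_def)
qed

lemma poly_bounded_poly [pb_intros]:
  "poly_bounded m f \<Longrightarrow> poly_bounded m (\<lambda>x. poly q (f x))"
  by (rule poly_bounded_compose[of f "\<lambda>x. poly q (f x)" m "\<lambda>x. x"]) (auto simp: poly_bounded_def)

text \<open>The surrounding stack contents are arbitrary, so that programs may run on top of data
  set aside by others. \<open>T\<close> is any function below a polynomial in the size; costs of
  parts can thus be added exactly before a polynomial is chosen.\<close>

definition polytime :: "('a :: enc \<Rightarrow> 'b :: enc) \<Rightarrow> bool" where
  "polytime h \<longleftrightarrow> (\<exists>p T. wf_com p \<and> poly_bounded sz T \<and>
     (\<forall>x i d e f c. reaches p (st i (code (enc x) @ d) e f c) (T x)
       (st i (code (enc (h x)) @ d) e f c)))"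

lemma polytimeI:
  assumes "wf_com p"
    and "\<And>x i d e f c. reaches p (st i (code (enc x) @ d) e f c) (T x) (st i (code (enc (h x)) @ d) e f c)"
    and "poly_bounded sz T"
  shows "polytime h"
  using assms unfolding polytime_def by blast

lemma polytimeE:
  assumes "polytime h"
  obtains p T where "wf_com p" "poly_bounded sz T"
    "\<And>x i d e f c. reaches p (st i (code (enc x) @ d) e f c) (T x) (st i (code (enc (h x)) @ d) e f c)"
  using assms unfolding polytime_def by blast

lemma poly_bounded_polytime [pb_intros]:
  assumes "polytime h"
  shows "poly_bounded sz (\<lambda>x. sz (h x))"
proof -
  obtain p T where T: "poly_bounded sz T" and p:
    "\<And>x i d e f c. reaches p (st i (code (enc x) @ d) e f c) (T x) (st i (code (enc (h x)) @ d) e f c)"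
    using polytimeE[OF assms] by metis
  have "sz (h x) \<le> sz x + T x" for x
  proof -
    obtain t where "t \<le> T x" "exec p (st [] (code (enc x) @ []) [] [] []) t (st [] (code (enc (h x)) @ []) [] [] [])"
      using p[of "[]" x "[]" "[]" "[]" "[]"] by (auto simp: reaches_def)
    then show ?thesis
      using exec_length[of p "st [] (code (enc x) @ []) [] [] []" t _ 1] by (force simp: sz_def)
  qed
  moreover have "poly_bounded sz (\<lambda>x. sz x + T x)"
    by (intro pb_intros T)
  ultimately show ?thesis
    by (rule poly_bounded_mono[rotated])
qed

lemma poly_bounded_polytime_compose:
  "poly_bounded sz g \<Longrightarrow> polytime h \<Longrightarrow> poly_bounded sz (\<lambda>x. g (h x))"
  by (erule poly_bounded_compose) (rule poly_bounded_polytime)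

named_theorems polytime_intros

text \<open>A program only sees encodings. This turns pairing into list construction and operations
  on digit lists into operations on numbers.\<close>

lemma polytime_cong_enc: "polytime h \<Longrightarrow> (\<And>x. enc (h' x) = enc (h x)) \<Longrightarrow> polytime h'"
  unfolding polytime_def by simp

lemma polytime_id [polytime_intros]: "polytime (\<lambda>x. x)"
  by (rule polytimeI[where p = Skip and T = "\<lambda>_. 0"]) (auto intro: pb_intros)

lemma polytime_compose:
  assumes "polytime g" "polytime h"
  shows "polytime (\<lambda>x. g (h x))"
proof -
  obtain p T where p: "wf_com p" "poly_bounded sz T"
    "\<And>x i d e f c. reaches p (st i (code (enc x) @ d) e f c) (T x) (st i (code (enc (h x)) @ d) e f c)"
    using polytimeE[OF assms(2)] by metis
  obtain p' T' where p': "wf_com p'" "poly_bounded sz T'"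
    "\<And>x i d e f c. reaches p' (st i (code (enc x) @ d) e f c) (T' x) (st i (code (enc (g x)) @ d) e f c)"
    using polytimeE[OF assms(1)] by metis
  show ?thesis
  proof (rule polytimeI)
    show "wf_com (p ;; p')" using p p' by simp
    show "reaches (p ;; p') (st i (code (enc x) @ d) e f c) (T x + T' (h x))
        (st i (code (enc (g (h x))) @ d) e f c)" for x i d e f c
      by (rule reaches_Seq[OF p(3) p'(3)])
    show "poly_bounded sz (\<lambda>x. T x + T' (h x))"
      by (intro pb_intros p poly_bounded_polytime_compose[OF p'(2)] assms)
  qed
qed

section \<open>Programs that drop, duplicate and exchange trees\<close>

definition drop_tree :: com where
  "drop_tree = save 2 ;; While 2 {1, 2} (Pop 2) ;; Pop 2"

text \<open>Emptying stack 2 writes one copy to stack 1 and one to stack 3. The latter is moved back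
  to stack 2, which reverses it once more, as \<open>restore\<close> expects.\<close>

definition dup_tree :: com where
  "dup_tree = save 2 ;; Push 3 3 ;;
     While 2 {1, 2} (Cond 2 {1} (Pop 2 ;; Push 1 1 ;; Push 3 1) (Pop 2 ;; Push 1 2 ;; Push 3 2)) ;;
     While 3 {1, 2} (Cond 3 {1} (Pop 3 ;; Push 2 1) (Pop 3 ;; Push 2 2)) ;; Pop 3 ;;
     restore 2"

definition swap_trees :: com where
  "swap_trees = save 2 ;; save 3 ;; restore 2 ;; restore 3"

fun push_all :: "nat list \<Rightarrow> com" where
  "push_all [] = Skip"
| "push_all (x # xs) = Push 1 x ;; push_all xs"

lemma wf_tree_ops [simp]:
  "wf_com drop_tree" "wf_com dup_tree" "wf_com swap_trees"
  "r < 5 \<Longrightarrow> wf_com (save r)" "r < 5 \<Longrightarrow> wf_com (restore r)"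
  by (simp_all add: drop_tree_def dup_tree_def swap_trees_def save_def save_loop_def restore_def)

lemma wf_push_all [simp]: "wf_com (push_all xs) \<longleftrightarrow> set xs \<subseteq> {0<..<6}"
  by (induction xs) auto

lemma push_all: "reaches (push_all xs) (st i d e f c) (2 * length xs) (st i (rev xs @ d) e f c)"
  by (induction xs arbitrary: d) auto

lemma pop_loop:
  "set ys \<subseteq> {1, 2} \<Longrightarrow> 3 * length ys + 1 \<le> n \<Longrightarrow>
    reaches (While 2 {1, 2} (Pop 2)) (st i d (ys @ 3 # e) f c) n (st i d (3 # e) f c)"
proof (induction ys arbitrary: n)
  case Nil
  then show ?case by (auto intro!: reaches_WhileF)
next
  case (Cons y ys)
  have "reaches (While 2 {1, 2} (Pop 2)) (st i d (ys @ 3 # e) f c) (3 * length ys + 1) (st i d (3 # e) f c)"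
    using Cons by auto
  then have "reaches (While 2 {1, 2} (Pop 2)) (st i d ((y # ys) @ 3 # e) f c)
      (1 + (3 * length ys + 1) + 2) (st i d (3 # e) f c)"
    using Cons.prems(1) by (intro reaches_WhileT) auto
  then show ?case
    by (rule reaches_mono) (use Cons.prems(2) in simp)
qed

lemma drop_tree:
  assumes "20 * length (code t) + 20 \<le> n"
  shows "reaches drop_tree (st i (code t @ d) e f c) n (st i d e f c)"
proof -
  have "reaches (While 2 {1, 2} (Pop 2)) (st i d (rev (code t) @ 3 # e) f c) (3 * length (code t) + 1)
      (st i d (3 # e) f c)"
    using set_code by (intro pop_loop) auto
  from reaches_Seq[OF this, of "Pop 2" 1]
  have "reaches (While 2 {1, 2} (Pop 2) ;; Pop 2) (st i d (rev (code t) @ 3 # e) f c)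
      (3 * length (code t) + 2) (st i d e f c)"
    by simp
  from reaches_Seq[OF save_st(1)[OF order_refl] this] show ?thesis
    unfolding drop_tree_def by (rule reaches_mono) (use assms in simp)
qed

lemma dup_loop1:
  "set ys \<subseteq> {1, 2} \<Longrightarrow> 9 * length ys + 1 \<le> n \<Longrightarrow>
    reaches (While 2 {1, 2} (Cond 2 {1} (Pop 2 ;; Push 1 1 ;; Push 3 1) (Pop 2 ;; Push 1 2 ;; Push 3 2)))
      (st i d (ys @ 3 # e) f c) n (st i (rev ys @ d) (3 # e) (rev ys @ f) c)"
proof (induction ys arbitrary: n d f)
  case Nil
  then show ?case by (auto intro!: reaches_WhileF)
next
  case (Cons y ys)
  let ?b = "Cond 2 {1} (Pop 2 ;; Push 1 1 ;; Push 3 1) (Pop 2 ;; Push 1 2 ;; Push 3 2)"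
  have "reaches (While 2 {1, 2} ?b) (st i (y # d) (ys @ 3 # e) (y # f) c) (9 * length ys + 1)
      (st i (rev ys @ y # d) (3 # e) (rev ys @ y # f) c)"
    using Cons by auto
  moreover have "reaches ?b (st i d ((y # ys) @ 3 # e) f c) 7 (st i (y # d) (ys @ 3 # e) (y # f) c)"
    using Cons.prems(1) by (intro reaches_Cond) auto
  ultimately have "reaches (While 2 {1, 2} ?b) (st i d ((y # ys) @ 3 # e) f c)
      (7 + (9 * length ys + 1) + 2) (st i (rev ys @ y # d) (3 # e) (rev ys @ y # f) c)"
    using Cons.prems(1) by (intro reaches_WhileT) auto
  then have "reaches (While 2 {1, 2} ?b) (st i d ((y # ys) @ 3 # e) f c) n
      (st i (rev ys @ y # d) (3 # e) (rev ys @ y # f) c)"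
    by (rule reaches_mono) (use Cons.prems(2) in simp)
  then show ?case by simp
qed

lemma dup_loop2:
  "set ys \<subseteq> {1, 2} \<Longrightarrow> 7 * length ys + 1 \<le> n \<Longrightarrow>
    reaches (While 3 {1, 2} (Cond 3 {1} (Pop 3 ;; Push 2 1) (Pop 3 ;; Push 2 2)))
      (st i d e (ys @ 3 # f) c) n (st i d (rev ys @ e) (3 # f) c)"
proof (induction ys arbitrary: n e)
  case Nil
  then show ?case by (auto intro!: reaches_WhileF)
next
  case (Cons y ys)
  let ?b = "Cond 3 {1} (Pop 3 ;; Push 2 1) (Pop 3 ;; Push 2 2)"
  have "reaches (While 3 {1, 2} ?b) (st i d (y # e) (ys @ 3 # f) c) (7 * length ys + 1)
      (st i d (rev ys @ y # e) (3 # f) c)"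
    using Cons by auto
  moreover have "reaches ?b (st i d e ((y # ys) @ 3 # f) c) 5 (st i d (y # e) (ys @ 3 # f) c)"
    using Cons.prems(1) by (intro reaches_Cond) auto
  ultimately have "reaches (While 3 {1, 2} ?b) (st i d e ((y # ys) @ 3 # f) c)
      (5 + (7 * length ys + 1) + 2) (st i d (rev ys @ y # e) (3 # f) c)"
    using Cons.prems(1) by (intro reaches_WhileT) auto
  then have "reaches (While 3 {1, 2} ?b) (st i d e ((y # ys) @ 3 # f) c) n
      (st i d (rev ys @ y # e) (3 # f) c)"
    by (rule reaches_mono) (use Cons.prems(2) in simp)
  then show ?case by simp
qed

lemma dup_tree:
  assumes "40 * length (code t) + 40 \<le> n"
  shows "reaches dup_tree (st i (code t @ d) e f c) n (st i (code t @ code t @ d) e f c)"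
proof -
  let ?l1 = "While 2 {1, 2} (Cond 2 {1} (Pop 2 ;; Push 1 1 ;; Push 3 1) (Pop 2 ;; Push 1 2 ;; Push 3 2))"
  let ?l2 = "While 3 {1, 2} (Cond 3 {1} (Pop 3 ;; Push 2 1) (Pop 3 ;; Push 2 2))"
  let ?n = "length (code t)"
  have set: "set (rev (code t)) \<subseteq> {1, 2}" "set (code t) \<subseteq> {1, 2}"
    using set_code by auto
  have 1: "reaches ?l1 (st i d (rev (code t) @ 3 # e) (3 # f) c) (9 * ?n + 1)
      (st i (code t @ d) (3 # e) (code t @ 3 # f) c)"
    using dup_loop1[OF set(1), of "9 * ?n + 1" i d e "3 # f" c] by simp
  have 2: "reaches ?l2 (st i (code t @ d) (3 # e) (code t @ 3 # f) c) (7 * ?n + 1)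
      (st i (code t @ d) (rev (code t) @ 3 # e) (3 # f) c)"
    using dup_loop2[OF set(2), of "7 * ?n + 1" i "code t @ d" "3 # e" f c] by simp
  have 3: "reaches (Pop 3 ;; restore 2) (st i (code t @ d) (rev (code t) @ 3 # e) (3 # f) c) (7 * ?n + 3)
      (st i (code t @ code t @ d) e f c)"
    by (simp add: restore_st)
  have 4: "reaches (Push 3 3 ;; ?l1 ;; ?l2 ;; Pop 3 ;; restore 2) (st i d (rev (code t) @ 3 # e) f c)
      (2 + (9 * ?n + 1 + (7 * ?n + 1 + (7 * ?n + 3)))) (st i (code t @ code t @ d) e f c)"
    using reaches_Seq[OF 1 reaches_Seq[OF 2 3]] by simp
  show ?thesis
    unfolding dup_tree_def
    by (rule reaches_mono[OF reaches_Seq[OF save_st(1)[OF order_refl] 4]]) (use assms in simp)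
qed

lemma swap_trees:
  assumes "20 * (length (code t) + length (code u)) + 20 \<le> n"
  shows "reaches swap_trees (st i (code t @ code u @ d) e f c) n (st i (code u @ code t @ d) e f c)"
  unfolding swap_trees_def
  by (rule reaches_mono[OF reaches_Seq[OF save_st(1)[OF order_refl] reaches_Seq[OF save_st(2)[OF order_refl]
    reaches_Seq[OF restore_st(1)[OF order_refl] restore_st(2)[OF order_refl]]]]]) (use assms in simp)

lemma polytime_const [polytime_intros]: "polytime (\<lambda>_. k)"
proof (rule polytimeI)
  let ?p = "push_all (rev (code (enc k)))"
  show "wf_com (drop_tree ;; ?p)"
    using set_code[of "enc k"] by auto
  show "reaches (drop_tree ;; ?p) (st i (code (enc x) @ d) e f c)
      (20 * sz x + 20 + 2 * sz k) (st i (code (enc k) @ d) e f c)" for x :: 'a and i d e f c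
    using push_all[of "rev (code (enc k))" i d e f c]
    by (intro reaches_Seq[OF drop_tree]) (simp_all add: sz_def)
  show "poly_bounded sz (\<lambda>x :: 'a. 20 * sz x + 20 + 2 * sz k)"
    by (intro pb_intros)
qed

lemma polytime_Pair [polytime_intros]:
  assumes "polytime f" "polytime g"
  shows "polytime (\<lambda>x. (f x, g x))"
proof -
  obtain p T where p: "wf_com p" "poly_bounded sz T"
    "\<And>x i d e h c. reaches p (st i (code (enc x) @ d) e h c) (T x) (st i (code (enc (f x)) @ d) e h c)"
    using polytimeE[OF assms(1)] by metis
  obtain p' T' where p': "wf_com p'" "poly_bounded sz T'"
    "\<And>x i d e h c. reaches p' (st i (code (enc x) @ d) e h c) (T' x) (st i (code (enc (g x)) @ d) e h c)"
    using polytimeE[OF assms(2)] by metis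
  \<comment> \<open>\<open>g x\<close> is computed first since the code of a pair has its first
    component on top.\<close>
  let ?p = "dup_tree ;; p' ;; swap_trees ;; p ;; Push 1 2"
  let ?T = "\<lambda>x. (40 * sz x + 40) + (T' x + ((20 * (sz (g x) + sz x) + 20) + (T x + 2)))"
  show ?thesis
  proof (rule polytimeI)
    show "wf_com ?p" using p p' by simp
    show "reaches ?p (st i (code (enc x) @ d) e h c) (?T x) (st i (code (enc (f x, g x)) @ d) e h c)"
      for x i d e h c
    proof -
      have "reaches (Push 1 2) (st i (code (enc (f x)) @ code (enc (g x)) @ d) e h c) 2
          (st i (code (enc (f x, g x)) @ d) e h c)"
        by (simp add: enc_prod_def)
      from reaches_Seq[OF dup_tree[OF order_refl] reaches_Seq[OF p'(3)
          reaches_Seq[OF swap_trees[OF order_refl] reaches_Seq[OF p(3) this]]]]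
      show ?thesis by (simp add: sz_def)
    qed
    show "poly_bounded sz ?T"
      by (intro pb_intros p p' assms)
  qed
qed

lemma polytime_fst [polytime_intros]:
  assumes "polytime h" shows "polytime (\<lambda>x. fst (h x))"
proof (rule polytime_compose[OF _ assms], rule polytimeI)
  let ?p = "Pop 1 ;; swap_trees ;; drop_tree"
  show "wf_com ?p" by simp
  show "reaches ?p (st i (code (enc x) @ d) e f c) (40 * sz x + 50) (st i (code (enc (fst x)) @ d) e f c)"
    for x :: "'b \<times> 'c" and i d e f c
  proof -
    have "reaches (swap_trees ;; drop_tree) (st i (code (enc (fst x)) @ code (enc (snd x)) @ d) e f c)
       ((20 * (length (code (enc (fst x))) + length (code (enc (snd x)))) + 20) + (20 * length (code (enc (snd x))) + 20))
       (st i (code (enc (fst x)) @ d) e f c)"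
      by (rule reaches_Seq[OF swap_trees drop_tree]) simp_all
    then show ?thesis
      by (auto simp: enc_prod_def sz_def elim!: reaches_mono)
  qed
  show "poly_bounded sz (\<lambda>x :: 'b \<times> 'c. 40 * sz x + 50)"
    by (intro pb_intros)
qed

lemma polytime_snd [polytime_intros]:
  assumes "polytime h" shows "polytime (\<lambda>x. snd (h x))"
proof (rule polytime_compose[OF _ assms], rule polytimeI)
  let ?p = "Pop 1 ;; drop_tree"
  show "wf_com ?p" by simp
  show "reaches ?p (st i (code (enc x) @ d) e f c) (20 * sz x + 50) (st i (code (enc (snd x)) @ d) e f c)"
    for x :: "'b \<times> 'c" and i d e f c
    by (auto simp: enc_prod_def sz_def intro!: drop_tree)
  show "poly_bounded sz (\<lambda>x :: 'b \<times> 'c. 20 * sz x + 50)"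
    by (intro pb_intros)
qed

text \<open>\<open>u x\<close> is computed on a copy of \<open>x\<close>. A leaf is a single symbol
  and is popped; otherwise one further \<open>2\<close> pairs \<open>u x\<close> with
  \<open>x\<close>. The element \<open>y\<close> is this pair seen at the argument type of
  \<open>g\<close>, which can then take \<open>u x\<close> apart.\<close>

lemma polytime_branch:
  fixes g :: "'c :: enc \<Rightarrow> 'd :: enc"
  assumes "polytime u" "polytime f" "polytime g"
    and Nl: "\<And>x. enc (u x) = Nl \<Longrightarrow> enc (h x) = enc (f x)"
    and Br: "\<And>x. enc (u x) \<noteq> Nl \<Longrightarrow> \<exists>y. enc y = Br (enc (u x)) (enc x) \<and> enc (h x) = enc (g y)"
  shows "polytime h"
proof -
  obtain pu Tu where pu: "wf_com pu" "poly_bounded sz Tu"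
    "\<And>x i d e r c. reaches pu (st i (code (enc x) @ d) e r c) (Tu x) (st i (code (enc (u x)) @ d) e r c)"
    using polytimeE[OF assms(1)] by metis
  obtain pf Tf where pf: "wf_com pf" "poly_bounded sz Tf"
    "\<And>x i d e r c. reaches pf (st i (code (enc x) @ d) e r c) (Tf x) (st i (code (enc (f x)) @ d) e r c)"
    using polytimeE[OF assms(2)] by metis
  obtain pg Tg where pg: "wf_com pg" "poly_bounded sz Tg"
    "\<And>x i d e r c. reaches pg (st i (code (enc x) @ d) e r c) (Tg x) (st i (code (enc (g x)) @ d) e r c)"
    using polytimeE[OF assms(3)] by metis
  \<comment> \<open>\<open>y\<close> is known only through its encoding, so the running time on it
    is controlled through its size.\<close>
  obtain q where q: "\<And>y. Tg y \<le> poly q (sz y)"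
    using pg(2) by (auto simp: poly_bounded_def)
  let ?b = "Cond 1 {2} (Push 1 2 ;; pg) (Pop 1 ;; pf)"
  let ?p = "dup_tree ;; pu ;; ?b"
  let ?T = "\<lambda>x. (40 * sz x + 40) + (Tu x + (2 + (2 + poly q (1 + sz (u x) + sz x) + (1 + Tf x))))"
  show ?thesis
  proof (rule polytimeI)
    show "wf_com ?p" using pu pf pg by simp
    show "poly_bounded sz ?T"
      by (intro pb_intros pu pf assms)
    fix x i d e r c
    have "reaches ?b (st i (code (enc (u x)) @ code (enc x) @ d) e r c)
       (2 + (2 + poly q (1 + sz (u x) + sz x) + (1 + Tf x))) (st i (code (enc (h x)) @ d) e r c)"
    proof (cases "enc (u x)")
      case N: Nl
      then show ?thesis
        using pf(3)[of i x d e r c] Nl[of x] by (intro reaches_Cond) (auto elim: reaches_mono)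
    next
      case B: (Br a b)
      then have "enc (u x) \<noteq> Nl" by simp
      then obtain y where y: "enc y = Br (enc (u x)) (enc x)" "enc (h x) = enc (g y)"
        using Br by blast
      have "Tg y \<le> poly q (1 + sz (u x) + sz x)"
        using q[of y] y(1) by (simp add: sz_def)
      then show ?thesis
        using pg(3)[of i y d e r c] y B by (intro reaches_Cond) (auto elim: reaches_mono)
    qed
    then show "reaches ?p (st i (code (enc x) @ d) e r c) (?T x) (st i (code (enc (h x)) @ d) e r c)"
      by (intro reaches_Seq[OF dup_tree] reaches_Seq[OF pu(3)]) (simp_all add: sz_def)
  qed
qed

lemma polytime_If [polytime_intros]:
  assumes "polytime b" "polytime f" "polytime g"
  shows "polytime (\<lambda>x. if b x then f x else g x)"
proof (rule polytime_branch[OF assms(1,3) polytime_compose[OF assms(2), where h = snd]])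
  show "polytime (snd :: bool \<times> 'a \<Rightarrow> 'a)"
    using polytime_snd[OF polytime_id] .
  fix x assume "enc (b x) \<noteq> Nl"
  then show "\<exists>y :: bool \<times> 'a. enc y = Br (enc (b x)) (enc x) \<and>
      enc (if b x then f x else g x) = enc (f (snd y))"
    by (intro exI[of _ "(b x, x)"]) (auto simp: enc_bool_def enc_prod_def split: if_splits)
qed (auto simp: enc_bool_def split: if_splits)

lemma polytime_case_list [polytime_intros]:
  assumes "polytime l" "polytime f" "polytime (\<lambda>p. g (fst (fst p)) (snd (fst p)) (snd p))"
  shows "polytime (\<lambda>x. case l x of [] \<Rightarrow> f x | y # ys \<Rightarrow> g y ys x)"
proof (rule polytime_branch[OF assms])
  fix x assume "enc (l x) \<noteq> Nl"
  then obtain y ys where "l x = y # ys" by (cases "l x") auto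
  then show "\<exists>p. enc p = Br (enc (l x)) (enc x) \<and> enc (case l x of [] \<Rightarrow> f x | y # ys \<Rightarrow> g y ys x) =
      enc (g (fst (fst p)) (snd (fst p)) (snd p))"
    by (intro exI[of _ "((y, ys), x)"]) (simp add: enc_prod_def)
next
  fix x assume "enc (l x) = Nl"
  then show "enc (case l x of [] \<Rightarrow> f x | y # ys \<Rightarrow> g y ys x) = enc (f x)"
    by (cases "l x") auto
qed

lemma polytime_case_prod [polytime_intros]:
  "polytime (\<lambda>x. g (fst (h x)) (snd (h x)) x) \<Longrightarrow> polytime (\<lambda>x. case h x of (a, b) \<Rightarrow> g a b x)"
  by (simp add: case_prod_beta)

lemma polytime_Cons [polytime_intros]:
  "polytime f \<Longrightarrow> polytime g \<Longrightarrow> polytime (\<lambda>x. f x # g x)"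
  by (rule polytime_cong_enc[OF polytime_Pair[of f g]]) (simp_all add: enc_prod_def)

lemma polytime_not [polytime_intros]: "polytime b \<Longrightarrow> polytime (\<lambda>x. \<not> b x)"
  by (rule polytime_cong_enc[OF polytime_If[of b "\<lambda>_. False" "\<lambda>_. True"]]) (auto intro: polytime_const)

lemma polytime_conj [polytime_intros]:
  "polytime b \<Longrightarrow> polytime c \<Longrightarrow> polytime (\<lambda>x. b x \<and> c x)"
  by (rule polytime_cong_enc[OF polytime_If[of b c "\<lambda>_. False"]]) (auto intro: polytime_const)

lemma polytime_disj [polytime_intros]:
  "polytime b \<Longrightarrow> polytime c \<Longrightarrow> polytime (\<lambda>x. b x \<or> c x)"
  by (rule polytime_cong_enc[OF polytime_If[of b "\<lambda>_. True" c]]) (auto intro: polytime_const)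

section \<open>Folding over lists\<close>

definition fold_com :: "com \<Rightarrow> com" where
  "fold_com p = While 1 {2} (Pop 1 ;; save 2 ;; save 3 ;; restore 2 ;; Push 1 2 ;; p ;; restore 3)"

text \<open>The remaining list lies on top of the state. Each round puts the tail aside, pairs the
  head with the state, runs \<open>p\<close> and brings the tail back; two saves at 13 per symbol
  and two restores at 7 give the factor 40. The leftover \<open>1\<close> is the code of the empty
  list.\<close>

lemma fold_com:
  assumes p: "\<And>y i d e f c. reaches p (st i (code (enc y) @ d) e f c) (T y) (st i (code (enc (h y)) @ d) e f c)"
    and q: "\<And>y. T y \<le> poly q (sz y)"
    and B: "\<And>l1 l2. l = l1 @ l2 \<Longrightarrow> sz (fold (\<lambda>x s. h (x, s)) l1 s) \<le> B" "sz l \<le> B"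
  shows "reaches (fold_com p) (st i (code (enc l) @ code (enc s) @ d) e f c)
    (length l * (40 * B + 25 + poly q (1 + B + B)) + 1)
    (st i (1 # code (enc (fold (\<lambda>x s. h (x, s)) l s)) @ d) e f c)"
  using B
proof (induction l arbitrary: s)
  case Nil
  then show ?case by (auto simp: fold_com_def intro!: reaches_WhileF)
next
  case (Cons x l)
  let ?b = "Pop 1 ;; save 2 ;; save 3 ;; restore 2 ;; Push 1 2 ;; p ;; restore 3"
  have x: "sz x \<le> B" and l: "sz l \<le> B" and s: "sz s \<le> B"
    using Cons.prems(1)[of "[]" "x # l"] Cons.prems(2) by auto
  have "sz (fold (\<lambda>x s. h (x, s)) l1 (h (x, s))) \<le> B" if "l = l1 @ l2" for l1 l2
    using Cons.prems(1)[of "x # l1" l2] that by simp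
  note IH = Cons.IH[OF this l]
  have "T (x, s) \<le> poly q (1 + B + B)"
    using q[of "(x, s)"] poly_nat_mono[of "sz (x, s)" "1 + B + B" q] x s by simp
  then have "reaches p (st i (code (enc (x, s)) @ d) e (rev (code (enc l)) @ 3 # f) c) (poly q (1 + B + B))
      (st i (code (enc (h (x, s))) @ d) e (rev (code (enc l)) @ 3 # f) c)"
    using p reaches_mono by blast
  from reaches_Seq[OF this restore_st(2)[OF order_refl]]
  have 1: "reaches (Push 1 2 ;; p ;; restore 3)
      (st i (code (enc x) @ code (enc s) @ d) e (rev (code (enc l)) @ 3 # f) c)
      (poly q (1 + B + B) + (7 * sz l + 2) + 2)
      (st i (code (enc l) @ code (enc (h (x, s))) @ d) e f c)"
    by (simp add: enc_prod_def sz_def)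
  have "reaches ?b (st i (code (enc (x # l)) @ code (enc s) @ d) e f c)
      (1 + ((13 * sz x + 8) + ((13 * sz l + 8) + ((7 * sz x + 2) + (poly q (1 + B + B) + (7 * sz l + 2) + 2)))))
      (st i (code (enc l) @ code (enc (h (x, s))) @ d) e f c)"
    using reaches_Seq[OF save_st(1)[OF order_refl, where t = "enc x"]
        reaches_Seq[OF save_st(2)[OF order_refl, where t = "enc l"]
          reaches_Seq[OF restore_st(1)[OF order_refl, where t = "enc x"] 1]]]
    by (simp add: sz_def)
  from reaches_WhileT[OF _ this IH[unfolded fold_com_def]]
  have "reaches (fold_com p) (st i (code (enc (x # l)) @ code (enc s) @ d) e f c)
     (1 + (13 * sz x + 8 + (13 * sz l + 8 + (7 * sz x + 2 + (poly q (1 + B + B) + (7 * sz l + 2) + 2)))) +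
      (length l * (40 * B + 25 + poly q (1 + B + B)) + 1) + 2)
     (st i (1 # code (enc (fold (\<lambda>x s. h (x, s)) (x # l) s)) @ d) e f c)"
    by (simp add: fold_com_def)
  then show ?case
    by (rule reaches_mono) (use x l in simp)
qed

lemma polytime_fold:
  assumes "polytime L" "polytime S" "polytime (\<lambda>p. g (fst p) (fst (snd p)) (snd (snd p)))"
    and B: "poly_bounded sz B" "\<And>x l1 l2. L x = l1 @ l2 \<Longrightarrow> sz (fold (\<lambda>y s. g y s x) l1 (S x)) \<le> B x"
  shows "polytime (\<lambda>x. fold (\<lambda>y s. g y s x) (L x) (S x))"
proof -
  \<comment> \<open>The step may depend on the outer argument \<open>x\<close>, which therefore
    travels along as part of the state.\<close>
  define h where "h p = (g (fst p) (fst (snd p)) (snd (snd p)), snd (snd p))" for p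
  have fold_h: "fold (\<lambda>y s. h (y, s)) l (s, x) = (fold (\<lambda>y s. g y s x) l s, x)" for l s x
    by (induction l arbitrary: s) (simp_all add: h_def)
  have "polytime h"
    unfolding h_def by (intro polytime_intros assms)
  then obtain p T where p: "wf_com p" "poly_bounded sz T"
    "\<And>x i d e r c. reaches p (st i (code (enc x) @ d) e r c) (T x) (st i (code (enc (h x)) @ d) e r c)"
    by (rule polytimeE) blast
  then obtain q where q: "\<And>y. T y \<le> poly q (sz y)"
    unfolding poly_bounded_def by blast
  have "polytime (\<lambda>x. (L x, (S x, x)))"
    by (intro polytime_intros assms)
  then obtain p0 T0 where p0: "wf_com p0" "poly_bounded sz T0"
    "\<And>x i d e r c. reaches p0 (st i (code (enc x) @ d) e r c) (T0 x) (st i (code (enc (L x, (S x, x))) @ d) e r c)"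
    by (rule polytimeE) blast
  define B' where "B' x = B x + 1 + sz x + sz (L x)" for x
  let ?h = "\<lambda>x. (fold (\<lambda>y s. g y s x) (L x) (S x), x)"
  let ?p = "p0 ;; Pop 1 ;; fold_com p ;; Pop 1"
  let ?T = "\<lambda>x. T0 x + (1 + ((sz (L x) * (40 * B' x + 25 + poly q (1 + B' x + B' x)) + 1) + 1))"
  have "polytime ?h"
  proof (rule polytimeI)
    show "wf_com ?p"
      using p(1) p0(1) by (simp add: fold_com_def)
    show "poly_bounded sz ?T"
      unfolding B'_def by (intro pb_intros assms p0)
    fix x i d e r c
    have bound: "sz (fold (\<lambda>y s. h (y, s)) l1 (S x, x)) \<le> B' x" if "L x = l1 @ l2" for l1 l2
      using B(2)[OF that] by (simp add: fold_h B'_def)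
    have "reaches (fold_com p) (st i (code (enc (L x)) @ code (enc (S x, x)) @ d) e r c)
        (length (L x) * (40 * B' x + 25 + poly q (1 + B' x + B' x)) + 1)
        (st i (1 # code (enc (fold (\<lambda>y s. h (y, s)) (L x) (S x, x))) @ d) e r c)"
      by (rule fold_com[OF p(3) q bound]) (simp_all add: B'_def)
    then have "reaches (fold_com p) (st i (code (enc (L x)) @ code (enc (S x, x)) @ d) e r c)
        (sz (L x) * (40 * B' x + 25 + poly q (1 + B' x + B' x)) + 1)
        (st i (1 # code (enc (?h x)) @ d) e r c)"
      unfolding fold_h by (rule reaches_mono) (use length_le_sz[of "L x"] in \<open>auto intro!: mult_right_mono\<close>)
    then have "reaches (fold_com p ;; Pop 1) (st i (code (enc (L x)) @ code (enc (S x, x)) @ d) e r c)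
        ((sz (L x) * (40 * B' x + 25 + poly q (1 + B' x + B' x)) + 1) + 1)
        (st i (code (enc (?h x)) @ d) e r c)"
      by (rule reaches_Seq) simp
    then show "reaches ?p (st i (code (enc x) @ d) e r c) (?T x) (st i (code (enc (?h x)) @ d) e r c)"
      by (intro reaches_Seq[OF p0(3)]) (simp add: enc_prod_def)
  qed
  from polytime_fst[OF this] show ?thesis by simp
qed

text \<open>If a round adds an amount that does not depend on the state, the total growth is at most
  this amount times the number of rounds.\<close>

lemma polytime_fold_add:
  assumes "polytime L" "polytime S" "polytime (\<lambda>p. g (fst p) (fst (snd p)) (snd (snd p)))"
    and B: "poly_bounded sz B" "\<And>x y s. y \<in> set (L x) \<Longrightarrow> sz (g y s x) \<le> sz s + B x"
  shows "polytime (\<lambda>x. fold (\<lambda>y s. g y s x) (L x) (S x))"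
proof (rule polytime_fold[OF assms(1-3)])
  show "poly_bounded sz (\<lambda>x. sz (S x) + sz (L x) * B x)"
    by (intro pb_intros assms)
  fix x l1 l2 assume l: "L x = l1 @ l2"
  have "sz (fold (\<lambda>y s. g y s x) l s) \<le> sz s + length l * B x" if "set l \<subseteq> set (L x)" for l s
    using that
  proof (induction l arbitrary: s)
    case (Cons y l)
    then show ?case
      using B(2)[of y x s] order_trans[OF Cons.IH[of "g y s x"]] by simp
  qed simp
  from this[of l1 "S x"] have "sz (fold (\<lambda>y s. g y s x) l1 (S x)) \<le> sz (S x) + length l1 * B x"
    using l by simp
  also have "\<dots> \<le> sz (S x) + sz (L x) * B x"
    using length_le_sz[of "L x"] l by (intro add_left_mono mult_right_mono) auto
  finally show "sz (fold (\<lambda>y s. g y s x) l1 (S x)) \<le> sz (S x) + sz (L x) * B x" .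
qed

lemma polytime_elem_bound:
  assumes "polytime L" "polytime g"
  obtains B where "poly_bounded sz B" "\<And>x y. y \<in> set (L x) \<Longrightarrow> sz (g (y, x)) \<le> B x"
proof -
  obtain q where q: "\<And>p. sz (g p) \<le> poly q (sz p)"
    using poly_bounded_polytime[OF assms(2)] unfolding poly_bounded_def by blast
  show ?thesis
  proof
    show "poly_bounded sz (\<lambda>x. poly q (1 + sz (L x) + sz x))"
      by (intro pb_intros assms)
    show "sz (g (y, x)) \<le> poly q (1 + sz (L x) + sz x)" if "y \<in> set (L x)" for x y
      using q[of "(y, x)"] poly_nat_mono[of "sz (y, x)" "1 + sz (L x) + sz x" q] sz_elem_le[OF that]
      by (simp add: order_trans)
  qed
qed

section \<open>List operations and bounded quantifiers as folds\<close>

lemma polytime_rev [polytime_intros]: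
  assumes "polytime L" shows "polytime (\<lambda>x. rev (L x))"
proof -
  have "polytime (\<lambda>x. fold (\<lambda>y s. y # s) (L x) [])"
  proof (rule polytime_fold_add[OF assms])
    show "poly_bounded sz (\<lambda>x. 1 + sz (L x))" by (intro pb_intros assms)
    show "sz (y # s) \<le> sz s + (1 + sz (L x))" if "y \<in> set (L x)" for x y s
      using sz_elem_le[OF that] by simp
  qed (intro polytime_intros)+
  then show ?thesis by (simp add: fold_Cons_rev)
qed

lemma polytime_append [polytime_intros]:
  assumes "polytime L" "polytime M" shows "polytime (\<lambda>x. L x @ M x)"
proof -
  have "polytime (\<lambda>x. fold (\<lambda>y s. y # s) (rev (L x)) (M x))"
  proof (rule polytime_fold_add)
    show "poly_bounded sz (\<lambda>x. 1 + sz (L x))" by (intro pb_intros assms)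
    show "sz (y # s) \<le> sz s + (1 + sz (L x))" if "y \<in> set (rev (L x))" for x y s
      using sz_elem_le[of y "L x"] that by simp
  qed (intro polytime_intros assms)+
  then show ?thesis by (simp add: fold_Cons_rev)
qed

lemma polytime_map [polytime_intros]:
  assumes "polytime L" "polytime (\<lambda>p. g (fst p) (snd p))"
  shows "polytime (\<lambda>x. map (\<lambda>y. g y x) (L x))"
proof -
  obtain B where B: "poly_bounded sz B" "\<And>x y. y \<in> set (L x) \<Longrightarrow> sz (g y x) \<le> B x"
    using polytime_elem_bound[OF assms] by auto
  have "polytime (\<lambda>x. fold (\<lambda>y s. g y x # s) (L x) [])"
  proof (rule polytime_fold_add[OF assms(1)])
    show "poly_bounded sz (\<lambda>x. 1 + B x)" by (intro pb_intros B)
    show "sz (g y x # s) \<le> sz s + (1 + B x)" if "y \<in> set (L x)" for x y s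
      using B(2)[OF that] by simp
    show "polytime (\<lambda>p. g (fst p) (snd (snd p)) # fst (snd p))"
      using polytime_compose[OF assms(2), of "\<lambda>p. (fst p, snd (snd p))"]
      by (intro polytime_Cons) (simp_all add: polytime_intros)
  qed (intro polytime_intros)
  moreover have "fold (\<lambda>y s. g y x # s) l s = rev (map (\<lambda>y. g y x) l) @ s" for x l s
    by (induction l arbitrary: s) simp_all
  ultimately have "polytime (\<lambda>x. rev (map (\<lambda>y. g y x) (L x)))"
    by simp
  from polytime_rev[OF this] show ?thesis by simp
qed

lemma polytime_Bex [polytime_intros]:
  assumes "polytime L" "polytime (\<lambda>p. P (fst p) (snd p))"
  shows "polytime (\<lambda>x. \<exists>y \<in> set (L x). P y x)"
proof -
  have "polytime (\<lambda>x. fold (\<lambda>y s. P y x \<or> s) (L x) False)"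
  proof (rule polytime_fold_add[OF assms(1)])
    show "poly_bounded sz (\<lambda>_ :: 'a. 3)" by (intro pb_intros)
    show "sz (P y x \<or> s) \<le> sz s + 3" for x y s
      using sz_bool_le[of "P y x \<or> s"] by simp
    show "polytime (\<lambda>p. P (fst p) (snd (snd p)) \<or> fst (snd p))"
      using polytime_compose[OF assms(2), of "\<lambda>p. (fst p, snd (snd p))"]
      by (intro polytime_disj) (simp_all add: polytime_intros)
  qed (intro polytime_intros)
  moreover have "fold (\<lambda>y s. P y x \<or> s) l s \<longleftrightarrow> (\<exists>y \<in> set l. P y x) \<or> s" for x l s
    by (induction l arbitrary: s) auto
  ultimately show ?thesis by simp
qed

lemma polytime_Ball [polytime_intros]:
  assumes "polytime L" "polytime (\<lambda>p. P (fst p) (snd p))"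
  shows "polytime (\<lambda>x. \<forall>y \<in> set (L x). P y x)"
  using polytime_not[OF polytime_Bex[OF assms(1) polytime_not[OF assms(2)]]] by simp

section \<open>Binary arithmetic\<close>

text \<open>Least significant digit first, so that parity and halving are head and tail of the
  list.\<close>

fun bits :: "nat \<Rightarrow> bool list" where
  "bits n = (if n = 0 then [] else odd n # bits (n div 2))"

declare bits.simps [simp del]

lemma bits_0 [simp]: "bits 0 = []"
  by (simp add: bits.simps)

lemma bits_pos: "0 < n \<Longrightarrow> bits n = odd n # bits (n div 2)"
  by (subst bits.simps) simp

instantiation nat :: enc
begin
definition enc_nat :: "nat \<Rightarrow> tree" where
  "enc_nat n = enc (bits n)"
instance ..
end

lemma sz_nat: "sz (n :: nat) = sz (bits n)"
  by (simp add: sz_def enc_nat_def)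

lemma bits_cases:
  "bits (n div 2) = (case bits n of [] \<Rightarrow> [] | b # bs \<Rightarrow> bs)"
  "odd n \<longleftrightarrow> (case bits n of [] \<Rightarrow> False | b # bs \<Rightarrow> b)"
  "n = 0 \<longleftrightarrow> (case bits n of [] \<Rightarrow> True | b # bs \<Rightarrow> False)"
  by (cases "n = 0"; simp add: bits_pos)+

lemma sz_half_le: "sz (n div 2 :: nat) \<le> sz n"
  by (cases "n = 0") (simp_all add: sz_nat bits_pos)

text \<open>A digit takes one list cell and at most three symbols for the Boolean.\<close>

lemma sz_bits_le: "sz (bs :: bool list) \<le> 4 * length bs + 1"
proof (induction bs)
  case (Cons b bs)
  then show ?case using sz_bool_le[of b] by simp
qed simp

lemma length_bits_le: "n < 2 ^ k \<Longrightarrow> length (bits n) \<le> k"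
proof (induction k arbitrary: n)
  case (Suc k)
  then have "length (bits (n div 2)) \<le> k" by simp
  then show ?case by (cases "n = 0") (simp_all add: bits_pos)
qed simp

lemma less_exp_length_bits: "n < 2 ^ length (bits n)"
proof (induction n rule: less_induct)
  case (less n)
  show ?case
  proof (cases "n = 0")
    case False
    then have "n div 2 < 2 ^ length (bits (n div 2))" by (intro less) simp
    then show ?thesis using False by (simp add: bits_pos)
  qed simp
qed

lemma sz_nat_le: "(n :: nat) < 2 ^ k \<Longrightarrow> sz n \<le> 4 * k + 1"
  using sz_bits_le[of "bits n"] length_bits_le[of n k] by (simp add: sz_nat)

lemma less_exp_sz: "(n :: nat) < 2 ^ sz n"
proof -
  have "(2 :: nat) ^ length (bits n) \<le> 2 ^ sz n"
    using length_le_sz[of "bits n"] by (intro power_increasing) (simp_all add: sz_nat)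
  with less_exp_length_bits show ?thesis by (rule less_le_trans)
qed

lemma less_exp_if_sz_le: "sz (n :: nat) \<le> k \<Longrightarrow> n < 2 ^ k"
  using less_exp_sz[of n] power_increasing[of "sz n" k "2 :: nat"] by linarith

lemma polytime_bits [polytime_intros]: "polytime f \<Longrightarrow> polytime (\<lambda>x. bits (f x))"
  by (erule polytime_cong_enc) (simp add: enc_nat_def)

lemma polytime_half [polytime_intros]:
  assumes "polytime f" shows "polytime (\<lambda>x. f x div 2 :: nat)"
proof -
  have "polytime (\<lambda>x. case bits (f x) of [] \<Rightarrow> [] | b # bs \<Rightarrow> bs)"
    by (intro polytime_intros assms)
  then show ?thesis
    by (rule polytime_cong_enc) (simp add: enc_nat_def bits_cases(1))
qed

lemma polytime_odd [polytime_intros]: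
  assumes "polytime f" shows "polytime (\<lambda>x. odd (f x :: nat))"
proof -
  have "polytime (\<lambda>x. case bits (f x) of [] \<Rightarrow> False | b # bs \<Rightarrow> b)"
    by (intro polytime_intros assms)
  then show ?thesis
    by (rule polytime_cong_enc) (simp only: bits_cases(2))
qed

lemma polytime_eq_0 [polytime_intros]:
  assumes "polytime f" shows "polytime (\<lambda>x. f x = (0 :: nat))"
proof -
  have "polytime (\<lambda>x. case bits (f x) of [] \<Rightarrow> True | b # bs \<Rightarrow> False)"
    by (intro polytime_intros assms)
  then show ?thesis
    by (rule polytime_cong_enc) (simp only: bits_cases(3))
qed

lemma polytime_bool_neq [polytime_intros]:
  assumes "polytime f" "polytime g" shows "polytime (\<lambda>x. f x \<noteq> (g x :: bool))"
  by (rule polytime_cong_enc[OF polytime_If[OF assms(1) polytime_not[OF assms(2)] assms(2)]]) simp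

definition shift_in :: "bool \<Rightarrow> nat \<Rightarrow> nat" where
  "shift_in b n = 2 * n + of_bool b"

text \<open>The exception keeps the representation canonical: \<open>0\<close> has no
  digits.\<close>

lemma bits_shift_in: "bits (shift_in b n) = (if b \<or> n \<noteq> 0 then b # bits n else [])"
  by (auto simp: shift_in_def bits_pos)

lemma sz_shift_in_le: "sz (shift_in b n) \<le> sz n + 4"
  using sz_bool_le[of b] by (simp add: sz_nat bits_shift_in)

lemma polytime_shift_in [polytime_intros]:
  assumes "polytime b" "polytime f" shows "polytime (\<lambda>x. shift_in (b x) (f x))"
proof -
  have "polytime (\<lambda>x. if b x \<or> \<not> f x = 0 then b x # bits (f x) else [])"
    by (intro polytime_intros assms)
  then show ?thesis
    by (rule polytime_cong_enc) (simp add: enc_nat_def bits_shift_in)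
qed

text \<open>Ripple-carry addition: the conditional is the majority of the two digits and the carry,
  the output digit is their parity. The most significant digit ends up on top of \<open>out\<close>,
  ready for \<open>fold shift_in\<close>.\<close>

definition add_step :: "nat \<times> nat \<times> bool \<times> bool list \<Rightarrow> nat \<times> nat \<times> bool \<times> bool list" where
  "add_step s = (case s of (x, y, c, out) \<Rightarrow>
    (x div 2, y div 2, if odd x then odd y \<or> c else odd y \<and> c, (odd x \<noteq> (odd y \<noteq> c)) # out))"

lemma add_step_apply:
  "add_step (x, y, c, out) =
    (x div 2, y div 2, if odd x then odd y \<or> c else odd y \<and> c, (odd x \<noteq> (odd y \<noteq> c)) # out)"
  by (simp add: add_step_def)

lemma add_step_sum:
  "x + y + of_bool c = 2 * (x div 2 + y div 2 + of_bool (if odd x then odd y \<or> c else odd y \<and> c)) +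
    (of_bool (odd x \<noteq> (odd y \<noteq> c)) :: nat)"
proof -
  have "x = 2 * (x div 2) + of_bool (odd x)" "y = 2 * (y div 2) + of_bool (odd y)"
    by (simp_all add: of_bool_odd_eq_mod_2)
  then show ?thesis
    by (cases "odd x"; cases "odd y"; cases c) (simp_all; presburger)+
qed

text \<open>The invariant is the number that arises when the digits produced so far are shifted into
  the sum of what is left.\<close>

lemma fold_add_step:
  assumes "fold (\<lambda>_. add_step) l (x, y, c, out) = (x', y', c', out')"
  shows "x' = x div 2 ^ length l \<and> y' = y div 2 ^ length l \<and>
    fold shift_in out' (x' + y' + of_bool c') = fold shift_in out (x + y + of_bool c)"
  using assms
proof (induction l arbitrary: x y c out)
  case (Cons a l)
  let ?c = "if odd x then odd y \<or> c else odd y \<and> c"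
  let ?b = "odd x \<noteq> (odd y \<noteq> c)"
  have "fold (\<lambda>_. add_step) l (x div 2, y div 2, ?c, ?b # out) = (x', y', c', out')"
    using Cons.prems unfolding fold_Cons comp_apply add_step_apply .
  note IH = Cons.IH[OF this]
  have "fold shift_in out' (x' + y' + of_bool c') = fold shift_in out (shift_in ?b (x div 2 + y div 2 + of_bool ?c))"
    using IH unfolding fold_Cons comp_apply by blast
  also have "shift_in ?b (x div 2 + y div 2 + of_bool ?c) = x + y + of_bool c"
    unfolding shift_in_def by (rule add_step_sum[symmetric])
  finally show ?case
    using IH unfolding length_Cons power_Suc div_mult2_eq by blast
qed simp

text \<open>The list folded over is a mere clock; it is long enough for both summands to be halved
  down to \<open>0\<close>.\<close>

lemma add_eq_fold:
  "x + y = (case fold (\<lambda>_. add_step) (bits x @ bits y) (x, y, False, []) of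
    (_, _, c, out) \<Rightarrow> fold shift_in out (of_bool c))"
proof -
  obtain x' y' c out where eq: "fold (\<lambda>_. add_step) (bits x @ bits y) (x, y, False, []) = (x', y', c, out)"
    by (metis prod_cases4)
  have "x < 2 ^ length (bits x @ bits y)" "y < 2 ^ length (bits x @ bits y)"
    using less_exp_length_bits[of x] less_exp_length_bits[of y]
    by (auto simp: power_add intro: less_le_trans)
  then show ?thesis
    using fold_add_step[OF eq] by (cases c) (auto simp: eq simp del: fold_append)
qed

lemma polytime_of_bool [polytime_intros]:
  assumes "polytime f" shows "polytime (\<lambda>x. of_bool (f x) :: nat)"
  using polytime_shift_in[OF assms polytime_const[of 0]] by (simp add: shift_in_def)

lemma polytime_add [polytime_intros]:
  assumes "polytime f" "polytime g" shows "polytime (\<lambda>x. f x + g x :: nat)"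
proof -
  define r where "r x = fold (\<lambda>_. add_step) (bits (f x) @ bits (g x)) (f x, g x, False, [])" for x
  have "polytime (\<lambda>x. fold (\<lambda>_ s. add_step s) (bits (f x) @ bits (g x)) (f x, g x, False, []))"
  proof (rule polytime_fold_add)
    show "poly_bounded sz (\<lambda>_ :: 'a. 10)" by (intro pb_intros)
    show "sz (add_step s) \<le> sz s + 10" for s
    proof -
      obtain x y c out where s: "s = (x, y, c, out)" by (metis prod_cases4)
      show ?thesis
        using sz_half_le[of x] sz_half_le[of y] sz_bool_le[of "if odd x then odd y \<or> c else odd y \<and> c"]
          sz_bool_le[of "odd x \<noteq> (odd y \<noteq> c)"]
        by (simp add: s add_step_def del: if_split)
    qed
    show "polytime (\<lambda>p. add_step (fst (snd p)))"
      unfolding add_step_def by (intro polytime_intros)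
  qed (intro polytime_intros assms)+
  then have r: "polytime r" by (simp add: r_def[abs_def] del: fold_append)
  have "polytime (\<lambda>x. fold (\<lambda>b n. shift_in b n) (snd (snd (snd (r x)))) (of_bool (fst (snd (snd (r x))))))"
  proof (rule polytime_fold_add)
    show "poly_bounded sz (\<lambda>_ :: 'a. 4)" by (intro pb_intros)
    show "sz (shift_in b n) \<le> sz n + 4" for b n by (rule sz_shift_in_le)
  qed (intro polytime_intros r)+
  moreover have "f x + g x = fold shift_in (snd (snd (snd (r x)))) (of_bool (fst (snd (snd (r x)))))" for x
    by (subst add_eq_fold) (simp add: r_def case_prod_beta)
  ultimately show ?thesis by simp
qed

text \<open>Horner's scheme: shifting a digit into the multiplier doubles the product and adds
  \<open>y\<close> if the digit is one.\<close>

lemma fold_mult: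
  "fold (\<lambda>b a. shift_in False a + (if b then y else 0)) l (n * y) = fold shift_in l n * y"
proof (induction l arbitrary: n)
  case (Cons b l)
  have "shift_in False (n * y) + (if b then y else 0) = shift_in b n * y"
    by (simp add: shift_in_def algebra_simps)
  then show ?case using Cons[of "shift_in b n"] by simp
qed simp

lemma shift_in_half: "shift_in (odd n) (n div 2) = n"
  by (simp add: shift_in_def of_bool_odd_eq_mod_2)

lemma fold_shift_in_rev_bits: "fold shift_in (rev (bits n)) 0 = n"
proof (induction n rule: less_induct)
  case (less n)
  show ?case
  proof (cases "n = 0")
    case False
    then have "fold shift_in (rev (bits (n div 2))) 0 = n div 2" by (intro less) simp
    then show ?thesis using False by (simp add: bits_pos shift_in_half)
  qed simp
qed

lemma fold_shift_in_less: "fold shift_in l n < (n + 1) * 2 ^ length l"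
proof (induction l arbitrary: n)
  case (Cons b l)
  have "fold shift_in l (shift_in b n) < (shift_in b n + 1) * 2 ^ length l" by (rule Cons)
  also have "\<dots> \<le> (2 * (n + 1)) * 2 ^ length l"
    by (intro mult_right_mono) (auto simp: shift_in_def)
  finally show ?case by simp
qed simp

lemma polytime_mult [polytime_intros]:
  assumes "polytime f" "polytime g" shows "polytime (\<lambda>x. f x * g x :: nat)"
proof -
  have "polytime (\<lambda>x. fold (\<lambda>b a. shift_in False a + (if b then g x else 0)) (rev (bits (f x))) 0)"
  proof (rule polytime_fold)
    show "polytime (\<lambda>p. shift_in False (fst (snd p)) + (if fst p then g (snd (snd p)) else 0))"
      by (intro polytime_intros polytime_compose[OF assms(2)])
    show "poly_bounded sz (\<lambda>x. 4 * (sz (f x) + sz (g x)) + 1)"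
      by (intro pb_intros assms)
    fix x l1 l2 assume l: "rev (bits (f x)) = l1 @ l2"
    \<comment> \<open>Every intermediate result is a leading part of \<open>f x\<close> times
      \<open>g x\<close>, so it has at most \<open>sz (f x) + sz (g x)\<close> bits.\<close>
    have "fold (\<lambda>b a. shift_in False a + (if b then g x else 0)) l1 0 = fold shift_in l1 0 * g x"
      using fold_mult[of "g x" l1 0] by simp
    also have "\<dots> \<le> 2 ^ length l1 * g x"
      using fold_shift_in_less[of l1 0] by (intro mult_right_mono) auto
    also have "\<dots> < 2 ^ length l1 * 2 ^ sz (g x)"
      using less_exp_sz by simp
    also have "\<dots> \<le> 2 ^ sz (f x) * 2 ^ sz (g x)"
    proof (intro mult_right_mono power_increasing)
      have "length l1 \<le> length (bits (f x))"
        using arg_cong[OF l, of length] by simp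
      then show "length l1 \<le> sz (f x)"
        using length_le_sz[of "bits (f x)"] by (simp add: sz_nat)
    qed simp_all
    finally have "fold (\<lambda>b a. shift_in False a + (if b then g x else 0)) l1 0 < 2 ^ (sz (f x) + sz (g x))"
      by (simp add: power_add)
    then show "sz (fold (\<lambda>b a. shift_in False a + (if b then g x else 0)) l1 0) \<le> 4 * (sz (f x) + sz (g x)) + 1"
      by (rule sz_nat_le)
  qed (intro polytime_intros assms)+
  moreover have "fold (\<lambda>b a. shift_in False a + (if b then g x else 0)) (rev (bits (f x))) 0 = f x * g x" for x
    using fold_mult[of "g x" "rev (bits (f x))" 0] by (simp add: fold_shift_in_rev_bits)
  ultimately show ?thesis by simp
qed

text \<open>\<open>r\<close> is the verdict on the lower digits; each later pair of unequal digits
  is more significant and overrides it.\<close>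

definition less_step :: "nat \<times> nat \<times> bool \<Rightarrow> nat \<times> nat \<times> bool" where
  "less_step s = (case s of (x, y, r) \<Rightarrow> (x div 2, y div 2, if odd x \<noteq> odd y then odd y else r))"

lemma less_step_apply:
  "less_step (x, y, r) = (x div 2, y div 2, if odd x \<noteq> odd y then odd y else r)"
  by (simp add: less_step_def)

lemma less_step_less:
  "x < y \<or> x = y \<and> r \<longleftrightarrow> x div 2 < y div 2 \<or> x div 2 = y div 2 \<and> (if odd x \<noteq> odd y then odd y else r)"
  for x y :: nat
  by (cases "odd x"; cases "odd y"; auto elim!: oddE evenE; presburger)

lemma fold_less_step:
  assumes "fold (\<lambda>_. less_step) l (x, y, r) = (x', y', r')"
  shows "x' = x div 2 ^ length l \<and> y' = y div 2 ^ length l \<and> ((x' < y' \<or> x' = y' \<and> r') \<longleftrightarrow> (x < y \<or> x = y \<and> r))"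
  using assms
proof (induction l arbitrary: x y r)
  case (Cons a l)
  have "fold (\<lambda>_. less_step) l (x div 2, y div 2, if odd x \<noteq> odd y then odd y else r) = (x', y', r')"
    using Cons.prems unfolding fold_Cons comp_apply less_step_apply .
  from Cons.IH[OF this] show ?case
    using less_step_less[of x y r] unfolding length_Cons power_Suc div_mult2_eq by blast
qed simp

lemma less_eq_fold:
  "x < y \<longleftrightarrow> snd (snd (fold (\<lambda>_. less_step) (bits x @ bits y) (x, y, False)))"
proof -
  obtain x' y' r where eq: "fold (\<lambda>_. less_step) (bits x @ bits y) (x, y, False) = (x', y', r)"
    by (metis prod_cases3)
  have "x < 2 ^ length (bits x @ bits y)" "y < 2 ^ length (bits x @ bits y)"
    using less_exp_length_bits[of x] less_exp_length_bits[of y]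
    by (auto simp: power_add intro: less_le_trans)
  then show ?thesis
    using fold_less_step[OF eq] by (auto simp: eq simp del: fold_append)
qed

lemma polytime_less [polytime_intros]:
  assumes "polytime f" "polytime g" shows "polytime (\<lambda>x. f x < (g x :: nat))"
proof -
  have "polytime (\<lambda>x. fold (\<lambda>_ s. less_step s) (bits (f x) @ bits (g x)) (f x, g x, False))"
  proof (rule polytime_fold_add)
    show "poly_bounded sz (\<lambda>_ :: 'a. 3)" by (intro pb_intros)
    show "sz (less_step s) \<le> sz s + 3" for s
    proof -
      obtain x y r where s: "s = (x, y, r)" by (metis prod_cases3)
      show ?thesis
        using sz_half_le[of x] sz_half_le[of y] sz_bool_le[of "if odd x \<noteq> odd y then odd y else r"]
        by (simp add: s less_step_def del: if_split)
    qed
    show "polytime (\<lambda>p. less_step (fst (snd p)))"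
      unfolding less_step_def by (intro polytime_intros)
  qed (intro polytime_intros assms)+
  from polytime_snd[OF polytime_snd[OF this]] show ?thesis
    unfolding less_eq_fold .
qed

lemma polytime_nat_eq [polytime_intros]:
  assumes "polytime f" "polytime g" shows "polytime (\<lambda>x. f x = (g x :: nat))"
proof -
  have "polytime (\<lambda>x. \<not> f x < g x \<and> \<not> g x < f x)"
    by (intro polytime_intros assms)
  then show ?thesis by (rule polytime_cong_enc) (simp add: enc_bool_def)
qed

section \<open>The Bellman--Ford tables\<close>

lemma sz_append_le: "sz (a @ b) \<le> sz a + sz b"
  by (induction a) auto

lemma polytime_concat_map [polytime_intros]:
  assumes "polytime L" "polytime (\<lambda>p. g (fst p) (snd p))"
  shows "polytime (\<lambda>x. concat (map (\<lambda>y. g y x) (L x)))"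
proof -
  obtain B where B: "poly_bounded sz B" "\<And>x y. y \<in> set (L x) \<Longrightarrow> sz (g y x) \<le> B x"
    using polytime_elem_bound[OF assms] by auto
  have "polytime (\<lambda>x. fold (\<lambda>y s. s @ g y x) (L x) [])"
  proof (rule polytime_fold_add[OF assms(1)])
    show "poly_bounded sz B" by (rule B)
    show "sz (s @ g y x) \<le> sz s + B x" if "y \<in> set (L x)" for x y s
      using B(2)[OF that] sz_append_le[of s "g y x"] by simp
    show "polytime (\<lambda>p. fst (snd p) @ g (fst p) (snd (snd p)))"
      using polytime_compose[OF assms(2), of "\<lambda>p. (fst p, snd (snd p))"]
      by (intro polytime_append) (simp_all add: polytime_intros)
  qed (intro polytime_intros)
  moreover have "fold (\<lambda>y s. s @ g y x) l s = s @ concat (map (\<lambda>y. g y x) l)" for x l s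
    by (induction l arbitrary: s) simp_all
  ultimately show ?thesis by simp
qed

type_synonym frac = "nat \<times> nat \<times> nat"
type_synonym edge = "nat \<times> nat \<times> frac \<times> nat \<times> nat"
type_synonym table = "(nat \<times> frac) list"

text \<open>The triple \<open>(p, n, b)\<close> stands for \<open>(p - n) / b\<close>, so that no subtraction of numbers in
  binary has to be carried out.\<close>

definition frac_val :: "frac \<Rightarrow> rat" where
  "frac_val r = (case r of (p, n, b) \<Rightarrow> (of_nat p - of_nat n) / of_nat b)"

text \<open>The inequality \<open>(p - n) / b < (p' - n') / b'\<close> multiplied by the
  denominators, with subtracted terms moved to the other side.\<close>

definition frac_less :: "frac \<Rightarrow> frac \<Rightarrow> bool" where
  "frac_less r r' = (case r of (p, n, b) \<Rightarrow> case r' of (p', n', b') \<Rightarrow>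
    p * b' + n' * b < p' * b + n * b')"

definition frac_pos :: "frac \<Rightarrow> bool" where
  "frac_pos r = (case r of (p, n, b) \<Rightarrow> n < p)"

text \<open>The map from \<open>x\<close> to \<open>(x - w) * d\<close> on unreduced fractions, with
  \<open>d\<close> given as \<open>u / v\<close>; the weight is subtracted by exchanging its
  positive and negative parts.\<close>

definition frac_step :: "frac \<Rightarrow> nat \<times> nat \<Rightarrow> frac \<Rightarrow> frac" where
  "frac_step w d r = (case r of (p, n, b) \<Rightarrow> case w of (p', n', b') \<Rightarrow> case d of (u, v) \<Rightarrow>
    ((p * b' + n' * b) * u, (n * b' + p' * b) * u, b * b' * v))"

text \<open>A list with at most one element plays the part of an optional value.\<close>

definition best :: "nat \<Rightarrow> table \<Rightarrow> frac list" where
  "best p T = fold (\<lambda>e acc. if fst e = p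
     then (case acc of [] \<Rightarrow> [snd e] | r # _ \<Rightarrow> if frac_less r (snd e) then [snd e] else acc)
     else acc) T []"

definition extend :: "edge \<Rightarrow> frac \<Rightarrow> nat \<times> frac" where
  "extend e r = (case e of (p, q, w, d) \<Rightarrow> (q, frac_step w d r))"

definition first_table :: "edge list \<Rightarrow> nat list \<Rightarrow> frac \<Rightarrow> table" where
  "first_table E I \<nu> = concat (map (\<lambda>e. if \<exists>i \<in> set I. i = fst e then [extend e \<nu>] else []) E)"

text \<open>Entries are produced per edge, so no list of vertices is needed. Taking only the best
  entry at the source keeps the table no longer than \<open>E\<close>, even when a vertex has
  several entries.\<close>

definition next_table :: "edge list \<Rightarrow> table \<Rightarrow> table" where
  "next_table E T = concat (map (\<lambda>e. case best (fst e) T of [] \<Rightarrow> [] | r # _ \<Rightarrow> [extend e r]) E)"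

text \<open>\<open>E\<close> also serves as the clock. In the end the pool contains the tables for
  the lengths from \<open>1\<close> to \<open>length E\<close>, and the second component is the
  table for \<open>length E + 1\<close>.\<close>

definition tables :: "edge list \<Rightarrow> nat list \<Rightarrow> frac \<Rightarrow> table \<times> table" where
  "tables E I \<nu> = fold (\<lambda>_ s. (snd s @ fst s, next_table E (snd s))) E ([], first_table E I \<nu>)"

text \<open>The second disjunct detects a late improvement; a vertex occurring only in the last
  table counts as improved.\<close>

definition decide :: "edge list \<Rightarrow> nat list \<Rightarrow> frac \<Rightarrow> bool" where
  "decide E I \<nu> = (case tables E I \<nu> of (pool, T) \<Rightarrow>
     (\<exists>e \<in> set (T @ pool). frac_pos (snd e)) \<or>
     (\<exists>e \<in> set T. \<forall>e' \<in> set pool. fst e' \<noteq> fst e \<or> frac_less (snd e') (snd e)))"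

lemma polytime_frac_less [polytime_intros]:
  assumes "polytime f" "polytime g" shows "polytime (\<lambda>x. frac_less (f x) (g x))"
  unfolding frac_less_def by (intro polytime_intros assms)

lemma polytime_frac_pos [polytime_intros]:
  assumes "polytime f" shows "polytime (\<lambda>x. frac_pos (f x))"
  unfolding frac_pos_def by (intro polytime_intros assms)

lemma polytime_frac_step [polytime_intros]:
  assumes "polytime f" "polytime g" "polytime h" shows "polytime (\<lambda>x. frac_step (f x) (g x) (h x))"
  unfolding frac_step_def by (intro polytime_intros assms)

lemma polytime_extend [polytime_intros]:
  assumes "polytime f" "polytime g" shows "polytime (\<lambda>x. extend (f x) (g x))"
  unfolding extend_def by (intro polytime_intros assms)

lemma polytime_best [polytime_intros]:
  assumes "polytime f" "polytime g" shows "polytime (\<lambda>x. best (f x) (g x))"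
  unfolding best_def
proof (rule polytime_fold_add)
  show "poly_bounded sz (\<lambda>x. sz (g x) + 2)"
    by (intro pb_intros assms)
  show "sz (if fst y = f x
     then (case s of [] \<Rightarrow> [snd y] | r # _ \<Rightarrow> if frac_less r (snd y) then [snd y] else s)
     else s) \<le> sz s + (sz (g x) + 2)" if "y \<in> set (g x)" for x y s
    using sz_elem_le[OF that] by (cases y) (auto split: list.split)
qed (intro polytime_intros assms polytime_compose[OF assms(1)])+

lemma polytime_first_table [polytime_intros]:
  assumes "polytime f" "polytime g" "polytime h"
  shows "polytime (\<lambda>x. first_table (f x) (g x) (h x))"
  unfolding first_table_def
  by (intro polytime_intros assms polytime_compose[OF assms(2)] polytime_compose[OF assms(3)])

lemma polytime_next_table [polytime_intros]:
  assumes "polytime f" "polytime g"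
  shows "polytime (\<lambda>x. next_table (f x) (g x))"
  unfolding next_table_def
  by (intro polytime_intros assms polytime_compose[OF assms(2)])

text \<open>Magnitudes are bounded instead of encoding sizes because powers of two combine easily
  under sums and products.\<close>

definition table_bounded :: "edge list \<Rightarrow> nat \<Rightarrow> table \<Rightarrow> bool" where
  "table_bounded E c T \<longleftrightarrow> (\<forall>(q, p, n, b) \<in> set T. sz q \<le> sz E \<and> p < 2 ^ c \<and> n < 2 ^ c \<and> b < 2 ^ c)"

lemma table_bounded_mono: "table_bounded E c T \<Longrightarrow> c \<le> c' \<Longrightarrow> table_bounded E c' T"
  unfolding table_bounded_def by (fastforce intro: less_le_trans power_increasing)

lemma table_bounded_append [simp]:
  "table_bounded E c (S @ T) \<longleftrightarrow> table_bounded E c S \<and> table_bounded E c T"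
  by (simp only: table_bounded_def set_append ball_Un)

text \<open>Bringing two fractions to a common denominator and multiplying by the discount factor
  cost \<open>m\<close> bits each, and the sum in between costs one more.\<close>

lemma frac_step_bounded:
  assumes "p < 2 ^ c" "n < 2 ^ c" "b < 2 ^ c" "p' < 2 ^ m" "n' < 2 ^ m" "b' < 2 ^ m" "u < 2 ^ m" "v < 2 ^ m"
    and eq: "frac_step (p', n', b') (u, v) (p, n, b) = (p'', n'', b'')"
  shows "p'' < 2 ^ (c + (2 * m + 1)) \<and> n'' < 2 ^ (c + (2 * m + 1)) \<and> b'' < 2 ^ (c + (2 * m + 1))"
proof -
  have prod: "x * y < 2 ^ (i + j)" if "x < 2 ^ i" "y < 2 ^ j" for x y i j :: nat
    using mult_strict_mono'[OF that] by (simp add: power_add)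
  have "p * b' + n' * b < 2 ^ Suc (c + m)" "n * b' + p' * b < 2 ^ Suc (c + m)"
    using prod[OF assms(1,6)] prod[OF assms(2,6)] prod[OF assms(3,5)] prod[OF assms(3,4)]
    by (auto simp: mult.commute[of _ b])
  then have "(p * b' + n' * b) * u < 2 ^ (Suc (c + m) + m)" "(n * b' + p' * b) * u < 2 ^ (Suc (c + m) + m)"
    using prod assms by blast+
  moreover have "b * b' * v < 2 ^ (c + m + m)"
    using prod assms by blast
  then have "b * b' * v < 2 ^ (Suc (c + m) + m)"
    by (simp add: power_add)
  ultimately show ?thesis
    using eq by (simp add: frac_step_def mult_2 add.assoc)
qed

lemma edge_bounds:
  fixes E :: "edge list"
  assumes "(p, q, (a, b, c), u, v) \<in> set E"
  shows "sz q \<le> sz E" "a < 2 ^ sz E" "b < 2 ^ sz E" "c < 2 ^ sz E" "u < 2 ^ sz E" "v < 2 ^ sz E"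
proof -
  show "sz q \<le> sz E" "a < 2 ^ sz E" "b < 2 ^ sz E" "c < 2 ^ sz E" "u < 2 ^ sz E" "v < 2 ^ sz E"
    using sz_elem_le[OF assms] by (auto intro!: less_exp_if_sz_le)
qed

lemma table_bounded_extend:
  assumes "e \<in> set E" "r = (p, n, b)" "p < 2 ^ c" "n < 2 ^ c" "b < 2 ^ c"
  shows "table_bounded E (c + (2 * sz E + 1)) [extend e r]"
proof -
  obtain i j p' n' b' u v where e: "e = (i, j, (p', n', b'), u, v)"
    by (metis prod_cases3 surj_pair)
  note E = edge_bounds[OF assms(1)[unfolded e]]
  obtain p'' n'' b'' where eq: "frac_step (p', n', b') (u, v) (p, n, b) = (p'', n'', b'')"
    by (metis prod_cases3)
  show ?thesis
    using frac_step_bounded[OF assms(3-5) E(2-) eq] E(1) eq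
    by (simp add: table_bounded_def extend_def e assms(2))
qed

lemma best_mem: "best p T = r # rs \<Longrightarrow> (p, r) \<in> set T"
proof -
  have "set (fold (\<lambda>e acc. if fst e = p
     then (case acc of [] \<Rightarrow> [snd e] | r # _ \<Rightarrow> if frac_less r (snd e) then [snd e] else acc)
     else acc) T acc) \<subseteq> set acc \<union> {r. (p, r) \<in> set T}" for acc
  proof (induction T arbitrary: acc)
    case (Cons e T)
    show ?case
      by (simp, intro conjI impI order_trans[OF Cons]) (auto split: list.splits if_splits)
  qed simp
  from this[of "[]"] show "best p T = r # rs \<Longrightarrow> (p, r) \<in> set T"
    unfolding best_def by auto
qed

lemma next_table_bounded:
  assumes "table_bounded E c T"
  shows "table_bounded E (c + (2 * sz E + 1)) (next_table E T)"
proof -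
  have "table_bounded E (c + (2 * sz E + 1)) (case best (fst e) T of [] \<Rightarrow> [] | r # _ \<Rightarrow> [extend e r])"
    if "e \<in> set E" for e
  proof (cases "best (fst e) T")
    case (Cons r rs)
    obtain p n b where r: "r = (p, n, b)" by (metis prod_cases3)
    have "p < 2 ^ c \<and> n < 2 ^ c \<and> b < 2 ^ c"
      using best_mem[OF Cons] assms by (auto simp: table_bounded_def r)
    then show ?thesis
      using table_bounded_extend[OF that r] Cons by simp
  qed (simp add: table_bounded_def)
  then show ?thesis
    by (auto simp: next_table_def table_bounded_def)
qed

lemma first_table_bounded:
  assumes "p < 2 ^ c" "n < 2 ^ c" "b < 2 ^ c"
  shows "table_bounded E (c + (2 * sz E + 1)) (first_table E I (p, n, b))"
  using table_bounded_extend[OF _ refl assms, of _ E]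
  by (auto simp: first_table_def table_bounded_def)

lemma length_concat_map_le:
  assumes "\<And>y. length (g y) \<le> 1" shows "length (concat (map g L)) \<le> length L"
proof (induction L)
  case (Cons y L)
  then show ?case using assms[of y] by simp
qed simp

lemma length_next_table: "length (next_table E T) \<le> length E"
  unfolding next_table_def by (rule length_concat_map_le) (simp split: list.split)

lemma length_first_table: "length (first_table E I \<nu>) \<le> length E"
  unfolding first_table_def by (rule length_concat_map_le) simp

text \<open>The three numbers of an entry take \<open>4 * c + 1\<close> symbols each, the three
  pairings add 3, and the list cell adds 1.\<close>

lemma sz_table_le:
  assumes "table_bounded E c T"
  shows "sz T \<le> 1 + length T * (sz E + 12 * c + 7)"
proof -
  have "sz e \<le> sz E + 12 * c + 6" if "e \<in> set T" for e
  proof -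
    obtain q p n b where e: "e = (q, p, n, b)" by (metis prod_cases4)
    then have "sz q \<le> sz E" "p < 2 ^ c" "n < 2 ^ c" "b < 2 ^ c"
      using assms that by (auto simp: table_bounded_def)
    then show ?thesis
      using sz_nat_le[of p c] sz_nat_le[of n c] sz_nat_le[of b c] by (simp add: e)
  qed
  from sz_list_le[of T, OF this] show ?thesis by (simp add: ac_simps)
qed

text \<open>A round multiplies by input numbers only, never two table entries with each other, so
  the number of bits grows linearly with the rounds.\<close>

lemma tables_bounded:
  fixes E :: "edge list"
  assumes "fold (\<lambda>_ s. (snd s @ fst s, next_table E (snd s))) l ([], first_table E I \<nu>) = (pool, T)"
  shows "length T \<le> length E \<and> length pool \<le> length l * length E \<and>
    table_bounded E (sz \<nu> + (length l + 1) * (2 * sz E + 1)) T \<and>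
    table_bounded E (sz \<nu> + (length l + 1) * (2 * sz E + 1)) pool"
  using assms
proof (induction l arbitrary: pool T rule: rev_induct)
  case Nil
  obtain p n b where \<nu>: "\<nu> = (p, n, b)" by (metis prod_cases3)
  have "p < 2 ^ sz \<nu>" "n < 2 ^ sz \<nu>" "b < 2 ^ sz \<nu>"
    by (rule less_exp_if_sz_le, simp add: \<nu>)+
  from first_table_bounded[OF this, of E I]
  have "table_bounded E (sz \<nu> + (2 * sz E + 1)) (first_table E I \<nu>)"
    by (simp only: \<nu>)
  then show ?case
    using Nil.prems length_first_table[of E I \<nu>] by (auto simp: table_bounded_def[of _ _ "[]"])
next
  case (snoc a l)
  obtain pool' T' where eq: "fold (\<lambda>_ s. (snd s @ fst s, next_table E (snd s))) l ([], first_table E I \<nu>) = (pool', T')"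
    by (rule prod.exhaust)
  note IH = snoc.IH[OF eq]
  let ?c = "sz \<nu> + (length l + 1) * (2 * sz E + 1)"
  have c: "sz \<nu> + (length (l @ [a]) + 1) * (2 * sz E + 1) = ?c + (2 * sz E + 1)" by simp
  have "pool = T' @ pool'" "T = next_table E T'"
    using snoc.prems by (simp_all add: eq)
  moreover have "table_bounded E (?c + (2 * sz E + 1)) T'" "table_bounded E (?c + (2 * sz E + 1)) pool'"
    using IH by (auto intro: table_bounded_mono)
  ultimately show ?case
    unfolding c using IH next_table_bounded[of E ?c T'] length_next_table[of E T'] by simp
qed

text \<open>One best entry may be extended along many edges, so the additive fold rule does not fit.
  The bound is the number of entries times the size of an entry with the final number of
  bits.\<close>

lemma polytime_tables [polytime_intros]:
  assumes "polytime f" "polytime g" "polytime h"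
  shows "polytime (\<lambda>x. tables (f x) (g x) (h x))"
  unfolding tables_def
proof (rule polytime_fold)
  let ?c = "\<lambda>x. sz (h x) + (sz (f x) + 1) * (2 * sz (f x) + 1)"
  let ?B = "\<lambda>x. 3 + (sz (f x) * sz (f x) + sz (f x)) * (sz (f x) + 12 * ?c x + 7)"
  show "poly_bounded sz ?B"
    by (intro pb_intros assms)
  fix x l1 l2 assume l: "f x = l1 @ l2"
  obtain pool T where eq: "fold (\<lambda>_ s. (snd s @ fst s, next_table (f x) (snd s))) l1
      ([], first_table (f x) (g x) (h x)) = (pool, T)"
    by (rule prod.exhaust)
  have l1: "length l1 \<le> sz (f x)" and fx: "length (f x) \<le> sz (f x)"
    using length_le_sz[of "f x"] by (simp_all add: l)
  note b = tables_bounded[OF eq]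
  have c: "sz (h x) + (length l1 + 1) * (2 * sz (f x) + 1) \<le> ?c x"
    using l1 by (intro add_left_mono mult_right_mono) auto
  define K where "K = sz (f x) + 12 * ?c x + 7"
  have "length pool \<le> length l1 * length (f x)" using b by simp
  also have "\<dots> \<le> sz (f x) * sz (f x)" by (intro mult_mono l1 fx) auto
  finally have "length pool * K \<le> (sz (f x) * sz (f x)) * K"
    by (rule mult_right_mono) simp
  moreover have "length T * K \<le> sz (f x) * K"
    using b fx by (intro mult_right_mono) auto
  moreover have "table_bounded (f x) (?c x) pool" "table_bounded (f x) (?c x) T"
    using b by (simp_all only: table_bounded_mono[OF _ c])
  note this[THEN sz_table_le, folded K_def]
  ultimately have "sz (pool, T) \<le> 3 + (sz (f x) * sz (f x) + sz (f x)) * K"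
    unfolding sz_prod add_mult_distrib by linarith
  then show "sz (fold (\<lambda>_ s. (snd s @ fst s, next_table (f x) (snd s))) l1
      ([], first_table (f x) (g x) (h x))) \<le> ?B x"
    by (simp only: eq K_def)
qed (intro polytime_intros assms polytime_compose[OF assms(1)])+

lemma polytime_decide [polytime_intros]:
  assumes "polytime f" "polytime g" "polytime h"
  shows "polytime (\<lambda>x. decide (f x) (g x) (h x))"
  unfolding decide_def by (intro polytime_intros assms assms[THEN polytime_compose])

section \<open>Reading the input\<close>

lemma sz_0 [simp]: "sz (0 :: nat) = 1"
  by (simp add: sz_nat)

lemma sz_False [simp]: "sz False = 1" and sz_True [simp]: "sz True = 3"
  by (simp_all add: sz_def enc_bool_def)

type_synonym token = "bool \<times> nat"
type_synonym lexer = "nat \<times> bool \<times> token list \<times> token list list"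

text \<open>The state holds the value of the digits read so far, a pending minus sign, the current
  segment and the finished segments, both in reverse order.\<close>

definition lex_step :: "nat \<Rightarrow> lexer \<Rightarrow> lexer" where
  "lex_step c s = (case s of (acc, neg, seg, segs) \<Rightarrow>
     if c = 1 then (shift_in False acc, neg, seg, segs)
     else if c = 2 then (shift_in True acc, neg, seg, segs)
     else if c = 3 then (0, False, (neg, acc) # seg, segs)
     else if c = 4 then (acc, neg, [], seg # segs)
     else (acc, True, seg, segs))"

definition frac_of :: "token \<Rightarrow> token \<Rightarrow> frac" where
  "frac_of a b = (if fst a then (0, snd a, snd b) else (snd a, 0, snd b))"

text \<open>The tokens of a segment arrive in reverse order, so \<open>buf\<close> holds the tokens of the current
  transition that follow \<open>x\<close>.\<close>

definition group_step :: "token \<Rightarrow> token list \<times> edge list \<Rightarrow> token list \<times> edge list" where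
  "group_step x s = (case s of (buf, E) \<Rightarrow>
     (case buf of [] \<Rightarrow> (x # buf, E) | a # l1 \<Rightarrow>
     (case l1 of [] \<Rightarrow> (x # buf, E) | q # l2 \<Rightarrow>
     (case l2 of [] \<Rightarrow> (x # buf, E) | wn # l3 \<Rightarrow>
     (case l3 of [] \<Rightarrow> (x # buf, E) | wd # l4 \<Rightarrow>
     (case l4 of [] \<Rightarrow> (x # buf, E) | dn # l5 \<Rightarrow>
     (case l5 of [] \<Rightarrow> (x # buf, E) | dd # l6 \<Rightarrow>
       ([], (snd x, snd q, frac_of wn wd, snd dn, snd dd) # E))))))))"

text \<open>Loading the input reverses it, hence \<open>rev w\<close>. The closed segments arrive
  with the initial states first; the last two numbers of the input stay in an unclosed segment.
  Reading tokens backwards, \<open>group_step\<close> needs seven per transition, so the two tokens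
  of the threshold, which come last, remain in its buffer.\<close>

definition solve :: "nat list \<Rightarrow> bool" where
  "solve w = (case fold lex_step (rev w) (0, False, [], []) of (_, _, _, segs) \<Rightarrow>
     case segs of [] \<Rightarrow> False | I # segs' \<Rightarrow>
     case segs' of [] \<Rightarrow> False | E # _ \<Rightarrow>
     case fold group_step E ([], []) of (buf, edges) \<Rightarrow>
     case buf of [] \<Rightarrow> False | a # l \<Rightarrow>
     case l of [] \<Rightarrow> False | b # _ \<Rightarrow>
       decide edges (map snd I) (frac_of a b))"

lemma polytime_frac_of [polytime_intros]:
  assumes "polytime f" "polytime g" shows "polytime (\<lambda>x. frac_of (f x) (g x))"
  unfolding frac_of_def by (intro polytime_intros assms)

lemma polytime_lex_step [polytime_intros]:
  assumes "polytime f" "polytime g" shows "polytime (\<lambda>x. lex_step (f x) (g x))"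
  unfolding lex_step_def by (intro polytime_intros assms)

lemma polytime_group_step:
  "polytime (\<lambda>p :: token \<times> token list \<times> edge list. group_step (fst p) (snd p))"
  unfolding group_step_def by (intro polytime_intros)

lemma sz_lex_step_le: "sz (lex_step c s) \<le> sz s + 10"
proof -
  obtain acc neg seg segs where s: "s = (acc, neg, seg, segs)" by (metis prod_cases4)
  show ?thesis
    using sz_shift_in_le[of False acc] sz_shift_in_le[of True acc]
    by (simp add: s lex_step_def)
qed

lemma sz_frac_of_le: "sz (frac_of a b) \<le> sz a + sz b + 3"
  by (cases a; cases b) (simp add: frac_of_def)

lemma sz_group_step_le: "sz (group_step x s) \<le> sz s + sz x + 10"
proof -
  obtain buf E where s: "s = (buf, E)" by (metis surj_pair)
  have snd_le: "sz (snd t) < sz t" for t :: token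
    by (cases t) simp
  show ?thesis
  proof (cases "\<exists>a q wn wd dn dd l. buf = a # q # wn # wd # dn # dd # l")
    case True
    then obtain a q wn wd dn dd l where "buf = a # q # wn # wd # dn # dd # l" by blast
    then show ?thesis
      using snd_le[of x] snd_le[of q] snd_le[of dn] snd_le[of dd] sz_frac_of_le[of wn wd]
      by (simp add: s group_step_def)
  next
    case False
    then have "group_step x s = (x # buf, E)"
      by (auto simp: s group_step_def split: list.split)
    then show ?thesis by (simp add: s)
  qed
qed

lemma polytime_fold_lex [polytime_intros]:
  assumes "polytime f" "polytime g" shows "polytime (\<lambda>x. fold lex_step (f x) (g x))"
proof -
  have "polytime (\<lambda>x. fold (\<lambda>c s. lex_step c s) (f x) (g x))"
  proof (rule polytime_fold_add[OF assms])
    show "poly_bounded sz (\<lambda>_ :: 'a. 10)" by (intro pb_intros)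
  qed (intro polytime_intros sz_lex_step_le)+
  then show ?thesis by simp
qed

lemma polytime_fold_group [polytime_intros]:
  assumes "polytime f" "polytime g" shows "polytime (\<lambda>x. fold group_step (f x) (g x))"
proof -
  have "polytime (\<lambda>x. fold (\<lambda>c s. group_step c s) (f x) (g x))"
  proof (rule polytime_fold_add[OF assms])
    show "poly_bounded sz (\<lambda>x. sz (f x) + 10)" by (intro pb_intros assms)
    show "sz (group_step y s) \<le> sz s + (sz (f x) + 10)" if "y \<in> set (f x)" for x y s
      using sz_group_step_le[of y s] sz_elem_le[OF that] by simp
    show "polytime (\<lambda>p. group_step (fst p) (fst (snd p)))"
      using polytime_compose[OF polytime_group_step, of "\<lambda>p. (fst p, fst (snd p))"]
      by (simp add: polytime_intros)
  qed
  then show ?thesis by simp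
qed

lemma polytime_solve: "polytime solve"
proof -
  have "polytime (\<lambda>w. solve w)"
    unfolding solve_def by (intro polytime_intros)
  then show ?thesis by simp
qed

section \<open>Correctness of the Bellman--Ford criterion\<close>

type_synonym 'q wedge = "'q \<times> 'q \<times> rat \<times> rat"

fun relax :: "'q wedge \<Rightarrow> rat \<Rightarrow> rat" where
  "relax (p, q, w, d) x = (x - w) * d"

fun chain :: "'q wedge set \<Rightarrow> 'q \<Rightarrow> 'q wedge list \<Rightarrow> 'q \<Rightarrow> bool" where
  "chain G p [] q \<longleftrightarrow> p = q"
| "chain G p (e # es) q \<longleftrightarrow> e \<in> G \<and> fst e = p \<and> chain G (fst (snd e)) es q"

lemma chain_append: "chain G p (es @ fs) q \<longleftrightarrow> (\<exists>m. chain G p es m \<and> chain G m fs q)"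
  by (induction es arbitrary: p) auto

lemma chain_set: "chain G p es q \<Longrightarrow> set es \<subseteq> G"
  by (induction es arbitrary: p) auto

lemma chain_last: "chain G p es q \<Longrightarrow> es \<noteq> [] \<Longrightarrow> q = fst (snd (last es))"
  by (induction es arbitrary: p) (auto split: if_splits)

lemma chain_power: "chain G m es m \<Longrightarrow> chain G m (concat (replicate n es)) m"
  by (induction n) (auto simp: chain_append)

locale discounted_graph =
  fixes G :: "'q wedge set" and I :: "'q set" and \<nu> :: rat
  assumes finite_G: "finite G"
    and slope: "(p, q, w, d) \<in> G \<Longrightarrow> 1 < d"
begin

definition walk :: "nat \<Rightarrow> 'q \<Rightarrow> rat \<Rightarrow> bool" where
  "walk k q r \<longleftrightarrow> (\<exists>p \<in> I. \<exists>es. chain G p es q \<and> length es = k \<and> r = fold relax es \<nu>)"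

lemma walk_1: "walk (Suc 0) q r \<longleftrightarrow> (\<exists>e \<in> G. fst e \<in> I \<and> q = fst (snd e) \<and> r = relax e \<nu>)"
  by (force simp: walk_def length_Suc_conv)

lemma walk_Suc: "walk (Suc k) q r \<longleftrightarrow>
    (\<exists>e \<in> G. \<exists>r'. walk k (fst e) r' \<and> q = fst (snd e) \<and> r = relax e r')" (is "?l \<longleftrightarrow> ?r")
proof
  assume ?l
  then obtain p es where p: "p \<in> I" "chain G p es q" "length es = Suc k" "r = fold relax es \<nu>"
    by (auto simp: walk_def)
  then obtain es' e where "es = es' @ [e]"
    by (metis length_Suc_conv_rev)
  with p show ?r
    by (force simp: walk_def chain_append)
next
  assume ?r
  then obtain e p es where "e \<in> G" "p \<in> I" "chain G p es (fst e)" "length es = k" "q = fst (snd e)"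
      "r = relax e (fold relax es \<nu>)"
    by (auto simp: walk_def)
  then show ?l
    unfolding walk_def by (intro bexI[of _ p] exI[of _ "es @ [e]"]) (auto simp: chain_append)
qed

text \<open>A slope of at least \<open>1\<close> means that gaps between thresholds never
  shrink.\<close>

lemma relax_expanding: "e \<in> G \<Longrightarrow> x \<le> y \<Longrightarrow> relax e x + (y - x) \<le> relax e y"
proof -
  assume "e \<in> G" "x \<le> y"
  moreover obtain p q w d where e: "e = (p, q, w, d)" by (metis prod_cases4)
  ultimately have "(y - x) * 1 \<le> (y - x) * d"
    using slope[of p q w d] by (intro mult_left_mono) auto
  then show ?thesis by (simp add: e algebra_simps)
qed

lemma fold_relax_expanding:
  "set es \<subseteq> G \<Longrightarrow> x \<le> y \<Longrightarrow> fold relax es x + (y - x) \<le> fold relax es y"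
proof (induction es arbitrary: x y)
  case (Cons e es)
  have 1: "relax e x + (y - x) \<le> relax e y"
    using Cons.prems by (intro relax_expanding) auto
  then have "fold relax es (relax e x) + (relax e y - relax e x) \<le> fold relax es (relax e y)"
    using Cons.prems by (intro Cons.IH) auto
  with 1 show ?case by simp
qed simp

lemma fold_relax_mono: "set es \<subseteq> G \<Longrightarrow> x \<le> y \<Longrightarrow> fold relax es x \<le> fold relax es y"
  using fold_relax_expanding[of es x y] by simp

lemma relax_mono: "e \<in> G \<Longrightarrow> x \<le> y \<Longrightarrow> relax e x \<le> relax e y"
  using relax_expanding[of e x y] by simp

text \<open>After each repetition the threshold is at least \<open>x\<close>, so by expansion the
  next one gains at least as much as the first.\<close>

lemma fold_relax_pump:
  assumes "set es \<subseteq> G" "x \<le> fold relax es x"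
  shows "x + of_nat n * (fold relax es x - x) \<le> fold relax (concat (replicate n es)) x"
proof (induction n)
  case (Suc n)
  let ?y = "fold relax (concat (replicate n es)) x"
  have "0 \<le> of_nat n * (fold relax es x - x)"
    using assms(2) by simp
  with Suc have y: "x \<le> ?y" by linarith
  have "concat (replicate (Suc n) es) = concat (replicate n es) @ es"
    by (metis append_Nil2 concat.simps concat_append replicate_Suc replicate_append_same)
  then have "fold relax (concat (replicate (Suc n) es)) x = fold relax es ?y"
    by simp
  then show ?case
    using fold_relax_expanding[OF assms(1) y] Suc by (simp add: algebra_simps)
qed simp

text \<open>The rationals are archimedean, so enough repetitions outweigh even a negative threshold
  at the entry of the cycle.\<close>

lemma improving_cycle:
  assumes "p \<in> I" "chain G p as m" "as \<noteq> []" "chain G m bs m"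
    and "fold relax as \<nu> < fold relax bs (fold relax as \<nu>)"
  shows "\<exists>k q r. 1 \<le> k \<and> walk k q r \<and> 0 < r"
proof -
  let ?x = "fold relax as \<nu>"
  let ?\<delta> = "fold relax bs ?x - ?x"
  obtain n where "- ?x < of_nat n * ?\<delta>"
    using ex_less_of_nat_mult[of ?\<delta> "- ?x"] assms(5) by auto
  moreover have "?x + of_nat n * ?\<delta> \<le> fold relax (concat (replicate n bs)) ?x"
    using chain_set[OF assms(4)] assms(5) by (intro fold_relax_pump) auto
  ultimately have "0 < fold relax (as @ concat (replicate n bs)) \<nu>"
    by simp
  moreover have "chain G p (as @ concat (replicate n bs)) m"
    using assms(2) chain_power[OF assms(4)] by (auto simp: chain_append)
  moreover have "1 \<le> length (as @ concat (replicate n bs))"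
    using assms(3) by (cases as) auto
  ultimately show ?thesis
    using assms(1) unfolding walk_def by blast
qed

text \<open>Cutting a cycle out of a long walk gives a shorter one with at least the same value, unless
  the cycle is improving.\<close>

lemma long_walk:
  assumes "walk K q r" "card ((fst \<circ> snd) ` G) < K"
  shows "(\<exists>k q r. 1 \<le> k \<and> walk k q r \<and> 0 < r) \<or> (\<exists>k r'. 1 \<le> k \<and> k < K \<and> walk k q r' \<and> r \<le> r')"
proof -
  obtain p es where es: "p \<in> I" "chain G p es q" "length es = K" "r = fold relax es \<nu>"
    using assms(1) by (auto simp: walk_def)
  \<comment> \<open>The pigeonhole argument runs over edge targets, which leaves out the start. The
    part before the cycle thus contains an edge, and the shortened walk is nonempty.\<close>
  have "card (set (map (fst \<circ> snd) es)) \<le> card ((fst \<circ> snd) ` G)"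
    using chain_set[OF es(2)] finite_G by (intro card_mono) auto
  then have "\<not> distinct (map (fst \<circ> snd) es)"
    using assms(2) es(3) distinct_card[of "map (fst \<circ> snd) es"] by auto
  then obtain xs ys zs m where "map (fst \<circ> snd) es = xs @ [m] @ ys @ [m] @ zs"
    using not_distinct_decomp by blast
  then obtain as r1 where 1: "es = as @ r1" "map (fst \<circ> snd) r1 = m # ys @ m # zs"
    by (auto simp: map_eq_append_conv)
  then obtain e r2 where 2: "r1 = e # r2" "fst (snd e) = m" "map (fst \<circ> snd) r2 = ys @ m # zs"
    by (cases r1) auto
  then obtain bs r3 where 3: "r2 = bs @ r3" "map (fst \<circ> snd) r3 = m # zs"
    by (auto simp: map_eq_append_conv)
  then obtain e' cs where 4: "r3 = e' # cs" "fst (snd e') = m"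
    by (cases r3) auto
  have dec: "es = (as @ [e]) @ (bs @ [e']) @ cs" "fst (snd e) = m" "fst (snd e') = m"
    using 1 2 3 4 by simp_all
  let ?as = "as @ [e]" and ?bs = "bs @ [e']"
  obtain m1 m2 where c: "chain G p ?as m1" "chain G m1 ?bs m2" "chain G m2 cs q"
    using es(2) unfolding dec(1) chain_append[of G p ?as] chain_append[of G _ ?bs cs] by blast
  have "m1 = m" "m2 = m"
    using chain_last[OF c(1)] chain_last[OF c(2)] dec by simp_all
  note c = c[unfolded this]
  let ?x = "fold relax ?as \<nu>"
  show ?thesis
  proof (cases "?x < fold relax ?bs ?x")
    case True
    then show ?thesis
      using improving_cycle[OF es(1) c(1) _ c(2)] by blast
  next
    case False
    then have "fold relax cs (fold relax ?bs ?x) \<le> fold relax cs ?x"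
      using chain_set[OF c(3)] by (intro fold_relax_mono) auto
    then have "r \<le> fold relax (?as @ cs) \<nu>"
      using es(4) dec(1) by simp
    moreover have "chain G p (?as @ cs) q"
      unfolding chain_append[of G p ?as cs] using c by blast
    then have "walk (length (?as @ cs)) q (fold relax (?as @ cs) \<nu>)"
      using es(1) unfolding walk_def by blast
    moreover have "1 \<le> length (?as @ cs)" "length (?as @ cs) < K"
      using es(3) dec(1) by auto
    ultimately show ?thesis by blast
  qed
qed

text \<open>\<open>T k\<close> need only contain values of walks of length \<open>k\<close> that
  dominate all others. A last entry above all earlier ones cannot be matched by a shortened walk, so
  \<open>long_walk\<close> leaves only a positive threshold. If there is no such entry, entries
  before \<open>K\<close> dominate walks of every length.\<close>

theorem positive_walk_iff:
  assumes sound: "\<And>k q r. 1 \<le> k \<Longrightarrow> (q, r) \<in> T k \<Longrightarrow> walk k q r"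
    and complete: "\<And>k q r. 1 \<le> k \<Longrightarrow> walk k q r \<Longrightarrow> \<exists>r' \<ge> r. (q, r') \<in> T k"
    and K: "card ((fst \<circ> snd) ` G) < K"
  shows "(\<exists>k q r. 1 \<le> k \<and> walk k q r \<and> 0 < r) \<longleftrightarrow>
    (\<exists>k q r. 1 \<le> k \<and> k \<le> K \<and> (q, r) \<in> T k \<and> 0 < r) \<or>
    (\<exists>q r. (q, r) \<in> T K \<and> (\<forall>k r'. 1 \<le> k \<and> k < K \<and> (q, r') \<in> T k \<longrightarrow> r' < r))"
    (is "?P \<longleftrightarrow> ?A \<or> ?B")
proof
  assume "?A \<or> ?B"
  then show ?P
  proof
    assume ?B
    then obtain q r where q: "(q, r) \<in> T K" "\<And>k r'. 1 \<le> k \<Longrightarrow> k < K \<Longrightarrow> (q, r') \<in> T k \<Longrightarrow> r' < r"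
      by blast
    have "walk K q r" using K q(1) by (intro sound) auto
    from long_walk[OF this K] show ?P
    proof
      assume "\<exists>k r'. 1 \<le> k \<and> k < K \<and> walk k q r' \<and> r \<le> r'"
      then show ?P
        using complete q(2) by (metis not_le order_trans)
    qed
  qed (use sound in blast)
next
  assume P: ?P
  show "?A \<or> ?B"
  proof (rule ccontr)
    assume neg: "\<not> (?A \<or> ?B)"
    \<comment> \<open>The dominating entry for the prefix is extended by the last edge. If this
      reaches length \<open>K\<close>, the failure of \<open>?B\<close> supplies an entry of an
      earlier table that is at least as large.\<close>
    have dom: "\<exists>k' r'. 1 \<le> k' \<and> k' < K \<and> r \<le> r' \<and> (q, r') \<in> T k'" if "walk (Suc k) q r" for k q r
      using that
    proof (induction k arbitrary: q r)
      case 0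
      then have "(fst \<circ> snd) ` G \<noteq> {}" by (auto simp: walk_1)
      then have "0 < card ((fst \<circ> snd) ` G)"
        using finite_G by (simp add: card_gt_0_iff)
      with K have "1 < K" by linarith
      then show ?case
        using complete[OF _ 0] by fastforce
    next
      case (Suc k)
      then obtain e r0 where e: "e \<in> G" "walk (Suc k) (fst e) r0" "q = fst (snd e)" "r = relax e r0"
        by (subst (asm) walk_Suc) blast
      then obtain k' r' where k': "1 \<le> k'" "k' < K" "r0 \<le> r'" "(fst e, r') \<in> T k'"
        using Suc.IH by blast
      then have "walk (Suc k') q (relax e r')"
        using sound e by (subst walk_Suc) blast
      then obtain r2 where r2: "relax e r' \<le> r2" "(q, r2) \<in> T (Suc k')"
        using complete[of "Suc k'"] by auto
      have "r \<le> r2"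
        using relax_mono[OF e(1) k'(3)] r2(1) e(4) by simp
      show ?case
      proof (cases "Suc k' < K")
        case True
        with \<open>r \<le> r2\<close> r2(2) show ?thesis by (intro exI[of _ "Suc k'"]) auto
      next
        case False
        then have "(q, r2) \<in> T K"
          using k'(2) r2(2) by (simp add: le_less_Suc_eq not_less_eq)
        then obtain k'' r'' where "1 \<le> k''" "k'' < K" "(q, r'') \<in> T k''" "r2 \<le> r''"
          using neg by (meson not_le)
        with \<open>r \<le> r2\<close> show ?thesis by (meson order_trans)
      qed
    qed
    from P obtain k q r where "1 \<le> k" "walk k q r" "0 < r" by blast
    with dom[of "k - 1" q r] neg show False
      by (metis (no_types, lifting) Suc_pred' less_le_trans less_imp_le One_nat_def Suc_le_eq)
  qed
qed

end

section \<open>Exact rationals behind fractions and tables\<close>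

definition frac_ok :: "frac \<Rightarrow> bool" where
  "frac_ok r = (case r of (p, n, b) \<Rightarrow> 0 < b)"

definition edge_ok :: "edge \<Rightarrow> bool" where
  "edge_ok e = (case e of (p, q, w, u, v) \<Rightarrow> frac_ok w \<and> 0 < v \<and> v < u)"

definition wedge_of :: "edge \<Rightarrow> nat wedge" where
  "wedge_of e = (case e of (p, q, w, u, v) \<Rightarrow> (p, q, frac_val w, of_nat u / of_nat v))"

lemma wedge_of_simps [simp]: "fst (wedge_of e) = fst e" "fst (snd (wedge_of e)) = fst (snd e)"
  by (simp_all add: wedge_of_def case_prod_beta)

lemma frac_pos_iff: "frac_ok r \<Longrightarrow> frac_pos r \<longleftrightarrow> 0 < frac_val r"
  by (cases r) (simp add: frac_ok_def frac_pos_def frac_val_def zero_less_divide_iff)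

lemma frac_less_iff:
  assumes "frac_ok r" "frac_ok r'" shows "frac_less r r' \<longleftrightarrow> frac_val r < frac_val r'"
proof -
  obtain p n b p' n' b' where r: "r = (p, n, b)" "r' = (p', n', b')" by (metis prod_cases3)
  have pos: "(0 :: rat) < of_nat b" "(0 :: rat) < of_nat b'"
    using assms by (simp_all add: r frac_ok_def)
  have "frac_less r r' \<longleftrightarrow> (of_nat (p * b' + n' * b) :: rat) < of_nat (p' * b + n * b')"
    unfolding of_nat_less_iff by (simp add: r frac_less_def)
  also have "\<dots> \<longleftrightarrow> (of_nat p - of_nat n :: rat) * of_nat b' < (of_nat p' - of_nat n') * of_nat b"
    by (simp add: algebra_simps)
  also have "\<dots> \<longleftrightarrow> frac_val r < frac_val r'"
    using pos by (simp add: r frac_val_def field_simps)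
  finally show ?thesis .
qed

lemma extend_correct:
  assumes "edge_ok e" "frac_ok r"
  shows "fst (extend e r) = fst (snd e)" "frac_ok (snd (extend e r))"
    "frac_val (snd (extend e r)) = relax (wedge_of e) (frac_val r)"
proof -
  obtain i j p' n' b' u v where e: "e = (i, j, (p', n', b'), u, v)"
    by (metis prod_cases3 surj_pair)
  obtain p n b where r: "r = (p, n, b)" by (metis prod_cases3)
  have pos: "(0 :: rat) < of_nat b" "(0 :: rat) < of_nat b'" "(0 :: rat) < of_nat v"
    using assms by (simp_all add: e r edge_ok_def frac_ok_def)
  show "fst (extend e r) = fst (snd e)" "frac_ok (snd (extend e r))"
    using assms by (simp_all add: e r extend_def frac_step_def frac_ok_def edge_ok_def)
  show "frac_val (snd (extend e r)) = relax (wedge_of e) (frac_val r)"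
    using pos by (simp add: e r extend_def frac_step_def frac_val_def wedge_of_def field_simps)
qed

definition table_ok :: "table \<Rightarrow> bool" where
  "table_ok T \<longleftrightarrow> (\<forall>e \<in> set T. frac_ok (snd e))"

text \<open>A fraction once held is only replaced by larger ones (\<open>keep\<close>), and right
  after \<open>(p, r)\<close> has been scanned the held value is at least that of
  \<open>r\<close>.\<close>

lemma best_max:
  assumes "table_ok T" "(p, r) \<in> set T"
  shows "\<exists>r' rs. best p T = r' # rs \<and> frac_val r \<le> frac_val r'"
proof -
  let ?f = "\<lambda>e acc. if fst e = p
     then (case acc of [] \<Rightarrow> [snd e] | r # _ \<Rightarrow> if frac_less r (snd e) then [snd e] else acc)
     else acc"
  have keep: "\<exists>r' rs. fold ?f T (r0 # l) = r' # rs \<and> frac_val r0 \<le> frac_val r'"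
    if "table_ok T" "frac_ok r0" for T r0 l
    using that
  proof (induction T arbitrary: r0 l)
    case (Cons e T)
    then show ?case
    proof (cases "fst e = p \<and> frac_less r0 (snd e)")
      case True
      then have "frac_val r0 < frac_val (snd e)"
        using Cons.prems frac_less_iff[of r0 "snd e"] by (simp add: table_ok_def)
      moreover have "\<exists>r' rs. fold ?f T [snd e] = r' # rs \<and> frac_val (snd e) \<le> frac_val r'"
        using Cons by (simp add: table_ok_def)
      ultimately show ?thesis using True by fastforce
    qed (auto simp: table_ok_def)
  qed simp
  have "\<exists>r' rs. fold ?f T acc = r' # rs \<and> frac_val r \<le> frac_val r'"
    if "table_ok T" "(p, r) \<in> set T" "\<forall>r \<in> set acc. frac_ok r" for acc
    using that
  proof (induction T arbitrary: acc)
    case (Cons e T)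
    show ?case
    proof (cases "e = (p, r)")
      case True
      show ?thesis
      proof (cases "acc \<noteq> [] \<and> \<not> frac_less (hd acc) r")
        case c: True
        then obtain r0 l where acc: "acc = r0 # l" by (cases acc) auto
        have "frac_val r \<le> frac_val r0"
          using c Cons.prems frac_less_iff[of r0 r] True by (simp add: acc table_ok_def)
        moreover have "\<exists>r' rs. fold ?f T (r0 # l) = r' # rs \<and> frac_val r0 \<le> frac_val r'"
          using Cons.prems by (intro keep) (auto simp: table_ok_def acc)
        ultimately show ?thesis using c by (fastforce simp: True acc)
      next
        case False
        have "\<exists>r' rs. fold ?f T [r] = r' # rs \<and> frac_val r \<le> frac_val r'"
          using Cons.prems True by (intro keep) (auto simp: table_ok_def)
        then show ?thesis using False by (auto simp: True split: list.split)
      qed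
    next
      case False
      have "\<exists>r' rs. fold ?f T (?f e acc) = r' # rs \<and> frac_val r \<le> frac_val r'"
        using Cons.prems False by (intro Cons.IH) (auto simp: table_ok_def split: list.splits if_splits)
      then show ?thesis by simp
    qed
  qed simp
  from this[of "[]"] assms show ?thesis
    by (simp add: best_def)
qed

lemma fold_tables:
  "fold (\<lambda>_ s. (snd s @ fst s, next_table E (snd s))) l ([], T) = (pool, T') \<Longrightarrow>
    T' = (next_table E ^^ length l) T \<and> set pool = (\<Union>k < length l. set ((next_table E ^^ k) T))"
proof (induction l arbitrary: pool T' rule: rev_induct)
  case (snoc a l)
  obtain pool1 T1 where eq: "fold (\<lambda>_ s. (snd s @ fst s, next_table E (snd s))) l ([], T) = (pool1, T1)"
    by (rule prod.exhaust)
  then show ?case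
    using snoc.prems snoc.IH[OF eq] by (auto simp: lessThan_Suc)
qed simp

theorem decide_correct:
  assumes ok: "\<And>e. e \<in> set E \<Longrightarrow> edge_ok e" "frac_ok \<nu>"
  shows "decide E I \<nu> \<longleftrightarrow>
    (\<exists>p \<in> set I. \<exists>es q. es \<noteq> [] \<and> chain (wedge_of ` set E) p es q \<and> 0 < fold relax es (frac_val \<nu>))"
proof -
  let ?G = "wedge_of ` set E"
  interpret discounted_graph ?G "set I" "frac_val \<nu>"
  proof
    fix p q w d assume "(p, q, w, d) \<in> ?G"
    then obtain e where "e \<in> set E" "(p, q, w, d) = wedge_of e" by auto
    with ok(1)[of e] show "1 < d"
      by (cases e) (auto simp: wedge_of_def edge_ok_def)
  qed simp
  \<comment> \<open>Shifted so that \<open>tab k\<close> belongs to walks of length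
    \<open>k\<close>; truncated subtraction makes \<open>tab 0\<close> a copy of
    \<open>tab 1\<close>, so the claims are made for positive \<open>k\<close> only.\<close>
  define tab where "tab k = (next_table E ^^ (k - 1)) (first_table E I \<nu>)" for k
  define T where "T k = (\<lambda>(q, r). (q, frac_val r)) ` set (tab k)" for k
  have tab_1: "tab 1 = first_table E I \<nu>" and tab_Suc: "tab (Suc (Suc k)) = next_table E (tab (Suc k))" for k
    by (simp_all add: tab_def)
  have mem_first: "x \<in> set (first_table E I \<nu>) \<longleftrightarrow> (\<exists>e \<in> set E. fst e \<in> set I \<and> x = extend e \<nu>)" for x
    by (auto simp: first_table_def split: if_splits)
  have mem_next: "x \<in> set (next_table E S) \<longleftrightarrow>
      (\<exists>e \<in> set E. \<exists>r rs. best (fst e) S = r # rs \<and> x = extend e r)" for x S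
  proof -
    have "x \<in> set (case best (fst e) S of [] \<Rightarrow> [] | r # _ \<Rightarrow> [extend e r]) \<longleftrightarrow>
        (\<exists>r rs. best (fst e) S = r # rs \<and> x = extend e r)" for e
      by (cases "best (fst e) S") auto
    then show ?thesis by (simp add: next_table_def)
  qed
  have table_ok: "table_ok (tab (Suc k))" for k
  proof (induction k)
    case 0
    show ?case
      unfolding table_ok_def
    proof
      fix x assume "x \<in> set (tab (Suc 0))"
      then obtain e where "e \<in> set E" "x = extend e \<nu>"
        unfolding tab_1[simplified] mem_first by blast
      then show "frac_ok (snd x)"
        using extend_correct(2)[OF ok] by simp
    qed
  next
    case (Suc k)
    show ?case
      unfolding table_ok_def
    proof
      fix x assume "x \<in> set (tab (Suc (Suc k)))"
      then obtain e r rs where e: "e \<in> set E" "best (fst e) (tab (Suc k)) = r # rs" "x = extend e r"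
        unfolding tab_Suc mem_next by blast
      then have "frac_ok r"
        using Suc best_mem[OF e(2)] by (auto simp: table_ok_def)
      then show "frac_ok (snd x)"
        using extend_correct(2)[OF ok(1)[OF e(1)]] e(3) by simp
    qed
  qed
  have sound: "walk (Suc k) q (frac_val r)" if "(q, r) \<in> set (tab (Suc k))" for k q r
    using that
  proof (induction k arbitrary: q r)
    case 0
    then obtain e where e: "e \<in> set E" "fst e \<in> set I" "(q, r) = extend e \<nu>"
      by (auto simp: tab_1[simplified] mem_first)
    then have "q = fst (snd e)" "frac_val r = relax (wedge_of e) (frac_val \<nu>)"
      using extend_correct[OF ok(1)[OF e(1)] ok(2)] by (metis fst_conv, metis snd_conv)
    with e show ?case by (auto simp: walk_1)
  next
    case (Suc k)
    then obtain e r' rs where e: "e \<in> set E" "best (fst e) (tab (Suc k)) = r' # rs" "(q, r) = extend e r'"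
      unfolding tab_Suc mem_next by blast
    have mem: "(fst e, r') \<in> set (tab (Suc k))" by (rule best_mem[OF e(2)])
    then have "frac_ok r'" using table_ok[of k] by (auto simp: table_ok_def)
    then have "q = fst (snd e)" "frac_val r = relax (wedge_of e) (frac_val r')"
      using extend_correct[OF ok(1)[OF e(1)]] e(3) by (metis fst_conv, metis snd_conv)
    with e(1) Suc.IH[OF mem] show ?case
      by (subst walk_Suc) auto
  qed
  \<comment> \<open>Domination is all that survives: \<open>best\<close> passes on a single
    threshold per source, and monotonicity carries its advantage along the edge.\<close>
  have complete: "\<exists>r'. r \<le> frac_val r' \<and> (q, r') \<in> set (tab (Suc k))" if "walk (Suc k) q r" for k q r
    using that
  proof (induction k arbitrary: q r)
    case 0
    then obtain e where e: "e \<in> set E" "fst e \<in> set I" "q = fst (snd e)" "r = relax (wedge_of e) (frac_val \<nu>)"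
      by (auto simp: walk_1)
    then show ?case
      using extend_correct[OF ok(1)[OF e(1)] ok(2)]
      by (intro exI[of _ "snd (extend e \<nu>)"]) (auto simp: tab_1[simplified] mem_first intro!: bexI[of _ e] prod_eqI)
  next
    case (Suc k)
    then obtain e r0 where e: "e \<in> set E" "walk (Suc k) (fst e) r0" "q = fst (snd e)" "r = relax (wedge_of e) r0"
      by (subst (asm) walk_Suc) auto
    obtain r1 where r1: "r0 \<le> frac_val r1" "(fst e, r1) \<in> set (tab (Suc k))"
      using Suc.IH[OF e(2)] by blast
    obtain r2 rs where r2: "best (fst e) (tab (Suc k)) = r2 # rs" "frac_val r1 \<le> frac_val r2"
      using best_max[OF table_ok r1(2)] by blast
    have "frac_ok r2"
      using best_mem[OF r2(1)] table_ok[of k] by (auto simp: table_ok_def)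
    note ext = extend_correct[OF ok(1)[OF e(1)] this]
    have "r \<le> frac_val (snd (extend e r2))"
      using relax_mono[of "wedge_of e" r0 "frac_val r2"] e r1(1) r2(2) by (simp add: ext)
    moreover have "(q, snd (extend e r2)) \<in> set (tab (Suc (Suc k)))"
      unfolding tab_Suc mem_next using e r2(1) ext(1) by (intro bexI[of _ e]) (auto intro!: prod_eqI)
    ultimately show ?case by blast
  qed
  \<comment> \<open>There are at most as many targets as edges, so this length exceeds their
    number.\<close>
  let ?K = "Suc (length E)"
  have K: "card ((fst \<circ> snd) ` ?G) < ?K"
  proof -
    have "card ((fst \<circ> snd) ` ?G) \<le> card (set E)"
      unfolding image_comp by (rule card_image_le) simp
    also have "\<dots> \<le> length E" by (rule card_length)
    finally show ?thesis by simp
  qed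
  have "(\<exists>p \<in> set I. \<exists>es q. es \<noteq> [] \<and> chain ?G p es q \<and> 0 < fold relax es (frac_val \<nu>)) \<longleftrightarrow>
      (\<exists>k q r. 1 \<le> k \<and> walk k q r \<and> 0 < r)"
    unfolding walk_def by (fastforce simp: Suc_le_eq)
  also have "\<dots> \<longleftrightarrow> (\<exists>k q r. 1 \<le> k \<and> k \<le> ?K \<and> (q, r) \<in> T k \<and> 0 < r) \<or>
    (\<exists>q r. (q, r) \<in> T ?K \<and> (\<forall>k r'. 1 \<le> k \<and> k < ?K \<and> (q, r') \<in> T k \<longrightarrow> r' < r))"
  proof (rule positive_walk_iff[OF _ _ K])
    show "walk k q r" if "1 \<le> k" "(q, r) \<in> T k" for k q r
      using sound[of q _ "k - 1"] that by (auto simp: T_def)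
    show "\<exists>r'\<ge>r. (q, r') \<in> T k" if "1 \<le> k" "walk k q r" for k q r
      using complete[of "k - 1" q r] that by (force simp: T_def)
  qed
  also have "\<dots> \<longleftrightarrow> decide E I \<nu>"
  proof -
    obtain pool S where eq: "tables E I \<nu> = (pool, S)" by (rule prod.exhaust)
    from fold_tables[OF eq[unfolded tables_def]]
    have S: "S = tab ?K" and pool: "set pool = (\<Union>k < length E. set (tab (Suc k)))"
      by (simp_all add: tab_def)
    have pool_iff: "x \<in> set pool \<longleftrightarrow> (\<exists>k. 1 \<le> k \<and> k < ?K \<and> x \<in> set (tab k))" for x
      unfolding pool by (auto simp: Suc_le_eq gr0_conv_Suc)
    have pool_S_iff: "x \<in> set (S @ pool) \<longleftrightarrow> (\<exists>k. 1 \<le> k \<and> k \<le> ?K \<and> x \<in> set (tab k))" for x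
      using pool_iff[of x] S
      by (auto simp: le_less[of _ ?K] conj_disj_distribL conj_disj_distribR ex_disj_distrib)
    have T_mem: "(fst x, frac_val (snd x)) \<in> T k" if "x \<in> set (tab k)" for k x
      unfolding T_def by (rule image_eqI[OF _ that]) (simp add: case_prod_beta)
    have tab_ok: "frac_ok (snd x)" if "1 \<le> k" "x \<in> set (tab k)" for k x
      using table_ok[of "k - 1"] that by (auto simp: table_ok_def)
    have "(\<exists>x \<in> set (S @ pool). frac_pos (snd x)) \<longleftrightarrow> (\<exists>k q r. 1 \<le> k \<and> k \<le> ?K \<and> (q, r) \<in> T k \<and> 0 < r)"
      (is "?l \<longleftrightarrow> ?r")
    proof
      assume ?l
      then obtain k x where "1 \<le> k" "k \<le> ?K" "x \<in> set (tab k)" "frac_pos (snd x)"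
        unfolding Bex_def pool_S_iff by blast
      moreover from this have "0 < frac_val (snd x)"
        using frac_pos_iff[OF tab_ok] by blast
      ultimately show ?r using T_mem by blast
    next
      assume ?r
      then obtain k x where "1 \<le> k" "k \<le> ?K" "x \<in> set (tab k)" "0 < frac_val (snd x)"
        by (auto simp: T_def)
      then show ?l
        unfolding Bex_def pool_S_iff using frac_pos_iff[OF tab_ok] by blast
    qed
    moreover have "(\<exists>x \<in> set S. \<forall>y \<in> set pool. fst y \<noteq> fst x \<or> frac_less (snd y) (snd x)) \<longleftrightarrow>
      (\<exists>q r. (q, r) \<in> T ?K \<and> (\<forall>k r'. 1 \<le> k \<and> k < ?K \<and> (q, r') \<in> T k \<longrightarrow> r' < r))" (is "?l' \<longleftrightarrow> ?r'")
    proof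
      assume ?l'
      then obtain x where x: "x \<in> set (tab ?K)" "\<And>y. y \<in> set pool \<Longrightarrow> fst y \<noteq> fst x \<or> frac_less (snd y) (snd x)"
        unfolding S by blast
      have "(fst x, frac_val (snd x)) \<in> T ?K"
        by (rule T_mem[OF x(1)])
      moreover have "r' < frac_val (snd x)" if k: "1 \<le> k" "k < ?K" and r': "(fst x, r') \<in> T k" for k r'
      proof -
        obtain y where y: "y \<in> set (tab k)" "fst y = fst x" "r' = frac_val (snd y)"
          using r' by (auto simp: T_def)
        then have "frac_less (snd y) (snd x)"
          using x(2)[of y] pool_iff k by blast
        then show ?thesis
          using frac_less_iff tab_ok[OF k(1) y(1)] tab_ok[OF _ x(1)] y(3) by simp
      qed
      ultimately show ?r' by blast
    next
      assume ?r'
      then obtain x where x: "x \<in> set (tab ?K)"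
        "\<And>k r'. 1 \<le> k \<Longrightarrow> k < ?K \<Longrightarrow> (fst x, r') \<in> T k \<Longrightarrow> r' < frac_val (snd x)"
        by (auto simp: T_def)
      have "fst y \<noteq> fst x \<or> frac_less (snd y) (snd x)" if y: "y \<in> set pool" for y
      proof -
        obtain k where k: "1 \<le> k" "k < ?K" "y \<in> set (tab k)"
          using iffD1[OF pool_iff y] by blast
        show ?thesis
        proof (cases "fst y = fst x")
          case True
          then have "frac_val (snd y) < frac_val (snd x)"
            using x(2)[OF k(1,2)] T_mem[OF k(3)] by simp
          then show ?thesis
            using frac_less_iff[OF tab_ok[OF k(1,3)] tab_ok[OF _ x(1)]] by simp
        qed simp
      qed
      then show ?l' using x(1) S by blast
    qed
    ultimately show ?thesis
      by (simp only: decide_def eq prod.case)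
  qed
  finally show ?thesis by simp
qed

section \<open>Automata and their encodings\<close>

text \<open>Letters are dropped: a walk in this graph can be labelled afterwards with those of the
  transitions behind its edges.\<close>

definition graph_of :: "('q \<Rightarrow> nat) \<Rightarrow> ('q, 'a) nmda \<Rightarrow> nat wedge set" where
  "graph_of f A = (\<lambda>(p, a, q). (f p, f q, weight A (p, a, q), discount A (p, a, q))) ` trans A"

text \<open>This recursion is the origin of \<open>relax\<close>: \<open>w + y / d < x\<close> iff
  \<open>y < (x - w) * d\<close>, as \<open>d\<close> is positive.\<close>

lemma run_value_Cons:
  "run_value A (a # u) (p # ps) =
    weight A (p, a, ps ! 0) + run_value A u ps / discount A (p, a, ps ! 0)"
  by (simp add: run_value_def Let_def sum.lessThan_Suc_shift prod.lessThan_Suc_shift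
      sum_divide_distrib del: sum.lessThan_Suc prod.lessThan_Suc)

text \<open>After a common first transition both sides pose the same question about the remainder
  with the relaxed threshold, so \<open>x\<close> has to vary in the induction.\<close>

lemma chain_iff_run:
  assumes "is_nmda A" "inj_on f (states A)" "p \<in> states A"
  shows "(\<exists>es q. length es = n \<and> chain (graph_of f A) (f p) es q \<and> 0 < fold relax es x) \<longleftrightarrow>
    (\<exists>u ps. length u = n \<and> length ps = Suc n \<and> ps ! 0 = p \<and>
      (\<forall>i < n. (ps ! i, u ! i, ps ! Suc i) \<in> trans A) \<and> run_value A u ps < x)"
  using assms(3)
proof (induction n arbitrary: p x)
  case 0
  have "run_value A [] [p] = 0" by (simp add: run_value_def)
  moreover have "ps = [p]" if "length ps = Suc 0" "ps ! 0 = p" for ps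
    using that by (cases ps) auto
  ultimately show ?case
    by (auto intro!: exI[of _ "[p]"])
next
  case (Suc n)
  let ?L = "\<lambda>p x. \<exists>es q. length es = n \<and> chain (graph_of f A) (f p) es q \<and> 0 < fold relax es x"
  let ?R = "\<lambda>p x. \<exists>u ps. length u = n \<and> length ps = Suc n \<and> ps ! 0 = p \<and>
      (\<forall>i < n. (ps ! i, u ! i, ps ! Suc i) \<in> trans A) \<and> run_value A u ps < x"
  have tr: "trans A \<subseteq> states A \<times> alphabet A \<times> states A" "\<And>t. t \<in> trans A \<Longrightarrow> 1 < discount A t"
    using assms(1) by (auto simp: is_nmda_def)
  let ?M = "\<lambda>Q. \<exists>a p'. (p, a, p') \<in> trans A \<and> Q p' ((x - weight A (p, a, p')) * discount A (p, a, p'))"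
  have "(\<exists>es q. length es = Suc n \<and> chain (graph_of f A) (f p) es q \<and> 0 < fold relax es x) \<longleftrightarrow> ?M ?L"
    (is "?A \<longleftrightarrow> ?B")
  proof
    assume ?A
    then obtain e es q where es: "length es = n" "e \<in> graph_of f A" "fst e = f p"
        "chain (graph_of f A) (fst (snd e)) es q" "0 < fold relax es (relax e x)"
      by (auto simp: length_Suc_conv)
    then obtain p0 a p' where t: "(p0, a, p') \<in> trans A" "f p0 = f p"
        "e = (f p0, f p', weight A (p0, a, p'), discount A (p0, a, p'))"
      by (auto simp: graph_of_def)
    \<comment> \<open>Numbers identify states, so the walk leaves the state at which the run is to
      start.\<close>
    then have "p0 = p"
      using tr(1) Suc.prems assms(2) by (auto dest: inj_onD)
    with t es show ?B by auto
  next
    assume ?B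
    then obtain a p' es q where t: "(p, a, p') \<in> trans A" "length es = n"
      "chain (graph_of f A) (f p') es q"
      "0 < fold relax es ((x - weight A (p, a, p')) * discount A (p, a, p'))" by blast
    moreover have "(f p, f p', weight A (p, a, p'), discount A (p, a, p')) \<in> graph_of f A"
      using t(1) by (force simp: graph_of_def)
    ultimately show ?A
      by (intro exI[of _ "(f p, f p', weight A (p, a, p'), discount A (p, a, p')) # es"]) auto
  qed
  also have "\<dots> \<longleftrightarrow> ?M ?R"
  proof -
    have *: "?L p' y \<longleftrightarrow> ?R p' y" if "(p, a, p') \<in> trans A" for a p' y
      using Suc.IH[of p' y] that tr(1) by blast
    show ?thesis
      by (intro iff_exI conj_cong refl) (rule *)
  qed
  also have "\<dots> \<longleftrightarrow> (\<exists>u ps. length u = Suc n \<and> length ps = Suc (Suc n) \<and> ps ! 0 = p \<and>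
      (\<forall>i < Suc n. (ps ! i, u ! i, ps ! Suc i) \<in> trans A) \<and> run_value A u ps < x)" (is "?B \<longleftrightarrow> ?A")
  proof
    assume ?B
    then obtain a p' u ps where t: "(p, a, p') \<in> trans A" "length u = n" "length ps = Suc n" "ps ! 0 = p'"
        "\<forall>i < n. (ps ! i, u ! i, ps ! Suc i) \<in> trans A"
        "run_value A u ps < (x - weight A (p, a, p')) * discount A (p, a, p')"
      by blast
    have "run_value A (a # u) (p # ps) < x"
      using t(6) tr(2)[OF t(1)] by (simp add: run_value_Cons t(4) pos_divide_less_eq field_simps)
    moreover have "\<forall>i < Suc n. ((p # ps) ! i, (a # u) ! i, (p # ps) ! Suc i) \<in> trans A"
      using t by (auto simp: less_Suc_eq_0_disj)
    ultimately show ?A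
      using t by (intro exI[of _ "a # u"] exI[of _ "p # ps"]) simp
  next
    assume ?A
    then obtain u' ps' where t': "length u' = Suc n" "length ps' = Suc (Suc n)" "ps' ! 0 = p"
        "\<forall>i < Suc n. (ps' ! i, u' ! i, ps' ! Suc i) \<in> trans A" "run_value A u' ps' < x"
      by blast
    obtain a u where u': "u' = a # u" using t'(1) by (cases u') auto
    obtain ps where ps': "ps' = p # ps" using t'(2,3) by (cases ps') auto
    have t: "length u = n" "length ps = Suc n"
        "\<forall>i < Suc n. ((p # ps) ! i, (a # u) ! i, ps ! i) \<in> trans A"
        "run_value A (a # u) (p # ps) < x"
      using t' by (simp_all add: u' ps')
    have 0: "(p, a, ps ! 0) \<in> trans A" using t(3) by fastforce
    have "\<forall>i < n. (ps ! i, u ! i, ps ! Suc i) \<in> trans A"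
      using t(3) by fastforce
    moreover have "run_value A u ps < (x - weight A (p, a, ps ! 0)) * discount A (p, a, ps ! 0)"
      using t(4) tr(2)[OF 0] by (simp add: run_value_Cons pos_divide_less_eq field_simps)
    ultimately show ?B
      using 0 t(1,2) by blast
  qed
  finally show ?case .
qed

lemma finite_runs:
  assumes "is_nmda A" shows "finite (runs A u)"
proof (rule finite_subset)
  show "finite {ps. set ps \<subseteq> states A \<and> length ps = Suc (length u)}"
    using assms by (intro finite_lists_length_eq) (simp add: is_nmda_def)
  show "runs A u \<subseteq> {ps. set ps \<subseteq> states A \<and> length ps = Suc (length u)}"
  proof
    fix ps assume ps: "ps \<in> runs A u"
    have "ps ! i \<in> states A" if "i < length ps" for i
    proof (cases i)
      case 0
      then show ?thesis using ps assms by (auto simp: runs_def is_nmda_def)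
    next
      case (Suc j)
      then have "(ps ! j, u ! j, ps ! Suc j) \<in> trans A"
        using ps that by (auto simp: runs_def)
      then show ?thesis using assms Suc by (auto simp: is_nmda_def)
    qed
    then show "ps \<in> {ps. set ps \<subseteq> states A \<and> length ps = Suc (length u)}"
      using ps by (auto simp: runs_def set_conv_nth)
  qed
qed

lemma nmda_value_less_iff:
  assumes "is_nmda A"
  shows "nmda_value A u < ereal (of_rat \<nu>) \<longleftrightarrow> (\<exists>ps \<in> runs A u. run_value A u ps < \<nu>)"
proof (cases "runs A u = {}")
  case False
  then have "Min (run_value A u ` runs A u) < \<nu> \<longleftrightarrow> (\<exists>ps \<in> runs A u. run_value A u ps < \<nu>)"
    using finite_runs[OF assms, of u] by (subst Min_less_iff) auto
  then show ?thesis
    using False by (simp add: nmda_value_def of_rat_less)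
qed (simp add: nmda_value_def)

text \<open>The value is a minimum over finitely many runs, so undercutting the threshold means that
  one run does. The letters along a run lie in the alphabet automatically.\<close>

lemma ex_word_iff_chain:
  assumes "is_nmda A" "inj_on f (states A)"
  shows "(\<exists>u \<in> lists (alphabet A). u \<noteq> [] \<and> nmda_value A u < ereal (of_rat \<nu>)) \<longleftrightarrow>
    (\<exists>p \<in> f ` initial A. \<exists>es q. es \<noteq> [] \<and> chain (graph_of f A) p es q \<and> 0 < fold relax es \<nu>)"
    (is "?l \<longleftrightarrow> ?r")
proof -
  have init: "initial A \<subseteq> states A" and tr: "trans A \<subseteq> states A \<times> alphabet A \<times> states A"
    using assms(1) by (auto simp: is_nmda_def)
  have "?l \<longleftrightarrow> (\<exists>p \<in> initial A. \<exists>n > 0. \<exists>u ps. length u = n \<and> length ps = Suc n \<and> ps ! 0 = p \<and>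
      (\<forall>i < n. (ps ! i, u ! i, ps ! Suc i) \<in> trans A) \<and> run_value A u ps < \<nu>)" (is "_ \<longleftrightarrow> ?m")
  proof
    assume ?l
    then obtain u ps where "u \<noteq> []" "ps \<in> runs A u" "run_value A u ps < \<nu>"
      unfolding nmda_value_less_iff[OF assms(1)] by blast
    then show ?m
      by (intro bexI[of _ "ps ! 0"] exI[of _ "length u"] exI[of _ u] exI[of _ ps] conjI)
        (auto simp: runs_def)
  next
    assume ?m
    then obtain u ps where u: "u \<noteq> []" "length ps = Suc (length u)" "ps ! 0 \<in> initial A"
        "\<forall>i < length u. (ps ! i, u ! i, ps ! Suc i) \<in> trans A" "run_value A u ps < \<nu>"
      by (metis length_greater_0_conv)
    then have "set u \<subseteq> alphabet A"
      using tr by (fastforce simp: in_set_conv_nth)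
    with u show ?l
      unfolding nmda_value_less_iff[OF assms(1)] by (auto simp: runs_def lists_eq_set)
  qed
  also have "\<dots> \<longleftrightarrow> (\<exists>p \<in> initial A. \<exists>n > 0. \<exists>es q. length es = n \<and> chain (graph_of f A) (f p) es q \<and>
      0 < fold relax es \<nu>)"
    using init by (intro bex_cong[OF refl] ex_cong1 conj_cong refl chain_iff_run[OF assms, symmetric]) auto
  also have "\<dots> \<longleftrightarrow> ?r" by auto
  finally show ?thesis .
qed

section \<open>Decoding rationals and transitions\<close>

definition rat_tokens :: "rat \<Rightarrow> token list" where
  "rat_tokens r = (case quotient_of r of (a, b) \<Rightarrow> [(a < 0, nat \<bar>a\<bar>), (False, nat b)])"

definition frac_of_rat :: "rat \<Rightarrow> frac" where
  "frac_of_rat r = (case quotient_of r of (a, b) \<Rightarrow> frac_of (a < 0, nat \<bar>a\<bar>) (False, nat b))"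

text \<open>The sign is dropped because discount factors are positive.\<close>

definition discount_of_rat :: "rat \<Rightarrow> nat \<times> nat" where
  "discount_of_rat r = (case quotient_of r of (a, b) \<Rightarrow> (nat \<bar>a\<bar>, nat b))"

lemma frac_of_rat: "frac_ok (frac_of_rat r)" "frac_val (frac_of_rat r) = r"
proof -
  obtain a b where ab: "quotient_of r = (a, b)" by (metis surj_pair)
  have b: "0 < b" and r: "r = of_int a / of_int b"
    using quotient_of_denom_pos[OF ab] quotient_of_div[OF ab] by auto
  have eq: "frac_of_rat r = frac_of (a < 0, nat \<bar>a\<bar>) (False, nat b)"
    by (simp add: frac_of_rat_def ab)
  show "frac_ok (frac_of_rat r)"
    using b by (simp add: eq frac_of_def frac_ok_def)
  show "frac_val (frac_of_rat r) = r"
    using b unfolding eq by (simp add: frac_of_def frac_val_def r)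
qed

lemma discount_of_rat:
  assumes "1 < r" "discount_of_rat r = (u, v)"
  shows "0 < v" "v < u" "of_nat u / of_nat v = r"
proof -
  obtain a b where ab: "quotient_of r = (a, b)" by (metis surj_pair)
  have b: "0 < b" and r: "r = of_int a / of_int b"
    using quotient_of_denom_pos[OF ab] quotient_of_div[OF ab] by auto
  have uv: "u = nat \<bar>a\<bar>" "v = nat b"
    using assms(2) by (simp_all add: discount_of_rat_def ab)
  have "b < a"
    using assms(1) b by (simp add: r)
  then show "0 < v" "v < u" "of_nat u / of_nat v = r"
    using b by (simp_all add: uv r)
qed

text \<open>Digits come most significant first, so the induction on \<open>k\<close> peels off bit
  \<open>k\<close> while \<open>a\<close> collects the prefix already read.\<close>

lemma lex_digits:
  "fold lex_step (map (\<lambda>i. if bit n i then 2 else 1) (rev [0..<k])) (a, s) = (a * 2 ^ k + take_bit k n, s)"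
proof (induction k arbitrary: a)
  case (Suc k)
  obtain neg seg segs where s: "s = (neg, seg, segs)" by (metis prod_cases3)
  have "lex_step (if bit n k then 2 else 1) (a, s) = (shift_in (bit n k) a, s)"
    by (simp add: lex_step_def s)
  then show ?case
    using Suc[of "shift_in (bit n k) a"]
    by (simp add: shift_in_def take_bit_Suc_from_most algebra_simps)
qed simp

lemma lex_nat_code:
  "fold lex_step (nat_code n) (0, neg, seg, segs) = (0, False, (neg, n) # seg, segs)"
proof -
  have "n < 2 ^ floorlog 2 n"
    using floorlog_leD[OF order_refl] by simp
  then show ?thesis
    by (simp add: nat_code_def lex_digits take_bit_nat_eq_self) (simp add: lex_step_def)
qed

lemma lex_rat_code:
  "fold lex_step (rat_code r) (0, False, seg, segs) = (0, False, rev (rat_tokens r) @ seg, segs)"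
proof -
  obtain a b where ab: "quotient_of r = (a, b)" by (metis surj_pair)
  have "lex_step 5 (0, False, seg, segs) = (0, True, seg, segs)"
    by (simp add: lex_step_def)
  then show ?thesis
    by (simp add: rat_code_def rat_tokens_def ab lex_nat_code)
qed

lemma lex_concat:
  assumes "\<And>x seg. x \<in> set xs \<Longrightarrow> fold lex_step (c x) (0, False, seg, segs) = (0, False, rev (t x) @ seg, segs)"
  shows "fold lex_step (concat (map c xs)) (0, False, seg, segs) =
    (0, False, rev (concat (map t xs)) @ seg, segs)"
  using assms by (induction xs arbitrary: seg) auto

context
  fixes A :: "(nat, nat) nmda" and f g :: "nat \<Rightarrow> nat"
begin

definition trans_code :: "nat \<times> nat \<times> nat \<Rightarrow> nat list" where
  "trans_code = (\<lambda>(p, a, q). nat_code (f p) @ nat_code (g a) @ nat_code (f q) @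
     rat_code (weight A (p, a, q)) @ rat_code (discount A (p, a, q)))"

definition trans_tokens :: "nat \<times> nat \<times> nat \<Rightarrow> token list" where
  "trans_tokens = (\<lambda>(p, a, q). (False, f p) # (False, g a) # (False, f q) #
     rat_tokens (weight A (p, a, q)) @ rat_tokens (discount A (p, a, q)))"

definition edge_of :: "nat \<times> nat \<times> nat \<Rightarrow> edge" where
  "edge_of = (\<lambda>(p, a, q). (f p, f q, frac_of_rat (weight A (p, a, q)), discount_of_rat (discount A (p, a, q))))"

lemma lex_trans_code:
  "fold lex_step (trans_code t) (0, False, seg, segs) = (0, False, rev (trans_tokens t) @ seg, segs)"
  by (cases t) (simp add: trans_code_def trans_tokens_def lex_nat_code lex_rat_code)

lemma group_trans_tokens:
  "fold group_step (rev (trans_tokens t)) ([], E) = ([], edge_of t # E)"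
  by (cases t) (auto simp: trans_tokens_def rat_tokens_def edge_of_def frac_of_rat_def
      discount_of_rat_def group_step_def split: prod.split)

lemma group_tokens:
  "fold group_step (rev (concat (map trans_tokens ts))) ([], E) = ([], map edge_of ts @ E)"
  by (induction ts) (simp_all add: group_trans_tokens)

lemma solve_correct:
  assumes A: "is_nmda A" "inj_on f (states A)" and "is": "set is = initial A" and ts: "set ts = trans A"
    and w: "w = rat_code \<nu> @ concat (map trans_code ts) @ [4] @ concat (map (\<lambda>q. nat_code (f q)) is) @ [4] @
      nat_code n @ nat_code m"
  shows "solve (rev w) \<longleftrightarrow> (\<exists>u \<in> lists (alphabet A). u \<noteq> [] \<and> nmda_value A u < ereal (of_rat \<nu>))"
proof -
  let ?E = "map edge_of ts"
  let ?I = "rev (map (\<lambda>q. (False, f q)) is)"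
  let ?S = "rev (concat (map trans_tokens ts)) @ rev (rat_tokens \<nu>)"
  have "fold lex_step (concat (map (\<lambda>q. nat_code (f q)) is)) (0, False, [], [?S]) =
      (0, False, ?I, [?S])"
    using lex_concat[of "is" "\<lambda>q. nat_code (f q)" "[?S]" "\<lambda>q. [(False, f q)]" "[]"]
    by (simp add: lex_nat_code)
  moreover have "lex_step 4 (acc, neg, seg, segs) = (acc, neg, [], seg # segs)" for acc neg seg segs
    by (simp add: lex_step_def)
  \<comment> \<open>The numbers of states and letters are left in the unclosed segment, which
    \<open>solve\<close> ignores.\<close>
  ultimately have lex: "fold lex_step w (0, False, [], []) = (0, False, [(False, m), (False, n)], [?I, ?S])"
    using lex_concat[of ts trans_code "[]" trans_tokens]
    by (simp add: w lex_rat_code lex_trans_code lex_nat_code)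
  obtain i j where q: "quotient_of \<nu> = (i, j)" by (rule prod.exhaust)
  define a b where "a = (i < 0, nat \<bar>i\<bar>)" and "b = (False, nat j)"
  then have ab: "rat_tokens \<nu> = [a, b]" "frac_of a b = frac_of_rat \<nu>"
    by (simp_all add: rat_tokens_def frac_of_rat_def q)
  have group: "fold group_step ?S ([], []) = ([a, b], ?E)"
    by (simp add: group_tokens) (simp add: ab group_step_def)
  have "solve (rev w) \<longleftrightarrow> decide ?E (map snd ?I) (frac_of_rat \<nu>)"
    by (simp only: solve_def rev_rev_ident lex prod.case list.case group ab(2))
  also have "\<dots> \<longleftrightarrow> (\<exists>p \<in> set (map snd ?I). \<exists>es q. es \<noteq> [] \<and> chain (wedge_of ` set ?E) p es q \<and>
      0 < fold relax es (frac_val (frac_of_rat \<nu>)))"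
  proof (rule decide_correct)
    fix e assume "e \<in> set ?E"
    then obtain p a q where t: "(p, a, q) \<in> trans A" "e = edge_of (p, a, q)"
      using ts by auto
    then have "1 < discount A (p, a, q)"
      using A(1) by (auto simp: is_nmda_def)
    from discount_of_rat(1,2)[OF this] show "edge_ok e"
      by (auto simp: t(2) edge_of_def edge_ok_def frac_of_rat split: prod.split)
  qed (rule frac_of_rat)
  also have "wedge_of ` set ?E = graph_of f A"
  proof -
    have "wedge_of (edge_of (p, a, q)) = (f p, f q, weight A (p, a, q), discount A (p, a, q))"
      if "(p, a, q) \<in> trans A" for p a q
    proof -
      have "1 < discount A (p, a, q)"
        using A(1) that by (auto simp: is_nmda_def)
      from discount_of_rat(3)[OF this] show ?thesis
        by (auto simp: edge_of_def wedge_of_def frac_of_rat split: prod.split)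
    qed
    then show ?thesis
      by (force simp: graph_of_def ts image_image intro!: image_cong)
  qed
  also have "set (map snd ?I) = f ` initial A"
    by (simp add: image_image "is")
  finally show ?thesis
    unfolding ex_word_iff_chain[OF A] frac_of_rat .
qed

end

section \<open>The complete machine\<close>

definition push_symbol :: "nat \<Rightarrow> com" where
  "push_symbol c = Pop 0 ;; push_all (rev (code (enc c))) ;; Push 1 2"

text \<open>No instruction transports an unknown symbol, so the five cases are told apart and each
  pushes a constant. Consing onto the list on stack 1 reverses the input.\<close>

definition take_symbol :: com where
  "take_symbol = Cond 0 {1} (push_symbol 1) (Cond 0 {2} (push_symbol 2) (Cond 0 {3} (push_symbol 3)
     (Cond 0 {4} (push_symbol 4) (push_symbol 5))))"

definition load :: "nat set \<Rightarrow> com" where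
  "load X = While 0 X take_symbol"

lemma wf_load [simp]: "wf_com take_symbol" "wf_com (load X)"
proof -
  have "wf_com (push_symbol c)" for c
    using set_code[of "enc c"] by (auto simp: push_symbol_def)
  then show "wf_com take_symbol" "wf_com (load X)"
    by (simp_all add: take_symbol_def load_def)
qed

lemma push_symbol:
  assumes "c \<le> 5"
  shows "reaches (push_symbol c) (st (c # w) (code (enc l) @ d) e r k) 40 (st w (code (enc (c # l)) @ d) e r k)"
proof -
  \<comment> \<open>Three bits make a code of at most \<open>4 * 3 + 1\<close> symbols, each pushed
    in two steps.\<close>
  have "c < 2 ^ 3" using assms by simp
  then have "sz c \<le> 13" using sz_nat_le[of c 3] by simp
  then have "reaches (push_all (rev (code (enc c)))) (st w (code (enc l) @ d) e r k) 30
      (st w (code (enc c) @ code (enc l) @ d) e r k)"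
    using push_all[of "rev (code (enc c))" w "code (enc l) @ d" e r k]
    by (auto simp: sz_def elim: reaches_mono)
  from reaches_Seq[OF this, of "Push 1 2" 2]
  have "reaches (push_all (rev (code (enc c))) ;; Push 1 2) (st w (code (enc l) @ d) e r k) 32
      (st w (code (enc (c # l)) @ d) e r k)"
    by simp
  then show ?thesis
    by (auto simp: push_symbol_def elim: reaches_mono)
qed

lemma take_symbol:
  assumes "0 < c" "c \<le> 5"
  shows "reaches take_symbol (st (c # w) (code (enc l) @ d) e r k) 50 (st w (code (enc (c # l)) @ d) e r k)"
proof -
  let ?r = "\<lambda>p n. reaches p (st (c # w) (code (enc l) @ d) e r k) n (st w (code (enc (c # l)) @ d) e r k)"
  have push: "?r (push_symbol c) n" if "40 \<le> n" for n
    using push_symbol[OF assms(2)] that by (rule reaches_mono)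
  have "c = 1 \<or> c = 2 \<or> c = 3 \<or> c = 4 \<or> c = 5"
    using assms by auto
  then show ?thesis
    unfolding take_symbol_def using push by (intro reaches_Cond) auto
qed

text \<open>Reading stops at a symbol outside \<open>X\<close>; the end of the input is covered too,
  as it shows symbol \<open>0\<close>. A round costs 50 for the symbol and 2 for the loop.\<close>

lemma load:
  assumes "set xs \<subseteq> X" "X \<subseteq> {1..5}" "peek (st ys [] [] [] []) 0 \<notin> X"
  shows "reaches (load X) (st (xs @ ys) (code (enc l) @ d) e r k) (52 * length xs + 1)
    (st ys (code (enc (rev xs @ l)) @ d) e r k)"
  using assms(1)
proof (induction xs arbitrary: l)
  case Nil
  have "peek (st ys (code (enc l) @ d) e r k) 0 = peek (st ys [] [] [] []) 0"
    by (simp add: peek_def)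
  then show ?case
    using assms(3) by (auto simp: load_def intro!: reaches_WhileF)
next
  case (Cons x xs)
  have "reaches (load X) (st ((x # xs) @ ys) (code (enc l) @ d) e r k) (50 + (52 * length xs + 1) + 2)
      (st ys (code (enc (rev xs @ x # l)) @ d) e r k)"
    unfolding load_def
  proof (rule reaches_WhileT)
    show "reaches take_symbol (st ((x # xs) @ ys) (code (enc l) @ d) e r k) 50
        (st (xs @ ys) (code (enc (x # l)) @ d) e r k)"
      using Cons.prems assms(2) take_symbol[of x "xs @ ys" l d e r k] by fastforce
    show "reaches (While 0 X take_symbol) (st (xs @ ys) (code (enc (x # l)) @ d) e r k) (52 * length xs + 1)
        (st ys (code (enc (rev xs @ x # l)) @ d) e r k)"
      using Cons.IH[of "x # l"] Cons.prems by (simp add: load_def)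
  qed (use Cons.prems in simp)
  then show ?case by simp
qed

text \<open>If the threshold is directly followed by the symbol \<open>4\<close>, there are no transitions. The rest of
  the input must then not be read, since its length is not bounded in terms of \<^const>\<open>nmda_size\<close>.\<close>

definition main_com :: "com \<Rightarrow> com" where
  "main_com p = Push 1 1 ;; load {1, 2, 5} ;; take_symbol ;; load {1, 2, 5} ;; take_symbol ;;
     Cond 0 {4} (Push 1 1) (load {1..5} ;; p)"

text \<open>A rational is two digit strings, each closed by \<open>3\<close>, so the threshold can
  be read in time linear in its own length, without touching the rest \<open>w\<close>.\<close>

lemma read_threshold:
  assumes "set xs \<subseteq> {1, 2, 5}" "set ys \<subseteq> {1, 2, 5}"
    and "reaches c (st w (code (enc (rev (xs @ [3] @ ys @ [3])))) [] [] []) n s"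
  shows "reaches (Push 1 1 ;; load {1, 2, 5} ;; take_symbol ;; load {1, 2, 5} ;; take_symbol ;; c)
    (input_store (xs @ [3] @ ys @ [3] @ w)) (52 * (length xs + length ys) + 104 + n) s"
proof -
  have inp: "input_store v = st v [] [] [] []" for v
    by (auto simp: input_store_def st_def fun_eq_iff)
  have 1: "reaches (load {1, 2, 5}) (st (xs @ 3 # ys @ 3 # w) (code (enc ([] :: nat list)) @ []) [] [] [])
      (52 * length xs + 1) (st (3 # ys @ 3 # w) (code (enc (rev xs @ [])) @ []) [] [] [])"
    by (rule load) (use assms(1) in auto)
  have 2: "reaches take_symbol (st (3 # ys @ 3 # w) (code (enc (rev xs @ [])) @ []) [] [] []) 50
      (st (ys @ 3 # w) (code (enc (3 # rev xs @ [])) @ []) [] [] [])"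
    by (rule take_symbol) auto
  have 3: "reaches (load {1, 2, 5}) (st (ys @ 3 # w) (code (enc (3 # rev xs @ [])) @ []) [] [] [])
      (52 * length ys + 1) (st (3 # w) (code (enc (rev ys @ 3 # rev xs @ [])) @ []) [] [] [])"
    by (rule load) (use assms(2) in auto)
  have 4: "reaches take_symbol (st (3 # w) (code (enc (rev ys @ 3 # rev xs @ [])) @ []) [] [] []) 50
      (st w (code (enc (3 # rev ys @ 3 # rev xs @ [])) @ []) [] [] [])"
    by (rule take_symbol) auto
  have 5: "reaches c (st w (code (enc (3 # rev ys @ 3 # rev xs @ [])) @ []) [] [] []) n s"
    using assms(3) by simp
  from reaches_Seq[OF 1 reaches_Seq[OF 2 reaches_Seq[OF 3 reaches_Seq[OF 4 5]]]]
  show ?thesis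
    by (auto simp: inp elim: reaches_mono)
qed

lemma set_nat_code: "set (nat_code n) \<subseteq> {1, 2, 3}"
  by (auto simp: nat_code_def)

lemma nat_code_split: "\<exists>xs. set xs \<subseteq> {1, 2} \<and> nat_code n = xs @ [3]"
  by (auto simp: nat_code_def)

lemma rat_code_split: "\<exists>xs ys. set xs \<subseteq> {1, 2, 5} \<and> set ys \<subseteq> {1, 2, 5} \<and> rat_code r = xs @ [3] @ ys @ [3]"
proof -
  obtain a b where ab: "quotient_of r = (a, b)" by (rule prod.exhaust)
  obtain xs where xs: "set xs \<subseteq> {1, 2}" "nat_code (nat \<bar>a\<bar>) = xs @ [3]"
    using nat_code_split by blast
  obtain ys where ys: "set ys \<subseteq> {1, 2}" "nat_code (nat b) = ys @ [3]"
    using nat_code_split by blast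
  show ?thesis
    using xs ys
    by (intro exI[of _ "(if a < 0 then [5] else []) @ xs"] exI[of _ ys]) (auto simp: rat_code_def ab)
qed

lemma set_rat_code: "set (rat_code r) \<subseteq> {1, 2, 3, 5}"
  using rat_code_split[of r] by auto

lemma length_nat_code_le: "n \<le> m \<Longrightarrow> length (nat_code n) \<le> m + 1"
proof -
  assume "n \<le> m"
  also have "m < 2 ^ m" by (rule less_exp)
  finally show ?thesis
    by (simp add: nat_code_def floorlog_leI)
qed

lemma length_rat_code_le: "length (rat_code r) \<le> rat_length r + 3"
  by (auto simp: rat_code_def rat_length_def nat_code_def split: prod.split)

text \<open>One transition makes both sets nonempty; by completeness every state is then the source
  of a transition and every letter labels one.\<close>

lemma card_le_card_trans:
  assumes "is_nmda A" "trans A \<noteq> {}"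
  shows "card (states A) \<le> card (trans A)" "card (alphabet A) \<le> card (trans A)"
proof -
  have fin: "finite (trans A)"
    using assms(1) by (auto simp: is_nmda_def intro: finite_subset)
  obtain p a q where t: "(p, a, q) \<in> trans A" using assms(2) by (metis ex_in_conv prod_cases3)
  then have "p \<in> states A" "a \<in> alphabet A" using assms(1) by (auto simp: is_nmda_def)
  then have "states A \<subseteq> fst ` trans A" "alphabet A \<subseteq> (fst \<circ> snd) ` trans A"
    using assms(1) by (force simp: is_nmda_def image_iff Bex_def)+
  then show "card (states A) \<le> card (trans A)" "card (alphabet A) \<le> card (trans A)"
    using fin by (meson card_image_le card_mono finite_imageI order_trans)+
qed

lemma nmda_size_bounds:
  assumes "is_nmda A"
  shows "card (trans A) \<le> nmda_size (A, \<nu>)" "rat_length \<nu> \<le> nmda_size (A, \<nu>)"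
    "t \<in> trans A \<Longrightarrow> rat_length (weight A t) \<le> nmda_size (A, \<nu>)"
    "t \<in> trans A \<Longrightarrow> rat_length (discount A t) \<le> nmda_size (A, \<nu>)"
proof -
  have "finite (trans A)"
    using assms by (auto simp: is_nmda_def intro: finite_subset)
  then show "card (trans A) \<le> nmda_size (A, \<nu>)" "rat_length \<nu> \<le> nmda_size (A, \<nu>)"
    "t \<in> trans A \<Longrightarrow> rat_length (weight A t) \<le> nmda_size (A, \<nu>)"
    "t \<in> trans A \<Longrightarrow> rat_length (discount A t) \<le> nmda_size (A, \<nu>)"
    unfolding nmda_size.simps by - (rule Max_ge; auto)+
qed

lemma length_concat_le: "(\<And>x. x \<in> set xs \<Longrightarrow> length (c x) \<le> b) \<Longrightarrow> length (concat (map c xs)) \<le> length xs * b"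
  by (induction xs) (auto intro: add_mono)

text \<open>The summands follow the encoding: threshold, transitions with three numbers and two
  rationals each, separator, initial states, separator, and the two cardinalities.\<close>

definition input_bound :: "nat \<Rightarrow> nat" where
  "input_bound n = (n + 3) + n * (5 * n + 9) + 1 + n * (n + 1) + 1 + (n + 1) + (n + 1)"

lemma length_encoding_le:
  assumes A: "is_nmda A" "trans A \<noteq> {}"
    and f: "bij_betw f (states A) {..<card (states A)}" and g: "bij_betw g (alphabet A) {..<card (alphabet A)}"
    and "is": "distinct is" "set is = initial A" and ts: "distinct ts" "set ts = trans A"
    and w: "w = rat_code \<nu> @ concat (map (trans_code A f g) ts) @ [4] @ concat (map (\<lambda>q. nat_code (f q)) is) @ [4] @
      nat_code (card (states A)) @ nat_code (card (alphabet A))"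
  shows "length w \<le> input_bound (nmda_size (A, \<nu>))"
proof -
  let ?n = "nmda_size (A, \<nu>)"
  note n = nmda_size_bounds[OF A(1), where \<nu> = \<nu>]
  have card: "card (states A) \<le> ?n" "card (alphabet A) \<le> ?n"
    using card_le_card_trans[OF A] n(1) by auto
  have tr: "trans A \<subseteq> states A \<times> alphabet A \<times> states A" and init: "initial A \<subseteq> states A"
    using A(1) by (auto simp: is_nmda_def)
  have fp: "length (nat_code (f p)) \<le> ?n + 1" if "p \<in> states A" for p
    using bij_betwE[OF f] that card(1) by (intro length_nat_code_le) (auto dest: bspec)
  have ga: "length (nat_code (g a)) \<le> ?n + 1" if "a \<in> alphabet A" for a
    using bij_betwE[OF g] that card(2) by (intro length_nat_code_le) (auto dest: bspec)
  have rat: "length (rat_code r) \<le> ?n + 3" if "rat_length r \<le> ?n" for r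
    using length_rat_code_le[of r] that by simp
  have "length (trans_code A f g t) \<le> 5 * ?n + 9" if "t \<in> set ts" for t
  proof -
    obtain p a q where t: "t = (p, a, q)" by (metis prod_cases3)
    then have "p \<in> states A" "a \<in> alphabet A" "q \<in> states A" and mem: "(p, a, q) \<in> trans A"
      using that ts(2) tr by auto
    then show ?thesis
      using fp[of p] ga[of a] fp[of q] rat[OF n(3)[OF mem]] rat[OF n(4)[OF mem]]
      by (simp add: t trans_code_def)
  qed
  then have "length (concat (map (trans_code A f g) ts)) \<le> length ts * (5 * ?n + 9)"
    by (rule length_concat_le)
  also have "\<dots> \<le> ?n * (5 * ?n + 9)"
    using distinct_card[OF ts(1)] ts(2) n(1) by (intro mult_right_mono) auto
  finally have 1: "length (concat (map (trans_code A f g) ts)) \<le> ?n * (5 * ?n + 9)" .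
  have "length (concat (map (\<lambda>q. nat_code (f q)) is)) \<le> length is * (?n + 1)"
    using fp init "is"(2) by (intro length_concat_le) auto
  also have "\<dots> \<le> ?n * (?n + 1)"
  proof (rule mult_right_mono)
    have "length is = card (initial A)"
      using distinct_card[OF "is"(1)] "is"(2) by simp
    also have "\<dots> \<le> card (states A)"
      using A(1) by (intro card_mono) (auto simp: is_nmda_def)
    finally show "length is \<le> ?n" using card(1) by simp
  qed simp
  finally have 2: "length (concat (map (\<lambda>q. nat_code (f q)) is)) \<le> ?n * (?n + 1)" .
  show ?thesis
    using 1 2 rat[OF n(2)] length_nat_code_le[OF card(1)] length_nat_code_le[OF card(2)]
    unfolding w input_bound_def by simp
qed

lemma set_encoding:
  "set (rat_code \<nu> @ concat (map (trans_code A f g) ts) @ [4] @ concat (map (\<lambda>q. nat_code (f q)) is) @ [4] @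
      nat_code n @ nat_code m) \<subseteq> {1..5}"
proof -
  have "set (trans_code A f g t) \<subseteq> {1..5}" for t
    using set_nat_code set_rat_code by (cases t) (fastforce simp: trans_code_def)
  moreover have "set (nat_code k) \<subseteq> {1..5}" for k using set_nat_code[of k] by auto
  moreover have "set (rat_code \<nu>) \<subseteq> {1..5}" using set_rat_code[of \<nu>] by auto
  ultimately show ?thesis by (simp add: UN_subset_iff)
qed

theorem theorem5p5:
  "ptime_decidable {(A :: (nat, nat) nmda, \<nu> :: rat). is_nmda A} nmda_encodes nmda_size
     (\<lambda>(A, \<nu>). \<exists>u \<in> lists (alphabet A). u \<noteq> [] \<and> nmda_value A u < ereal (of_rat \<nu>))"
proof -
  obtain p T where p: "wf_com p" "poly_bounded sz T" and
    reaches_p: "\<And>x i d e r c. reaches p (st i (code (enc x) @ d) e r c) (T x) (st i (code (enc (solve x)) @ d) e r c)"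
    using polytime_solve by (rule polytimeE) blast
  obtain q where q: "\<And>x. T x \<le> poly q (sz x)"
    using p(2) unfolding poly_bounded_def by blast
  define L where "L = main_com p"
  let ?M = "accept_machine L"
  have wf: "wf_com L"
    using p(1) by (simp add: L_def main_com_def)
  \<comment> \<open>The terms cover reading the threshold, the short rejecting branch, loading the
    rest and running \<open>p\<close>, plus one step for the final branch. The factor 14 is a symbol
    code of length 13 with its list cell.\<close>
  define b where "b n = 1 + (52 * input_bound n + 104 + (52 * (n + 3) + (4 + (52 * input_bound n + 1 +
    poly q (1 + input_bound n * 14)))))" for n
  have "poly_bounded (\<lambda>n. n) b"
    unfolding b_def input_bound_def by (intro pb_intros poly_bounded_id)
  then obtain bp where bp: "\<And>n. b n \<le> poly bp n"
    unfolding poly_bounded_def by blast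
  have main: "set w \<subseteq> {0<..<tm_symbols ?M} \<and> (\<exists>t \<le> poly bp (nmda_size (A, \<nu>)).
      tm_state_after ?M w t = (if \<exists>u \<in> lists (alphabet A). u \<noteq> [] \<and> nmda_value A u < ereal (of_rat \<nu>)
        then tm_acc ?M else tm_rej ?M))" (is "_ \<and> (\<exists>t \<le> _. _ = (if ?P then _ else _))")
    if A: "is_nmda A" and enc: "nmda_encodes (A, \<nu>) w" for A :: "(nat, nat) nmda" and \<nu> w
  proof -
    let ?n = "nmda_size (A, \<nu>)"
    obtain f g "is" ts where f: "bij_betw f (states A) {..<card (states A)}"
      and g: "bij_betw g (alphabet A) {..<card (alphabet A)}"
      and "is": "distinct is" "set is = initial A" and ts: "distinct ts" "set ts = trans A"
      and w: "w = rat_code \<nu> @ concat (map (trans_code A f g) ts) @ [4] @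
        concat (map (\<lambda>q. nat_code (f q)) is) @ [4] @ nat_code (card (states A)) @ nat_code (card (alphabet A))"
      using enc unfolding nmda_encodes.simps trans_code_def by blast
    have set_w: "set w \<subseteq> {1..5}"
      unfolding w by (rule set_encoding)
    have symbols: "tm_symbols ?M = 6"
      by (simp add: accept_machine_def Let_def machine_def)
    have inj: "inj_on f (states A)"
      using f by (rule bij_betw_imp_inj_on)
    have solve: "solve (rev w) \<longleftrightarrow> ?P"
      by (rule solve_correct[OF A inj "is"(2) ts(2) w])
    obtain xs ys where xy: "set xs \<subseteq> {1, 2, 5}" "set ys \<subseteq> {1, 2, 5}" "rat_code \<nu> = xs @ [3] @ ys @ [3]"
      using rat_code_split by blast
    obtain v where v: "w = xs @ [3] @ ys @ [3] @ v"
      "v = concat (map (trans_code A f g) ts) @ [4] @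
        concat (map (\<lambda>q. nat_code (f q)) is) @ [4] @ nat_code (card (states A)) @ nat_code (card (alphabet A))"
      using w xy(3) by simp
    have xy_len: "length xs + length ys \<le> ?n + 3"
      using length_rat_code_le[of \<nu>] nmda_size_bounds(2)[OF A, of \<nu>] xy(3) by simp
    let ?s = "st v (code (enc (rev (xs @ [3] @ ys @ [3])))) [] [] []"
    have "\<exists>s. reaches L (input_store w) (b ?n - 1) s \<and> (peek s 1 = 2 \<longleftrightarrow> ?P)"
    proof (cases "trans A = {}")
      case True
      \<comment> \<open>By completeness there are no letters or no states, so no nonempty word over
        the alphabet has a run. The pushed \<open>1\<close> makes the final branch reject.\<close>
      then have "alphabet A = {} \<or> states A = {}"
        using A by (fastforce simp: is_nmda_def)
      then have no: "\<not> ?P"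
      proof
        assume "states A = {}"
        then have "runs A u = {}" for u
          using A by (auto simp: runs_def is_nmda_def)
        then show ?thesis by (simp add: nmda_value_def)
      qed (auto simp: lists_eq_set)
      have "v = 4 # concat (map (\<lambda>q. nat_code (f q)) is) @ [4] @ nat_code (card (states A)) @ nat_code (card (alphabet A))"
        using v(2) ts(2) True by simp
      then have "reaches (Cond 0 {4} (Push 1 1) (load {1..5} ;; p)) ?s 4 (?s(1 := 1 # ?s 1))"
        by (intro reaches_Cond) auto
      from read_threshold[OF xy(1,2) this]
      have "reaches L (input_store w) (52 * (length xs + length ys) + 104 + 4) (?s(1 := 1 # ?s 1))"
        unfolding L_def main_com_def v(1) by simp
      then have "reaches L (input_store w) (b ?n - 1) (?s(1 := 1 # ?s 1))"
        by (rule reaches_mono) (use xy_len in \<open>simp add: b_def\<close>)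
      then show ?thesis
        using no by (intro exI[of _ "?s(1 := 1 # ?s 1)"]) (simp add: peek_def)
    next
      case False
      have len: "length w \<le> input_bound ?n"
        using length_encoding_le[OF A False f g "is" ts w] .
      have set_v: "set v \<subseteq> {1..5}"
        using set_w v(1) by simp
      have "reaches (load {1..5}) (st (v @ []) (code (enc (rev (xs @ [3] @ ys @ [3]))) @ []) [] [] [])
          (52 * length v + 1) (st [] (code (enc (rev v @ rev (xs @ [3] @ ys @ [3]))) @ []) [] [] [])"
        by (rule load) (use set_v in auto)
      also have "rev v @ rev (xs @ [3] @ ys @ [3]) = rev w"
        by (simp add: v(1))
      finally have "reaches (load {1..5}) ?s (52 * length v + 1) (st [] (code (enc (rev w)) @ []) [] [] [])"
        by (simp only: append_Nil2)
      from reaches_Seq[OF this reaches_p]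
      have "reaches (load {1..5} ;; p) ?s (52 * length v + 1 + T (rev w)) (st [] (code (enc (solve (rev w))) @ []) [] [] [])" .
      \<comment> \<open>The code of a transition begins with a digit or, for the number
        \<open>0\<close>, with \<open>3\<close>, so it cannot be mistaken for the end of the
        list.\<close>
      moreover have "peek ?s 0 \<noteq> 4"
      proof -
        obtain t ts' where "ts = t # ts'" using False ts(2) by (cases ts) auto
        moreover obtain p a q where "t = (p, a, q)" by (metis prod_cases3)
        moreover obtain zs where "set zs \<subseteq> {1, 2}" "nat_code (f p) = zs @ [3]"
          using nat_code_split by blast
        ultimately show ?thesis
          by (cases zs) (auto simp: v(2) trans_code_def peek_def)
      qed
      ultimately have "reaches (Cond 0 {4} (Push 1 1) (load {1..5} ;; p)) ?s
          (52 * length v + 1 + T (rev w) + 1) (st [] (code (enc (solve (rev w))) @ []) [] [] [])"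
        by (intro reaches_CondF) auto
      from read_threshold[OF xy(1,2) this]
      have "reaches L (input_store w) (52 * (length xs + length ys) + 104 + (52 * length v + 1 + T (rev w) + 1))
          (st [] (code (enc (solve (rev w))) @ []) [] [] [])"
        unfolding L_def main_com_def v(1) by simp
      moreover have "52 * (length xs + length ys) + 104 + (52 * length v + 1 + T (rev w) + 1) \<le> b ?n - 1"
      proof -
        have "sz c \<le> 13" if "c \<in> set (rev w)" for c
        proof -
          have "c < 2 ^ 3" using that set_w by auto
          then show ?thesis using sz_nat_le[of c 3] by simp
        qed
        then have "sz (rev w) \<le> 1 + length (rev w) * (13 + 1)"
          by (rule sz_list_le)
        also have "\<dots> \<le> 1 + input_bound ?n * 14"
          using len by simp
        finally have "T (rev w) \<le> poly q (1 + input_bound ?n * 14)"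
          using q[of "rev w"] poly_nat_mono order_trans by blast
        then show ?thesis
          using len unfolding b_def by (simp add: v(1))
      qed
      ultimately have "reaches L (input_store w) (b ?n - 1) (st [] (code (enc (solve (rev w))) @ []) [] [] [])"
        by (rule reaches_mono)
      then show ?thesis
        using solve by (intro exI conjI) (auto simp: enc_bool_def peek_def)
    qed
    then obtain s t where t: "t \<le> b ?n - 1" "exec L (input_store w) t s" "peek s 1 = 2 \<longleftrightarrow> ?P"
      by (auto simp: reaches_def)
    have "Suc t \<le> poly bp ?n"
      using t(1) bp[of ?n] by (simp add: b_def)
    moreover have "tm_state_after ?M w (Suc t) = (if ?P then tm_acc ?M else tm_rej ?M)"
      using accept_machine_halts[OF t(2) wf] t(3) by simp
    moreover have "set w \<subseteq> {0<..<tm_symbols ?M}"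
      using set_w by (auto simp: symbols)
    ultimately show ?thesis by blast
  qed
  have "\<forall>x \<in> {(A :: (nat, nat) nmda, \<nu> :: rat). is_nmda A}. \<forall>w. nmda_encodes x w \<longrightarrow>
      set w \<subseteq> {0<..<tm_symbols ?M} \<and>
      (\<exists>t \<le> poly bp (nmda_size x). tm_state_after ?M w t =
        (if case x of (A, \<nu>) \<Rightarrow> \<exists>u \<in> lists (alphabet A). u \<noteq> [] \<and> nmda_value A u < ereal (of_rat \<nu>)
         then tm_acc ?M else tm_rej ?M))"
  proof (intro ballI allI impI)
    fix x :: "(nat, nat) nmda \<times> rat" and w
    assume x: "x \<in> {(A, \<nu>). is_nmda A}" and enc: "nmda_encodes x w"
    obtain A \<nu> where "x = (A, \<nu>)" by (rule prod.exhaust)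
    with x enc main[of A \<nu> w]
    show "set w \<subseteq> {0<..<tm_symbols ?M} \<and>
      (\<exists>t \<le> poly bp (nmda_size x). tm_state_after ?M w t =
        (if case x of (A, \<nu>) \<Rightarrow> \<exists>u \<in> lists (alphabet A). u \<noteq> [] \<and> nmda_value A u < ereal (of_rat \<nu>)
         then tm_acc ?M else tm_rej ?M))"
      by (simp only: mem_Collect_eq prod.case)
  qed
  with is_tm_accept_machine[OF wf] show ?thesis
    unfolding ptime_decidable_def by blast
qed

end
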